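(* There exists a constant $C > 0$ such that for all real $0 < \alpha < 1$, with corresponding spectral radius order $k = k\left( \frac{1-\alpha}{2\alpha} \right)$, and all $r \in \mathbb{N}$, the following hold: \begin{enumerate} \item if $k < \infty$ and $r \geq 2^{1/\alpha^{C (k-1)}}$, then $N^{\mathbb{R}}_{\alpha}(r) = \left \lfloor \frac{k}{k-1} (r-1) \right \rfloor$; \item if $k < \infty$ and $2^{1/\alpha^C} \leq r < 2^{1/\alpha^{C (k-1)}}$, then $N^{\mathbb{R}}_{\alpha}(r) \leq r + \frac{C r \log(1/\alpha)}{\log\log r}$; \item if $k = \infty$ and $r \geq 2^{1/\alpha^C}$, then $N^{\mathbb{R}}_{\alpha}(r) \leq r + \frac{C r \log(1/\alpha)}{\log\log r}$. \end{enumerate}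
   Context: $\mathbb{N}$ is the set of positive integers. Lines $l_1,\dots,l_n$ through the origin in $\mathbb{R}^r$ are equiangular with common angle $\arccos(\alpha)$ if, choosing a unit vector $v_i$ along each $l_i$, one has $|\langle v_i, v_j\rangle| = \alpha$ for all $i \neq j$. $N^{\mathbb{R}}_\alpha(r)$ denotes the maximum number of equiangular lines in $\mathbb{R}^r$ with common angle $\arccos(\alpha)$. For real $\lambda$, the spectral radius order $k(\lambda)$ is the least number of vertices of a (finite simple) graph whose adjacency matrix has largest eigenvalue exactly $\lambda$; $k(\lambda)=\infty$ if no such graph exists. Here $\log$ is the natural logarithm. *)

theory Defs
  imports
    "HOL-Library.Extended_Nat"
    "Jordan_Normal_Form.Char_Poly"
    "Graph_Theory.Pair_Digraph"
begin

section \<open>Equiangular lines\<close>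

definition line_through_origin :: "nat \<Rightarrow> real vec set \<Rightarrow> bool" where
  "line_through_origin r l \<longleftrightarrow>
     (\<exists>v \<in> carrier_vec r. v \<noteq> 0\<^sub>v r \<and> l = {c \<cdot>\<^sub>v v | c. True})"

definition unit_vector :: "real vec \<Rightarrow> bool" where
  "unit_vector v \<longleftrightarrow> v \<bullet> v = 1"

text \<open>
  A line contains exactly two unit vectors, which differ by a sign, so quantifying over all
  of them is the same as choosing one on each line.
\<close>
definition equiangular_lines :: "nat \<Rightarrow> real \<Rightarrow> real vec set set \<Rightarrow> bool" where
  "equiangular_lines r \<alpha> L \<longleftrightarrow>
     (\<forall>l \<in> L. line_through_origin r l) \<and>
     (\<forall>l \<in> L. \<forall>m \<in> L. l \<noteq> m \<longrightarrow>
        (\<forall>u \<in> l. \<forall>v \<in> m. unit_vector u \<longrightarrow> unit_vector v \<longrightarrow> \<bar>u \<bullet> v\<bar> = \<alpha>))"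

definition max_equiangular_lines :: "real \<Rightarrow> nat \<Rightarrow> nat" where
  "max_equiangular_lines \<alpha> r = Max {card L | L. finite L \<and> equiangular_lines r \<alpha> L}"

lemma unit_vector_on_line:
  assumes "line_through_origin r l"
  shows "\<exists>u \<in> l. u \<in> carrier_vec r \<and> unit_vector u"
proof -
  obtain v where v: "v \<in> carrier_vec r" "v \<noteq> 0\<^sub>v r" "l = {c \<cdot>\<^sub>v v | c. True}"
    using assms unfolding line_through_origin_def by blast
  have "\<exists>i < r. v $ i \<noteq> 0"
    using v(1,2) by (metis carrier_vecD eq_vecI index_zero_vec(1) index_zero_vec(2))
  then obtain i where "i < r" "v $ i \<noteq> 0" by blast
  then have "0 < (\<Sum>i<r. v $ i * v $ i)"
    by (intro sum_pos2[of _ i]) (auto simp: zero_less_mult_iff linorder_neq_iff)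
  then have pos: "0 < v \<bullet> v"
    using v(1) by (simp add: scalar_prod_def atLeast0LessThan)
  define c where "c = 1 / sqrt (v \<bullet> v)"
  have "c * c * (v \<bullet> v) = 1"
    using pos by (simp add: c_def)
  then have "unit_vector (c \<cdot>\<^sub>v v)"
    using v(1) by (simp add: unit_vector_def)
  moreover have "c \<cdot>\<^sub>v v \<in> l" "c \<cdot>\<^sub>v v \<in> carrier_vec r"
    using v by auto
  ultimately show ?thesis by blast
qed

text \<open>
  Gerzon's bound: the matrices \<open>u u\<^sup>T\<close> are linearly independent. It shows that the set whose
  maximum is taken above is finite.
\<close>
lemma card_equiangular_lines_le:
  fixes \<alpha> :: real
  assumes \<alpha>: "0 \<le> \<alpha>" "\<alpha> < 1" and fin: "finite L" and L: "equiangular_lines r \<alpha> L"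
  shows "card L \<le> r * r"
proof (rule ccontr)
  define n where "n = card L"
  assume "\<not> card L \<le> r * r"
  then have n: "r * r < n" by (simp add: n_def)
  obtain f where f: "bij_betw f {0..<n} L"
    using fin ex_bij_betw_nat_finite unfolding n_def by blast
  have "\<exists>u. u \<in> f i \<and> u \<in> carrier_vec r \<and> unit_vector u" if "i < n" for i
    using that f L unit_vector_on_line unfolding equiangular_lines_def
    by (metis atLeastLessThan_iff bij_betwE zero_le)
  then obtain u where u: "\<And>i. i < n \<Longrightarrow> u i \<in> f i \<and> u i \<in> carrier_vec r \<and> unit_vector (u i)"
    by metis
  have ang: "(u i \<bullet> u j)\<^sup>2 = (if i = j then 1 else \<alpha>\<^sup>2)" if ij: "i < n" "j < n" for i j
  proof (cases "i = j")
    case True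
    then show ?thesis using u[OF ij(1)] by (simp add: unit_vector_def)
  next
    case False
    then have "f i \<noteq> f j" "f i \<in> L" "f j \<in> L"
      using f ij by (auto simp: bij_betw_def inj_on_def)
    then have "\<bar>u i \<bullet> u j\<bar> = \<alpha>"
      using L u ij unfolding equiangular_lines_def by blast
    then show ?thesis using False by (metis power2_abs)
  qed
  define A where "A = mat n n (\<lambda>(p, i). if p < r * r then u i $ (p div r) * u i $ (p mod r) else 0)"
  have A: "A \<in> carrier_mat n n" by (simp add: A_def)
  have "det A = 0"
  proof -
    have "A = mat\<^sub>r n n (\<lambda>p. if p = r * r then 0\<^sub>v n else row A p)"
      using n by (intro eq_matI) (auto simp: A_def)
    then show ?thesis
      using det_row_0[OF n, of "row A"] A by auto
  qed
  then obtain c where c: "c \<in> carrier_vec n" "c \<noteq> 0\<^sub>v n" "A *\<^sub>v c = 0\<^sub>v n"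
    using det_0_iff_vec_prod_zero_field[OF A] by blast
  have rel: "(\<Sum>i<n. c $ i * (u i $ a * u i $ b)) = 0" if ab: "a < r" "b < r" for a b
  proof -
    have p: "a * r + b < r * r"
    proof -
      have "a * r + b < Suc a * r" using ab by simp
      also have "\<dots> \<le> r * r" using ab by (intro mult_right_mono) auto
      finally show ?thesis .
    qed
    have "(A *\<^sub>v c) $ (a * r + b) = 0" using c p n by simp
    then show ?thesis
      using p n c(1) ab by (simp add: A_def scalar_prod_def atLeast0LessThan mult.commute)
  qed
  have ip: "(u i \<bullet> u j)\<^sup>2 = (\<Sum>a<r. \<Sum>b<r. (u i $ a * u i $ b) * (u j $ a * u j $ b))"
    if "i < n" "j < n" for i j
  proof -
    have "dim_vec (u j) = r" using u that by auto
    then have "u i \<bullet> u j = (\<Sum>a<r. u i $ a * u j $ a)"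
      by (simp add: scalar_prod_def atLeast0LessThan)
    then show ?thesis
      by (simp add: power2_eq_square sum_product mult_ac)
  qed
  have inner0: "(\<Sum>i<n. c $ i * (u i \<bullet> u j)\<^sup>2) = 0" if j: "j < n" for j
  proof -
    have "(\<Sum>i<n. c $ i * (u i \<bullet> u j)\<^sup>2)
        = (\<Sum>i<n. \<Sum>a<r. \<Sum>b<r. c $ i * (u i $ a * u i $ b) * (u j $ a * u j $ b))"
      using j by (intro sum.cong refl) (simp add: ip sum_distrib_left mult.assoc)
    also have "\<dots> = (\<Sum>a<r. \<Sum>i<n. \<Sum>b<r. c $ i * (u i $ a * u i $ b) * (u j $ a * u j $ b))"
      by (rule sum.swap)
    also have "\<dots> = (\<Sum>a<r. \<Sum>b<r. \<Sum>i<n. c $ i * (u i $ a * u i $ b) * (u j $ a * u j $ b))"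
      by (intro sum.cong refl sum.swap)
    also have "\<dots> = (\<Sum>a<r. \<Sum>b<r. (\<Sum>i<n. c $ i * (u i $ a * u i $ b)) * (u j $ a * u j $ b))"
      by (simp add: sum_distrib_right)
    also have "\<dots> = 0" using rel by simp
    finally show ?thesis .
  qed
  define s where "s = (\<Sum>i<n. c $ i)"
  have lin: "(1 - \<alpha>\<^sup>2) * c $ j + \<alpha>\<^sup>2 * s = 0" if j: "j < n" for j
  proof -
    have "0 = (\<Sum>i<n. c $ i * (if i = j then 1 else \<alpha>\<^sup>2))"
      using inner0[OF j] j by (simp add: ang)
    also have "\<dots> = (\<Sum>i<n. \<alpha>\<^sup>2 * c $ i + (if i = j then (1 - \<alpha>\<^sup>2) * c $ i else 0))"
      by (intro sum.cong) (auto simp: algebra_simps)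
    also have "\<dots> = \<alpha>\<^sup>2 * s + (1 - \<alpha>\<^sup>2) * c $ j"
      using j by (simp add: sum.distrib s_def sum_distrib_left sum.delta)
    finally show ?thesis by simp
  qed
  have a1: "0 < 1 - \<alpha>\<^sup>2" using \<alpha> by (simp add: power_less_one_iff abs_square_less_1)
  have "(\<Sum>j<n. (1 - \<alpha>\<^sup>2) * c $ j + \<alpha>\<^sup>2 * s) = 0" using lin by simp
  then have "(1 - \<alpha>\<^sup>2) * (\<Sum>j<n. c $ j) + \<alpha>\<^sup>2 * (real n * s) = 0"
    by (simp only: sum.distrib sum_distrib_left[symmetric] sum_constant card_lessThan)
  then have "(1 - \<alpha>\<^sup>2 + real n * \<alpha>\<^sup>2) * s = 0"
    unfolding s_def[symmetric] by (simp add: algebra_simps)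
  moreover have "0 < 1 - \<alpha>\<^sup>2 + real n * \<alpha>\<^sup>2" using a1 by (simp add: add_pos_nonneg)
  ultimately have "s = 0" by simp
  then have "c $ j = 0" if "j < n" for j using lin[OF that] a1 by simp
  then have "c = 0\<^sub>v n" using c(1) by (intro eq_vecI) auto
  then show False using c(2) by simp
qed

section \<open>Spectral radius order\<close>

text \<open>The rows and columns are indexed by the vertices, which are assumed to be \<open>0, \<dots>, n - 1\<close>.\<close>
definition adjacency_matrix :: "nat pair_pre_digraph \<Rightarrow> real mat" where
  "adjacency_matrix G =
     (let n = card (pverts G) in mat n n (\<lambda>(i, j). if (i, j) \<in> parcs G then 1 else 0))"

text \<open>The adjacency matrix of a graph is real symmetric, so considering real eigenvalues suffices.\<close>
definition is_largest_eigenvalue :: "real mat \<Rightarrow> real \<Rightarrow> bool" where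
  "is_largest_eigenvalue A \<mu> \<longleftrightarrow> eigenvalue A \<mu> \<and> (\<forall>\<nu>. eigenvalue A \<nu> \<longrightarrow> \<nu> \<le> \<mu>)"

text \<open>
  The predicate \<^const>\<open>pair_graph\<close> describes finite simple graphs: the arc relation is symmetric
  and has no loops. Every graph is isomorphic to one with vertices \<open>0, \<dots>, n - 1\<close>. The infimum
  of the empty set is \<open>\<infinity>\<close>.
\<close>
definition spectral_radius_order :: "real \<Rightarrow> enat" where
  "spectral_radius_order \<mu> =
     Inf {enat (card (pverts G)) | G :: nat pair_pre_digraph.
            pair_graph G \<and> pverts G = {..<card (pverts G)} \<and>
            is_largest_eigenvalue (adjacency_matrix G) \<mu>}"

end

theory Submission
  imports Defs "HOL-Analysis.Function_Topology" "HOL-Real_Asymp.Real_Asymp"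
begin

text \<open>
  Put \<open>\<mu> = (1 - \<alpha>) / (2 * \<alpha>)\<close>, choose a unit vector on each of \<open>n\<close> lines, and join two of
  them when their inner product is \<open>- \<alpha>\<close>. If \<open>A\<close> is the adjacency operator of this graph and \<open>J\<close>
  the all-ones operator, then the Gram matrix is \<open>2 * \<alpha>\<close> times \<open>\<mu> - A + J / 2\<close>. So
  \<open>\<mu> - A + J / 2\<close> is positive semidefinite of rank at most \<open>r\<close>, and \<open>n - r\<close> is bounded by the
  dimension of its kernel, which consists of eigenvectors of \<open>A\<close> for \<open>\<mu>\<close>, up to one dimension.

  Negating vectors changes the graph but not the lines. If \<open>n\<close> is large, Ramsey's argument yields
  a large set of vectors with pairwise positive inner products, because pairwise negative ones
  are at most \<open>1 / \<alpha> + 1\<close> many. Negating each further vector that has many neighbours in this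
  set, one obtains a graph whose degrees are \<open>O(1 / \<alpha>\<^sup>2)\<close> (\<open>bounded_degree_switching\<close>).

  There are two cases. If \<open>\<mu> - A\<close> is itself positive semidefinite, then every eigenvector for
  \<open>\<mu>\<close> has constant sign or vanishes on each component, so the dimension of the kernel is less than the
  number of components with largest eigenvalue \<open>\<mu>\<close>, unless both are zero; each of these components
  has at least \<open>k\<close> vertices, and \<open>k * (n - r + 1) \<le> n\<close> follows (\<open>card_bound_if_bounded\<close>). Otherwise some
  component \<open>C\<close> has a larger eigenvalue. All eigenvectors for \<open>\<mu>\<close> live on \<open>C\<close>, where \<open>\<mu>\<close> can only be
  the second eigenvalue, and the multiplicity of that one in a connected graph of bounded degree is
  sublinear (\<open>card_bound_if_unbounded\<close>): delete from \<open>C\<close> a sparse net, at distance at most \<open>R\<close> from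
  every vertex, and a small ball that contains all vertices whose neighbourhood of radius \<open>R * q\<close> has
  an eigenvalue above \<open>\<mu>\<close>. Every vertex has a walk of length \<open>R\<close> that the deletion of the net destroys,
  so on the remaining neighbourhoods the operator norm of the \<open>R\<close>-th power drops noticeably below
  \<open>\<mu> ^ R\<close>; counting closed walks of length \<open>2 * R * q\<close> then leaves room for few eigenvectors. With
  \<open>R\<close> and \<open>q\<close> of the right size the multiplicity is \<open>O(n * ln (1 / \<alpha>) / ln (ln n))\<close>.

  Conversely, if \<open>G\<close> is a graph on \<open>k\<close> vertices with largest eigenvalue \<open>\<mu>\<close>, the matrix
  \<open>\<mu> - A\<close> of \<open>G\<close> is the Gram matrix of vectors in dimension \<open>k - 1\<close>. Placing copies of these vectors, and
  isolated vertices, in orthogonal subspaces and adding a common coordinate gives the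
  \<open>\<lfloor>k * (r - 1) / (k - 1)\<rfloor>\<close> lines (\<open>equiangular_family_construction\<close>).
\<close>

section \<open>Inner products and homogeneous linear systems\<close>

text \<open>
  Vectors are functions on a finite index set \<open>V\<close>, since the dimension varies within the proof.
  Many of them are required to vanish outside \<open>V\<close>.
\<close>
definition ip :: "'a set \<Rightarrow> ('a \<Rightarrow> real) \<Rightarrow> ('a \<Rightarrow> real) \<Rightarrow> real" where
  "ip V x y = (\<Sum>v\<in>V. x v * y v)"

lemma ip_commute: "ip V x y = ip V y x"
  by (simp add: ip_def mult.commute)

lemma ip_self_nonneg: "0 \<le> ip V x x"
  by (simp add: ip_def sum_nonneg)

lemma ip_self_eq_0: "finite V \<Longrightarrow> ip V x x = 0 \<longleftrightarrow> (\<forall>v\<in>V. x v = 0)"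
  by (simp add: ip_def sum_nonneg_eq_0_iff)

lemma ip_add: "ip V (\<lambda>v. x v + y v) z = ip V x z + ip V y z"
              "ip V z (\<lambda>v. x v + y v) = ip V z x + ip V z y"
  by (simp_all add: ip_def algebra_simps sum.distrib)

lemma ip_diff: "ip V (\<lambda>v. x v - y v) z = ip V x z - ip V y z"
               "ip V z (\<lambda>v. x v - y v) = ip V z x - ip V z y"
  by (simp_all add: ip_def algebra_simps sum_subtractf)

lemma ip_scale: "ip V (\<lambda>v. c * x v) z = c * ip V x z"
                "ip V z (\<lambda>v. c * x v) = c * ip V z x"
  by (simp_all add: ip_def sum_distrib_left mult_ac)

lemma ip_sum: "ip V (\<lambda>v. \<Sum>i\<in>I. f i v) z = (\<Sum>i\<in>I. ip V (f i) z)"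
              "ip V z (\<lambda>v. \<Sum>i\<in>I. f i v) = (\<Sum>i\<in>I. ip V z (f i))"
  unfolding ip_def sum_distrib_left sum_distrib_right by (rule sum.swap)+

lemma ip_abs: "ip V (\<lambda>v. \<bar>x v\<bar>) (\<lambda>v. \<bar>x v\<bar>) = ip V x x"
  by (simp add: ip_def abs_mult_self_eq)

definition point :: "'a \<Rightarrow> 'a \<Rightarrow> real" where
  "point p v = (if v = p then 1 else 0)"

lemma ip_point:
  assumes "finite V"
  shows "ip V x (point p) = (if p \<in> V then x p else 0)" "ip V (point p) x = (if p \<in> V then x p else 0)"
proof -
  have "x v * point p v = (if v = p then x v else 0)" for v
    by (auto simp: point_def)
  then show "ip V x (point p) = (if p \<in> V then x p else 0)" using assms by (simp add: ip_def)
  then show "ip V (point p) x = (if p \<in> V then x p else 0)" by (simp add: ip_commute)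
qed

lemma homogeneous_system_nontrivial_solution:
  assumes "finite I" "finite V" "card I < card V"
  shows "\<exists>x. (\<exists>v\<in>V. x v \<noteq> 0) \<and> (\<forall>v. v \<notin> V \<longrightarrow> x v = 0) \<and> (\<forall>i\<in>I. ip V (f i) x = 0)"
  using assms
proof (induction I arbitrary: V f rule: finite_induct)
  case empty
  then obtain p where "p \<in> V" by fastforce
  then show ?case by (intro exI[of _ "point p"]) (auto simp: point_def)
next
  case (insert i I)
  show ?case
  proof (cases "\<forall>v\<in>V. f i v = 0")
    case True
    have "card I < card V" using insert by simp
    then obtain x where "\<exists>v\<in>V. x v \<noteq> 0" "\<forall>v. v \<notin> V \<longrightarrow> x v = 0" "\<forall>i\<in>I. ip V (f i) x = 0"
      using insert.IH[OF \<open>finite V\<close>] by blast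
    then show ?thesis using True by (intro exI[of _ x]) (auto simp: ip_def)
  next
    case False
    then obtain p where p: "p \<in> V" "f i p \<noteq> 0" by blast
    let ?W = "V - {p}"
    \<comment> \<open>Eliminate the unknown \<open>p\<close> by means of equation \<open>i\<close>.\<close>
    define g where "g j v = f j v - f j p * f i v / f i p" for j v
    have "card I < card ?W" using insert p by simp
    then obtain x where x: "\<exists>v\<in>?W. x v \<noteq> 0" "\<forall>v. v \<notin> ?W \<longrightarrow> x v = 0" "\<forall>j\<in>I. ip ?W (g j) x = 0"
      using insert.IH[of ?W g] \<open>finite V\<close> by auto
    define y where "y = x(p := - ip ?W (f i) x / f i p)"
    have split: "ip V h y = h p * y p + ip ?W h x" for h
      using p \<open>finite V\<close> by (simp add: ip_def y_def sum.remove[of V p])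
    have "ip V (f i) y = 0" using p by (simp add: split) (simp add: y_def)
    moreover have "ip V (f j) y = 0" if "j \<in> I" for j
    proof -
      have "0 = ip ?W (g j) x" using x that by simp
      also have "\<dots> = ip ?W (f j) x - f j p / f i p * ip ?W (f i) x"
        by (simp add: g_def ip_def algebra_simps sum_subtractf sum_distrib_left)
      also have "\<dots> = ip V (f j) y" using p by (simp add: split) (simp add: y_def)
      finally show ?thesis by simp
    qed
    moreover have "\<exists>v\<in>V. y v \<noteq> 0" using x(1) by (auto simp: y_def)
    moreover have "\<forall>v. v \<notin> V \<longrightarrow> y v = 0" using x(2) p by (auto simp: y_def)
    ultimately show ?thesis by auto
  qed
qed

definition orthonormal :: "'a set \<Rightarrow> nat \<Rightarrow> (nat \<Rightarrow> 'a \<Rightarrow> real) \<Rightarrow> bool" where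
  "orthonormal V m X \<longleftrightarrow> (\<forall>i<m. \<forall>j<m. ip V (X i) (X j) = (if i = j then 1 else 0))"

text \<open>
  The solutions are found one at a time: being orthogonal to the previous ones is just a further
  linear equation, so no notion of dimension is needed.
\<close>
lemma homogeneous_system_orthonormal_solutions:
  assumes "finite I" "finite V" "card I + m \<le> card V"
  shows "\<exists>X. orthonormal V m X \<and> (\<forall>k<m. (\<forall>v. v \<notin> V \<longrightarrow> X k v = 0) \<and> (\<forall>i\<in>I. ip V (f i) (X k) = 0))"
  using assms(3)
proof (induction m)
  case 0
  then show ?case by (simp add: orthonormal_def)
next
  case (Suc m)
  then obtain X where X: "orthonormal V m X"
    "\<And>k v. k < m \<Longrightarrow> v \<notin> V \<Longrightarrow> X k v = 0" "\<And>k i. k < m \<Longrightarrow> i \<in> I \<Longrightarrow> ip V (f i) (X k) = 0"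
    by auto
  define J where "J = Inl ` I \<union> Inr ` {..<m}"
  have "card J \<le> card I + m"
    unfolding J_def by (metis card_Un_le card_image card_lessThan inj_Inl inj_Inr inj_on_subset subset_UNIV)
  then have "card J < card V" "finite J" using Suc.prems assms by (auto simp: J_def)
  then obtain x where x: "\<exists>v\<in>V. x v \<noteq> 0" "\<forall>v. v \<notin> V \<longrightarrow> x v = 0"
    "\<forall>j\<in>J. ip V (case_sum f X j) x = 0"
    using homogeneous_system_nontrivial_solution[of J V "case_sum f X"] assms by blast
  have pos: "0 < ip V x x"
    using ip_self_nonneg[of V x] ip_self_eq_0[OF \<open>finite V\<close>, of x] x(1) by fastforce
  define z where "z v = 1 / sqrt (ip V x x) * x v" for v
  have ipz: "ip V h z = 1 / sqrt (ip V x x) * ip V h x" for h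
    unfolding z_def by (rule ip_scale(2))
  have zz: "ip V z z = 1" using pos
    by (simp add: ipz) (simp add: ip_commute[of V z x] ipz real_div_sqrt)
  have zX: "ip V (X k) z = 0" if "k < m" for k
    using bspec[OF x(3), of "Inr k"] that by (simp add: ipz J_def)
  then have Xz: "ip V z (X k) = 0" if "k < m" for k using that by (simp add: ip_commute)
  have fz: "ip V (f i) z = 0" if "i \<in> I" for i
    using bspec[OF x(3), of "Inl i"] that by (simp add: ipz J_def)
  let ?X = "X(m := z)"
  have "orthonormal V (Suc m) ?X"
    using X(1) zz zX Xz unfolding orthonormal_def by (auto simp: less_Suc_eq)
  moreover have "(\<forall>v. v \<notin> V \<longrightarrow> ?X k v = 0) \<and> (\<forall>i\<in>I. ip V (f i) (?X k) = 0)" if "k < Suc m" for k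
    using that X(2,3) x(2) fz by (cases "k = m") (auto simp: z_def)
  ultimately show ?case by blast
qed

lemma bessel:
  assumes "orthonormal V m X"
  shows "(\<Sum>i<m. (ip V y (X i))\<^sup>2) \<le> ip V y y"
proof -
  define p where "p = (\<lambda>v. \<Sum>i<m. ip V y (X i) * X i v)"
  have yp: "ip V y p = (\<Sum>i<m. (ip V y (X i))\<^sup>2)"
    by (simp add: p_def ip_sum ip_scale power2_eq_square)
  have "ip V (X j) p = ip V y (X j)" if "j < m" for j
  proof -
    have "ip V (X j) p = (\<Sum>i<m. ip V y (X i) * (if j = i then 1 else 0))"
      using assms that by (simp add: p_def ip_sum ip_scale orthonormal_def)
    also have "\<dots> = (\<Sum>i<m. if i = j then ip V y (X i) else 0)"
      by (intro sum.cong) auto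
    finally show ?thesis using that by simp
  qed
  then have pp: "ip V p p = (\<Sum>i<m. (ip V y (X i))\<^sup>2)"
    by (subst p_def) (simp add: ip_sum ip_scale power2_eq_square)
  have "0 \<le> ip V (\<lambda>v. y v - p v) (\<lambda>v. y v - p v)" by (rule ip_self_nonneg)
  also have "\<dots> = ip V y y - (\<Sum>i<m. (ip V y (X i))\<^sup>2)"
    by (simp add: ip_diff yp pp ip_commute[of V p y])
  finally show ?thesis by simp
qed

section \<open>Adjacency operators and neighbourhoods\<close>

text \<open>
  The adjacency operator of the graph with arc set \<open>E\<close>. It is applied to functions directly, so
  that restricting the graph amounts to shrinking \<open>E\<close>.
\<close>
definition adj :: "('a \<times> 'a) set \<Rightarrow> ('a \<Rightarrow> real) \<Rightarrow> 'a \<Rightarrow> real" where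
  "adj E x v = (\<Sum>w\<in>E `` {v}. x w)"

lemma adj_add: "adj E (\<lambda>v. x v + y v) = (\<lambda>v. adj E x v + adj E y v)"
  and adj_diff: "adj E (\<lambda>v. x v - y v) = (\<lambda>v. adj E x v - adj E y v)"
  and adj_scale: "adj E (\<lambda>v. c * x v) = (\<lambda>v. c * adj E x v)"
  by (rule ext; simp add: adj_def sum.distrib sum_subtractf sum_distrib_left)+

lemma adj_nonneg: "(\<And>v. 0 \<le> x v) \<Longrightarrow> 0 \<le> adj E x v"
  by (simp add: adj_def sum_nonneg)

lemma adj_pow_nonneg: "(\<And>v. 0 \<le> x v) \<Longrightarrow> 0 \<le> (adj E ^^ j) x v"
proof (induction j arbitrary: v)
  case (Suc j)
  then have "0 \<le> adj E ((adj E ^^ j) x) v" by (intro adj_nonneg) blast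
  then show ?case by simp
qed simp

text \<open>
  The vertices that are reached from \<open>Z\<close> in at most \<open>s\<close> steps; for \<open>Z = {v}\<close>, the ball of radius \<open>s\<close>.
\<close>
primrec nbhd :: "('a \<times> 'a) set \<Rightarrow> 'a set \<Rightarrow> nat \<Rightarrow> 'a set" where
  "nbhd E Z 0 = Z"
| "nbhd E Z (Suc s) = nbhd E Z s \<union> E `` nbhd E Z s"

lemma nbhd_mono: "s \<le> t \<Longrightarrow> nbhd E Z s \<subseteq> nbhd E Z t"
  by (induction t) (auto simp: le_Suc_eq)

lemma nbhd_mono_graph: "E' \<subseteq> E \<Longrightarrow> nbhd E' Z s \<subseteq> nbhd E Z s"
  by (induction s) auto

lemma nbhd_trans: "u \<in> nbhd E Z s \<Longrightarrow> w \<in> nbhd E {u} t \<Longrightarrow> w \<in> nbhd E Z (s + t)"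
  by (induction t arbitrary: w) auto

lemma nbhd_sym:
  assumes "sym E"
  shows "u \<in> nbhd E {v} s \<Longrightarrow> v \<in> nbhd E {u} s"
proof (induction s arbitrary: u)
  case (Suc s)
  show ?case
  proof (cases "u \<in> nbhd E {v} s")
    case False
    then obtain w where w: "w \<in> nbhd E {v} s" "(w, u) \<in> E" using Suc.prems by auto
    then have "w \<in> nbhd E {u} 1" using assms by (auto dest: symD)
    from nbhd_trans[OF this Suc.IH[OF w(1)]] show ?thesis by simp
  qed (use Suc.IH in auto)
qed simp

lemma nbhd_predecessor: "u \<in> nbhd E Z (Suc s) \<Longrightarrow> u \<notin> Z \<Longrightarrow> \<exists>w \<in> nbhd E Z s. (w, u) \<in> E"
  by (induction s) auto

locale sym_graph =
  fixes V :: "'a set" and E :: "('a \<times> 'a) set"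
  assumes finite_V: "finite V" and E_sub: "E \<subseteq> V \<times> V" and sym_E: "sym E"
begin

lemma subgraph: "sym_graph V (E \<inter> H \<times> H)"
  using finite_V E_sub sym_E by unfold_locales (auto simp: sym_def)

lemma finite_E [simp]: "finite E"
  using finite_V E_sub finite_subset by blast

lemma finite_nbrs [simp]: "finite (E `` {v})"
  using finite_E by (rule finite_Image)

lemma adj_alt: "adj E x v = (\<Sum>w\<in>V. if (v, w) \<in> E then x w else 0)"
  unfolding adj_def using finite_V E_sub
  by (intro sum.mono_neutral_cong_left) auto

lemma adj_outside [simp]: "v \<notin> V \<Longrightarrow> adj E x v = 0"
  using E_sub by (auto simp: adj_alt intro!: sum.neutral)

lemma adj_point: "adj E (point w) v = (if (v, w) \<in> E then 1 else 0)"
  using sum.delta[OF finite_nbrs[of v], of w "\<lambda>_. 1::real"] by (simp add: adj_def point_def)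

lemma adj_sym: "ip V (adj E x) y = ip V x (adj E y)"
proof -
  have "ip V (adj E x) y = (\<Sum>v\<in>V. \<Sum>w\<in>V. if (v, w) \<in> E then x w * y v else 0)"
    by (simp add: ip_def adj_alt sum_distrib_right if_distrib[of "\<lambda>z. z * _"] cong: if_cong)
  also have "\<dots> = (\<Sum>w\<in>V. \<Sum>v\<in>V. if (v, w) \<in> E then x w * y v else 0)"
    by (rule sum.swap)
  also have "\<dots> = (\<Sum>w\<in>V. \<Sum>v\<in>V. if (w, v) \<in> E then x w * y v else 0)"
    using sym_E by (intro sum.cong refl if_cong) (auto dest: symD)
  also have "\<dots> = ip V x (adj E y)"
    by (simp add: ip_def adj_alt sum_distrib_left if_distrib[of "\<lambda>z. _ * z"] cong: if_cong)
  finally show ?thesis .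
qed

lemma adj_pow_sym: "ip V ((adj E ^^ j) x) y = ip V x ((adj E ^^ j) y)"
proof (induction j arbitrary: x y)
  case (Suc j)
  have "ip V ((adj E ^^ Suc j) x) y = ip V ((adj E ^^ j) x) (adj E y)"
    by (simp add: adj_sym)
  also have "\<dots> = ip V x ((adj E ^^ j) (adj E y))" by (rule Suc)
  finally show ?case by (simp only: funpow_Suc_right o_apply)
qed simp

lemma adj_mono_graph:
  assumes "E' \<subseteq> E" "\<And>v. x v \<le> y v" "\<And>v. 0 \<le> y v"
  shows "adj E' x v \<le> adj E y v"
proof -
  have "adj E' x v \<le> adj E' y v" unfolding adj_def using assms by (intro sum_mono) auto
  also have "\<dots> \<le> adj E y v" unfolding adj_def using assms by (intro sum_mono2) auto
  finally show ?thesis .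
qed

lemma adj_pow_mono_graph:
  assumes "E' \<subseteq> E" "\<And>v. x v \<le> y v" "\<And>v. 0 \<le> y v"
  shows "(adj E' ^^ j) x v \<le> (adj E ^^ j) y v"
proof (induction j arbitrary: v)
  case (Suc j)
  have "adj E' ((adj E' ^^ j) x) v \<le> adj E ((adj E ^^ j) y) v"
    by (rule adj_mono_graph[OF assms(1) Suc.IH]) (rule adj_pow_nonneg[OF assms(3)])
  then show ?case by simp
qed (use assms in simp)

lemma abs_adj_form: "\<bar>ip V x (adj E x)\<bar> \<le> ip V (\<lambda>v. \<bar>x v\<bar>) (adj E (\<lambda>v. \<bar>x v\<bar>))"
proof -
  have "\<bar>ip V x (adj E x)\<bar> \<le> (\<Sum>v\<in>V. \<bar>x v * adj E x v\<bar>)"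
    unfolding ip_def by (rule sum_abs)
  also have "\<dots> \<le> ip V (\<lambda>v. \<bar>x v\<bar>) (adj E (\<lambda>v. \<bar>x v\<bar>))"
    unfolding ip_def abs_mult
    by (intro sum_mono mult_left_mono) (simp_all add: adj_def)
  finally show ?thesis .
qed

lemma adj_pow_support:
  assumes "\<And>u. u \<notin> nbhd E Z i \<Longrightarrow> x u = 0"
  shows "u \<notin> nbhd E Z (i + j) \<Longrightarrow> (adj E ^^ j) x u = 0"
proof (induction j arbitrary: u)
  case (Suc j)
  have "(adj E ^^ j) x w = 0" if "(u, w) \<in> E" for w
    using Suc that sym_E by (auto dest: symD)
  then have "(\<Sum>w\<in>E `` {u}. (adj E ^^ j) x w) = 0" by (intro sum.neutral) auto
  then show ?case by (simp add: adj_def[of E "(adj E ^^ j) x" u])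
qed (use assms in simp)

text \<open>
  For a symmetric matrix this says that the principal submatrix on \<open>Q\<close> has no eigenvalue above \<open>\<mu>\<close>;
  in this form it is available without diagonalizing anything.
\<close>
definition bounded_on :: "real \<Rightarrow> 'a set \<Rightarrow> bool" where
  "bounded_on \<mu> Q \<longleftrightarrow> (\<forall>x. (\<forall>v. v \<notin> Q \<longrightarrow> x v = 0) \<longrightarrow> ip V x (adj E x) \<le> \<mu> * ip V x x)"

text \<open>
  Since the entries are nonnegative, an upper bound on the quadratic form is also a bound on its
  absolute value, and polarization turns it into a bound on the operator norm.
\<close>
lemma norm_adj_le:
  assumes "bounded_on \<mu> Q" "0 < \<mu>"
    and x: "\<And>v. v \<notin> Q \<Longrightarrow> x v = 0" and Ax: "\<And>v. v \<notin> Q \<Longrightarrow> adj E x v = 0"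
  shows "ip V (adj E x) (adj E x) \<le> \<mu>\<^sup>2 * ip V x x"
proof -
  have up: "ip V y (adj E y) \<le> \<mu> * ip V y y" if "\<forall>v. v \<notin> Q \<longrightarrow> y v = 0" for y
    using assms(1) that unfolding bounded_on_def by blast
  have lo: "- ip V y (adj E y) \<le> \<mu> * ip V y y" if "\<forall>v. v \<notin> Q \<longrightarrow> y v = 0" for y
    using abs_adj_form[of y] up[of "\<lambda>v. \<bar>y v\<bar>"] that by (simp add: ip_abs)
  define z where "z = adj E x"
  define w where "w = (\<lambda>v. \<mu> * x v)"
  have zAw: "ip V z (adj E w) = \<mu> * ip V z z" "ip V w (adj E z) = \<mu> * ip V z z"
    by (simp_all add: w_def adj_scale ip_scale z_def adj_sym)
  have "4 * (\<mu> * ip V z z) = ip V (\<lambda>v. z v + w v) (adj E (\<lambda>v. z v + w v))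
      - ip V (\<lambda>v. z v - w v) (adj E (\<lambda>v. z v - w v))"
    by (simp add: adj_add adj_diff ip_add ip_diff zAw)
  also have "\<dots> \<le> \<mu> * ip V (\<lambda>v. z v + w v) (\<lambda>v. z v + w v)
      + \<mu> * ip V (\<lambda>v. z v - w v) (\<lambda>v. z v - w v)"
    using up[of "\<lambda>v. z v + w v"] lo[of "\<lambda>v. z v - w v"] x Ax by (simp add: z_def w_def)
  also have "\<dots> = 2 * \<mu> * (ip V z z + ip V w w)"
    by (simp add: ip_add ip_diff algebra_simps)
  also have "ip V w w = \<mu>\<^sup>2 * ip V x x"
    by (simp add: w_def ip_scale power2_eq_square)
  finally have "2 * \<mu> * ip V z z \<le> 2 * \<mu> * (\<mu>\<^sup>2 * ip V x x)" by (simp add: algebra_simps)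
  then show ?thesis using assms(2) by (simp add: z_def)
qed

lemma norm_adj_pow_le:
  assumes "bounded_on \<mu> (nbhd E {v} s)" "0 < \<mu>"
    and "\<And>u. u \<notin> nbhd E {v} i \<Longrightarrow> x u = 0" and "i + j \<le> s"
  shows "ip V ((adj E ^^ j) x) ((adj E ^^ j) x) \<le> (\<mu>\<^sup>2) ^ j * ip V x x"
  using assms(4)
proof (induction j)
  case (Suc j)
  have supp: "(adj E ^^ l) x u = 0" if "u \<notin> nbhd E {v} s" "i + l \<le> s" for u l
    by (rule adj_pow_support[of "{v}" i x u l, OF assms(3)])
       (use that nbhd_mono[of "i + l" s E "{v}"] in blast)+
  have "ip V ((adj E ^^ Suc j) x) ((adj E ^^ Suc j) x) \<le> \<mu>\<^sup>2 * ip V ((adj E ^^ j) x) ((adj E ^^ j) x)"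
    unfolding funpow.simps(2) o_apply
    using supp[of _ "Suc j"] Suc.prems by (intro norm_adj_le[OF assms(1,2)] supp) auto
  also have "\<dots> \<le> \<mu>\<^sup>2 * ((\<mu>\<^sup>2) ^ j * ip V x x)"
    using Suc by (intro mult_left_mono) auto
  finally show ?case by (simp add: mult_ac)
qed simp

lemma card_nbhd_le:
  assumes "\<And>v. card (E `` {v}) \<le> \<Delta>" "finite Z"
  shows "card (nbhd E Z s) \<le> card Z * (\<Delta> + 1) ^ s" "finite (nbhd E Z s)"
proof -
  have fin: "finite (nbhd E Z s)" for s
    by (induction s) (use assms(2) finite_Image[OF finite_E] in auto)
  then show "finite (nbhd E Z s)" .
  show "card (nbhd E Z s) \<le> card Z * (\<Delta> + 1) ^ s"
  proof (induction s)
    case (Suc s)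
    let ?B = "nbhd E Z s"
    have "card (E `` ?B) \<le> (\<Sum>v\<in>?B. card (E `` {v}))"
      using card_UN_le[OF fin, of "\<lambda>v. E `` {v}"] by (simp add: Image_eq_UN[symmetric])
    also have "\<dots> \<le> card ?B * \<Delta>" using sum_bounded_above[of ?B "\<lambda>v. card (E `` {v})" \<Delta>] assms(1) by simp
    finally have "card (nbhd E Z (Suc s)) \<le> card ?B * (\<Delta> + 1)"
      using card_Un_le[of ?B "E `` ?B"] by simp
    also have "\<dots> \<le> card Z * (\<Delta> + 1) ^ s * (\<Delta> + 1)" using Suc by (rule mult_right_mono) simp
    finally show ?case by (simp add: mult_ac)
  qed simp
qed


end

section \<open>Walks that avoid a net\<close>

context sym_graph
begin

definition arcs_in :: "'a set \<Rightarrow> ('a \<times> 'a) set" where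
  "arcs_in H = E \<inter> H \<times> H"

lemma arcs_in_subset: "arcs_in H \<subseteq> E"
  by (simp add: arcs_in_def)

lemma sym_graph_restrict: "sym_graph V (arcs_in H)"
  unfolding arcs_in_def by (rule subgraph)

lemma adj_restrict_outside: "v \<notin> H \<Longrightarrow> adj (arcs_in H) x v = 0"
  by (auto simp: adj_def arcs_in_def intro!: sum.neutral)

lemma adj_pow_restrict_outside:
  assumes "\<And>v. v \<notin> H \<Longrightarrow> x v = 0" "v \<notin> H"
  shows "(adj (arcs_in H) ^^ j) x v = 0"
  using assms adj_restrict_outside by (cases j) auto

lemma walk_exists:
  assumes "\<And>v. v \<in> C \<Longrightarrow> E `` {v} \<noteq> {}" "E `` C \<subseteq> C" "u \<in> C"
  shows "\<exists>w\<in>V. 1 \<le> (adj E ^^ Suc j) (point w) u"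
  using assms(3)
proof (induction j arbitrary: u)
  case 0
  then obtain w where "(u, w) \<in> E" using assms(1) by blast
  then show ?case using E_sub by (intro bexI[of _ w]) (auto simp: adj_point)
next
  case (Suc j)
  then obtain u' where u': "(u, u') \<in> E" using assms(1) by blast
  then obtain w where w: "w \<in> V" "1 \<le> (adj E ^^ Suc j) (point w) u'"
    using Suc assms(2) by blast
  have "(adj E ^^ Suc j) (point w) u' \<le> (\<Sum>u\<in>E `` {u}. (adj E ^^ Suc j) (point w) u)"
    using u' by (intro member_le_sum adj_pow_nonneg) (auto simp: point_def)
  also have "\<dots> = (adj E ^^ Suc (Suc j)) (point w) u"
    by (subst (2) funpow.simps(2)) (simp only: o_apply adj_def[of E "(adj E ^^ Suc j) (point w)" u])
  finally have "1 \<le> (adj E ^^ Suc (Suc j)) (point w) u" using w(2) by linarith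
  then show ?case using w(1) by blast
qed

text \<open>
  Every vertex \<open>u\<close> of \<open>C\<close> starts a walk of length \<open>j + 1\<close> that visits the net \<open>Z\<close>: go to the net by a
  shortest path and continue arbitrarily. Removing the net therefore lowers the number of walks
  from \<open>u\<close> to some \<open>w\<close>, which is \<open>(adj E ^^ Suc j) (point w) u\<close>, by at least one.
\<close>
lemma extra_walk_through_net:
  assumes C: "\<And>v. v \<in> C \<Longrightarrow> E `` {v} \<noteq> {}" "E `` C \<subseteq> C"
    and H: "H \<inter> Z = {}" and u: "u \<in> C" "u \<in> nbhd E Z (Suc j)"
  shows "\<exists>w\<in>V. (adj (arcs_in H) ^^ Suc j) (point w) u + 1 \<le> (adj E ^^ Suc j) (point w) u"
  using u
proof (induction j arbitrary: u)
  case (0 u)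
  show ?case
  proof (cases "u \<in> Z")
    case True
    then obtain w where "w \<in> V" "1 \<le> (adj E ^^ Suc 0) (point w) u"
      using walk_exists[OF C 0(1)] by blast
    then show ?thesis using adj_restrict_outside[of u H] H True by force
  next
    case False
    then obtain z where z: "z \<in> Z" "(z, u) \<in> E"
      using nbhd_predecessor[OF 0(2)] by auto
    then have "adj E (point z) u = 1" using sym_E by (auto simp: adj_point dest: symD)
    moreover have "adj (arcs_in H) (point z) u = 0"
      using sym_graph.adj_point[OF sym_graph_restrict] z H by (auto simp: arcs_in_def)
    ultimately show ?thesis using z E_sub by (intro bexI[of _ z]) auto
  qed
next
  case (Suc j u)
  show ?case
  proof (cases "u \<in> Z")
    case True
    then obtain w where "w \<in> V" "1 \<le> (adj E ^^ Suc (Suc j)) (point w) u"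
      using walk_exists[OF C Suc.prems(1)] by blast
    moreover have "(adj (arcs_in H) ^^ Suc (Suc j)) (point w) u = 0"
      using adj_restrict_outside[of u H] H True by auto
    ultimately show ?thesis by force
  next
    case False
    then obtain u' where u': "u' \<in> nbhd E Z (Suc j)" "(u', u) \<in> E"
      using nbhd_predecessor[OF Suc.prems(2)] by auto
    then have uu': "(u, u') \<in> E" "u' \<in> C" using sym_E C(2) Suc.prems by (auto dest: symD)
    then obtain w where w: "w \<in> V"
      "(adj (arcs_in H) ^^ Suc j) (point w) u' + 1 \<le> (adj E ^^ Suc j) (point w) u'"
      using Suc.IH u' by blast
    let ?a = "(adj E ^^ Suc j) (point w)" and ?d = "(adj (arcs_in H) ^^ Suc j) (point w)"
    have da: "?d v \<le> ?a v" for v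
      by (rule adj_pow_mono_graph[OF arcs_in_subset]) (auto simp: point_def)
    have a0: "0 \<le> ?d v" for v by (rule adj_pow_nonneg) (auto simp: point_def)
    have "(adj (arcs_in H) ^^ Suc (Suc j)) (point w) u = (\<Sum>v\<in>arcs_in H `` {u}. ?d v)"
      by (subst funpow.simps(2)) (simp only: o_apply adj_def[of _ ?d u])
    also have "\<dots> \<le> (\<Sum>v\<in>E `` {u}. ?d v)"
      using a0 arcs_in_subset by (intro sum_mono2) auto
    also have "\<dots> + 1 \<le> (\<Sum>v\<in>E `` {u}. ?a v)"
    proof -
      have "(\<Sum>v\<in>E `` {u} - {u'}. ?d v) \<le> (\<Sum>v\<in>E `` {u} - {u'}. ?a v)"
        by (intro sum_mono da)
      then show ?thesis using w(2) uu' sum.remove[of "E `` {u}" u' ?a] sum.remove[of "E `` {u}" u' ?d]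
        by fastforce
    qed
    also have "(\<Sum>v\<in>E `` {u}. ?a v) = (adj E ^^ Suc (Suc j)) (point w) u"
      by (subst (2) funpow.simps(2)) (simp only: o_apply adj_def[of _ ?a u])
    finally show ?thesis using w(1) by auto
  qed
qed

text \<open>
  Choosing for each \<open>u\<close> the endpoint \<open>\<pi> u\<close> of a destroyed walk, the \<open>R\<close>-th power of the full operator
  exceeds that of the restricted one by at least the push-forward \<open>g\<close> of \<open>x\<close> along \<open>\<pi>\<close>. All entries are
  nonnegative, so the squared norms differ by at least the squared norm of \<open>g\<close>, hence of \<open>x\<close>.
\<close>
lemma norm_restrict_pow_gain:
  assumes C: "\<And>v. v \<in> C \<Longrightarrow> E `` {v} \<noteq> {}" "E `` C \<subseteq> C" and "C \<subseteq> V"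
    and H: "H \<inter> Z = {}" "H \<subseteq> C" and net: "C \<subseteq> nbhd E Z R" "0 < R"
    and x: "\<And>v. 0 \<le> x v" "\<And>v. v \<notin> H \<Longrightarrow> x v = 0"
  shows "ip V ((adj (arcs_in H) ^^ R) x) ((adj (arcs_in H) ^^ R) x) + ip V x x
    \<le> ip V ((adj E ^^ R) x) ((adj E ^^ R) x)"
proof -
  let ?D = "adj (arcs_in H)"
  let ?a = "\<lambda>w. (adj E ^^ R) (point w)" and ?d = "\<lambda>w. (?D ^^ R) (point w)"
  have "\<forall>u\<in>C. \<exists>w\<in>V. ?d w u + 1 \<le> ?a w u"
    using extra_walk_through_net[OF C H(1), of _ "R - 1"] net by auto
  then obtain \<pi> where \<pi>: "\<And>u. u \<in> C \<Longrightarrow> \<pi> u \<in> V" "\<And>u. u \<in> C \<Longrightarrow> ?d (\<pi> u) u + 1 \<le> ?a (\<pi> u) u"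
    by metis
  define g where "g w = (\<Sum>u\<in>C. if \<pi> u = w then x u else 0)" for w
  have finC: "finite C" using \<open>C \<subseteq> V\<close> finite_V finite_subset by blast
  have g0: "0 \<le> g w" for w using x by (auto simp: g_def intro!: sum_nonneg)
  have da: "?d w u \<le> ?a w u" for u w
    by (rule adj_pow_mono_graph[OF arcs_in_subset]) (auto simp: point_def)
  have d0: "0 \<le> (?D ^^ R) x w" for w by (rule adj_pow_nonneg) (rule x)
  have on_C: "ip V y x = (\<Sum>u\<in>C. y u * x u)" for y
    unfolding ip_def using H x \<open>C \<subseteq> V\<close> finite_V by (intro sum.mono_neutral_right) auto
  have key: "(?D ^^ R) x w + g w \<le> (adj E ^^ R) x w" if w: "w \<in> V" for w
  proof -
    have "(?D ^^ R) x w = ip V (point w) ((?D ^^ R) x)"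
      using w finite_V by (simp add: ip_point)
    also have "\<dots> = ip V (?d w) x"
      by (rule sym_graph.adj_pow_sym[OF sym_graph_restrict, symmetric])
    finally have d: "(?D ^^ R) x w = ip V (?d w) x" .
    have "(adj E ^^ R) x w = ip V (point w) ((adj E ^^ R) x)"
      using w finite_V by (simp add: ip_point)
    also have "\<dots> = ip V (?a w) x" by (rule adj_pow_sym[symmetric])
    finally have a: "(adj E ^^ R) x w = ip V (?a w) x" .
    have "(\<Sum>u\<in>C. ?d w u * x u) + g w = (\<Sum>u\<in>C. (?d w u + (if \<pi> u = w then 1 else 0)) * x u)"
      unfolding g_def sum.distrib[symmetric] by (intro sum.cong) (auto simp: algebra_simps)
    also have "\<dots> \<le> (\<Sum>u\<in>C. ?a w u * x u)"
      using \<pi>(2) da x by (intro sum_mono mult_right_mono) auto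
    finally show ?thesis by (simp add: d a on_C)
  qed
  have "ip V x x \<le> (\<Sum>w\<in>V. (g w)\<^sup>2)"
  proof -
    have "ip V x x = (\<Sum>w\<in>V. \<Sum>u\<in>{u\<in>C. \<pi> u = w}. x u * x u)"
      unfolding on_C using finC finite_V \<pi>(1) by (subst sum.group[of C V \<pi>]) auto
    also have "\<dots> \<le> (\<Sum>w\<in>V. (g w)\<^sup>2)"
    proof (rule sum_mono)
      fix w assume "w \<in> V"
      have g: "g w = (\<Sum>u\<in>{u\<in>C. \<pi> u = w}. x u)"
        unfolding g_def using finC by (simp add: sum.inter_filter)
      have "(\<Sum>u\<in>{u\<in>C. \<pi> u = w}. x u * x u) \<le> (\<Sum>u\<in>{u\<in>C. \<pi> u = w}. x u * g w)"
        unfolding g using finC x by (intro sum_mono mult_left_mono member_le_sum) auto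
      also have "\<dots> = (g w)\<^sup>2" by (simp add: g sum_distrib_right[symmetric] power2_eq_square)
      finally show "(\<Sum>u\<in>{u\<in>C. \<pi> u = w}. x u * x u) \<le> (g w)\<^sup>2" .
    qed
    finally show ?thesis .
  qed
  then have "ip V ((?D ^^ R) x) ((?D ^^ R) x) + ip V x x
      \<le> (\<Sum>w\<in>V. ((?D ^^ R) x w)\<^sup>2 + (g w)\<^sup>2)"
    by (simp add: ip_def power2_eq_square sum.distrib)
  also have "\<dots> \<le> (\<Sum>w\<in>V. ((adj E ^^ R) x w)\<^sup>2)"
  proof (rule sum_mono)
    fix w assume "w \<in> V"
    have "((?D ^^ R) x w)\<^sup>2 + (g w)\<^sup>2 \<le> ((?D ^^ R) x w + g w)\<^sup>2"
      using g0[of w] d0[of w] by (simp add: power2_sum)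
    also have "\<dots> \<le> ((adj E ^^ R) x w)\<^sup>2"
      using key[OF \<open>w \<in> V\<close>] g0[of w] d0[of w] by (intro power_mono) auto
    finally show "((?D ^^ R) x w)\<^sup>2 + (g w)\<^sup>2 \<le> ((adj E ^^ R) x w)\<^sup>2" .
  qed
  finally show ?thesis by (simp add: ip_def power2_eq_square)
qed

text \<open>
  The support of the iterates of a point mass stays within the ball of radius \<open>R * q\<close>, on which the
  full operator has norm at most \<open>\<mu>\<close>. Each block of \<open>R\<close> steps then loses the factor given by
  \<open>norm_restrict_pow_gain\<close>.
\<close>
lemma norm_restrict_pow_point_le:
  assumes C: "\<And>v. v \<in> C \<Longrightarrow> E `` {v} \<noteq> {}" "E `` C \<subseteq> C" and "C \<subseteq> V"
    and H: "H \<inter> Z = {}" "H \<subseteq> C" and net: "C \<subseteq> nbhd E Z R" "0 < R"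
    and v: "v \<in> H" and bdd: "bounded_on \<mu> (nbhd E {v} (R * q))" "0 < \<mu>"
    and \<rho>: "(\<mu>\<^sup>2) ^ R - 1 \<le> \<rho>" "0 \<le> \<rho>"
  shows "ip V ((adj (arcs_in H) ^^ (R * q)) (point v)) ((adj (arcs_in H) ^^ (R * q)) (point v)) \<le> \<rho> ^ q"
proof -
  let ?D = "adj (arcs_in H)"
  define x where "x i = (?D ^^ (R * i)) (point v)" for i
  have x0: "0 \<le> x i u" for i u unfolding x_def by (rule adj_pow_nonneg) (auto simp: point_def)
  have xH: "x i u = 0" if "u \<notin> H" for i u
    unfolding x_def by (rule adj_pow_restrict_outside) (use that v in \<open>auto simp: point_def\<close>)
  have xball: "x i u = 0" if "u \<notin> nbhd E {v} (R * i)" for i u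
  proof -
    have "u \<notin> nbhd (arcs_in H) {v} (0 + R * i)"
      using that nbhd_mono_graph[OF arcs_in_subset] by auto
    then show ?thesis unfolding x_def
      by (rule sym_graph.adj_pow_support[OF sym_graph_restrict, rotated]) (auto simp: point_def)
  qed
  have step: "x (Suc i) = (?D ^^ R) (x i)" for i
    by (simp add: x_def funpow_add)
  have "ip V (x i) (x i) \<le> \<rho> ^ i" if "i \<le> q" for i
    using that
  proof (induction i)
    case 0
    have "v \<in> V" using v H \<open>C \<subseteq> V\<close> by auto
    then show ?case using finite_V by (simp add: x_def ip_point) (simp add: point_def)
  next
    case (Suc i)
    have "R * i + R \<le> R * q" using Suc.prems by (metis mult_Suc_right add.commute mult_le_mono2)
    then have "ip V ((adj E ^^ R) (x i)) ((adj E ^^ R) (x i)) \<le> (\<mu>\<^sup>2) ^ R * ip V (x i) (x i)"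
      by (intro norm_adj_pow_le[OF bdd, of "R * i"] xball) auto
    then have "ip V (x (Suc i)) (x (Suc i)) \<le> ((\<mu>\<^sup>2) ^ R - 1) * ip V (x i) (x i)"
      using norm_restrict_pow_gain[OF C \<open>C \<subseteq> V\<close> H net, of "x i"] x0 xH by (simp add: step algebra_simps)
    also have "\<dots> \<le> \<rho> * ip V (x i) (x i)" using \<rho>(1) ip_self_nonneg by (rule mult_right_mono)
    also have "\<dots> \<le> \<rho> * \<rho> ^ i" using Suc \<rho>(2) by (intro mult_left_mono) auto
    finally show ?case by simp
  qed
  then show ?thesis unfolding x_def by blast
qed

text \<open>
  The trace of the \<open>2 * s\<close>-th power counts closed walks and dominates the contribution of any
  orthonormal family of eigenvectors. Bessel's inequality, applied to each row of the \<open>s\<close>-th power,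
  replaces the spectral theorem here.
\<close>
lemma eigenspace_dim_le_walks:
  assumes X: "orthonormal V m X" "\<And>i. i < m \<Longrightarrow> adj E (X i) = (\<lambda>v. \<mu> * X i v)"
  shows "real m * (\<mu>\<^sup>2) ^ s \<le> (\<Sum>v\<in>V. ip V ((adj E ^^ s) (point v)) ((adj E ^^ s) (point v)))"
proof -
  have pow: "(adj E ^^ s) (X i) = (\<lambda>v. \<mu> ^ s * X i v)" if "i < m" for i s
  proof (induction s)
    case (Suc s)
    have "(adj E ^^ Suc s) (X i) = adj E (\<lambda>v. \<mu> ^ s * X i v)" by (simp add: Suc)
    also have "\<dots> = (\<lambda>v. \<mu> ^ Suc s * X i v)" by (simp add: adj_scale X(2)[OF that] mult_ac)
    finally show ?case .
  qed simp
  have val: "\<mu> ^ s * X i v = ip V ((adj E ^^ s) (point v)) (X i)" if "v \<in> V" "i < m" for i v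
    using that finite_V by (simp add: adj_pow_sym pow ip_point)
  have "real m * (\<mu>\<^sup>2) ^ s = (\<Sum>i<m. (\<mu>\<^sup>2) ^ s * ip V (X i) (X i))"
    using X(1) by (simp add: orthonormal_def)
  also have "\<dots> = (\<Sum>i<m. \<Sum>v\<in>V. (\<mu> ^ s * X i v)\<^sup>2)"
    by (simp add: ip_def power_mult_distrib sum_distrib_left power_mult[symmetric] mult.commute power2_eq_square[of "X _ _"])
  also have "\<dots> = (\<Sum>v\<in>V. \<Sum>i<m. (\<mu> ^ s * X i v)\<^sup>2)" by (rule sum.swap)
  also have "\<dots> = (\<Sum>v\<in>V. \<Sum>i<m. (ip V ((adj E ^^ s) (point v)) (X i))\<^sup>2)"
    by (simp add: val)
  also have "\<dots> \<le> (\<Sum>v\<in>V. ip V ((adj E ^^ s) (point v)) ((adj E ^^ s) (point v)))"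
    by (intro sum_mono bessel X(1))
  finally show ?thesis .
qed

text \<open>
  Eigenvectors that vanish outside \<open>H\<close> are eigenvectors of the restricted operator. As
  \<open>\<mu> \<le> b\<close>, the factor \<open>1 - 1 / b ^ (2 * R)\<close> bounds \<open>((\<mu>\<^sup>2) ^ R - 1) / (\<mu>\<^sup>2) ^ R\<close>, and it is nonnegative
  even if \<open>\<mu> < 1\<close>.
\<close>
lemma restricted_eigenspace_dim_le:
  assumes C: "\<And>v. v \<in> C \<Longrightarrow> E `` {v} \<noteq> {}" "E `` C \<subseteq> C" and "C \<subseteq> V"
    and H: "H \<inter> Z = {}" "H \<subseteq> C" and net: "C \<subseteq> nbhd E Z R" "0 < R" and q: "0 < q"
    and bdd: "\<And>v. v \<in> H \<Longrightarrow> bounded_on \<mu> (nbhd E {v} (R * q))" and \<mu>: "0 < \<mu>" "\<mu> \<le> b" "1 \<le> b"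
    and X: "orthonormal V m X" "\<And>i v. i < m \<Longrightarrow> v \<notin> H \<Longrightarrow> X i v = 0"
      "\<And>i v. i < m \<Longrightarrow> v \<in> H \<Longrightarrow> adj E (X i) v = \<mu> * X i v"
  shows "real m \<le> real (card V) * (1 - 1 / b ^ (2 * R)) ^ q"
proof -
  let ?D = "adj (arcs_in H)"
  have DX: "?D (X i) = (\<lambda>v. \<mu> * X i v)" if i: "i < m" for i
  proof
    fix v
    show "?D (X i) v = \<mu> * X i v"
    proof (cases "v \<in> H")
      case True
      have "?D (X i) v = (\<Sum>w\<in>E `` {v}. X i w)"
        unfolding adj_def arcs_in_def using True X(2)[OF i]
        by (intro sum.mono_neutral_left) auto
      then show ?thesis using X(3)[OF i True] by (simp add: adj_def)
    qed (simp add: adj_restrict_outside X(2) i)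
  qed
  define \<rho> where "\<rho> = (\<mu>\<^sup>2) ^ R * (1 - 1 / b ^ (2 * R))"
  have b: "0 < b" using \<mu> by simp
  have "(\<mu>\<^sup>2) ^ R \<le> b ^ (2 * R)" using \<mu> by (simp add: power_mult[symmetric] power_mono)
  then have le1: "(\<mu>\<^sup>2) ^ R / b ^ (2 * R) \<le> 1" using b by simp
  have \<rho>1: "(\<mu>\<^sup>2) ^ R - 1 \<le> \<rho>" using le1 by (simp add: \<rho>_def algebra_simps)
  have \<rho>0: "0 \<le> \<rho>" using \<mu> by (simp add: \<rho>_def)
  have bound: "ip V ((?D ^^ (R * q)) (point v)) ((?D ^^ (R * q)) (point v)) \<le> \<rho> ^ q" if "v \<in> V" for v
  proof (cases "v \<in> H")
    case True
    show ?thesis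
      by (rule norm_restrict_pow_point_le[OF C \<open>C \<subseteq> V\<close> H net True bdd[OF True] \<mu>(1)]) (use \<rho>1 \<rho>0 in auto)
  next
    case False
    have "?D (point v) = (\<lambda>u. 0)"
      using False sym_graph.adj_point[OF sym_graph_restrict] by (auto simp: arcs_in_def)
    moreover have "(?D ^^ j) (\<lambda>u. 0) = (\<lambda>u. 0)" for j
    proof (induction j)
      case (Suc j)
      have "?D (\<lambda>u. 0) = (\<lambda>u. 0)" by (simp add: adj_def fun_eq_iff)
      then show ?case using Suc by simp
    qed simp
    moreover have "R * q = Suc (R * q - 1)" using net(2) q by simp
    ultimately have "(?D ^^ (R * q)) (point v) = (\<lambda>u. 0)"
      by (metis funpow_Suc_right o_apply)
    then show ?thesis using \<rho>0 by (simp add: ip_def)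
  qed
  have "real m * (\<mu>\<^sup>2) ^ (R * q) \<le> (\<Sum>v\<in>V. ip V ((?D ^^ (R * q)) (point v)) ((?D ^^ (R * q)) (point v)))"
    by (rule sym_graph.eigenspace_dim_le_walks[OF sym_graph_restrict X(1) DX])
  also have "\<dots> \<le> real (card V) * \<rho> ^ q"
    using bound sum_bounded_above[of V _ "\<rho> ^ q"] by simp
  finally have main: "real m * (\<mu>\<^sup>2) ^ (R * q) \<le> real (card V) * \<rho> ^ q" .
  have "\<rho> ^ q = (\<mu>\<^sup>2) ^ (R * q) * (1 - 1 / b ^ (2 * R)) ^ q"
    by (simp add: \<rho>_def power_mult_distrib power_mult)
  with main have "(\<mu>\<^sup>2) ^ (R * q) * real m \<le> (\<mu>\<^sup>2) ^ (R * q) * (real (card V) * (1 - 1 / b ^ (2 * R)) ^ q)"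
    by (simp add: mult_ac)
  then show ?thesis using \<mu>(1) by (subst (asm) mult_le_cancel_left_pos) simp_all
qed

end

section \<open>Components, nets and eigenvectors\<close>

definition cut :: "'a set \<Rightarrow> ('a \<Rightarrow> real) \<Rightarrow> 'a \<Rightarrow> real" where
  "cut C x v = (if v \<in> C then x v else 0)"

lemma nbhd_split: "v \<in> nbhd E Z (a + b) \<Longrightarrow> \<exists>w\<in>nbhd E Z a. v \<in> nbhd E {w} b"
proof (induction b arbitrary: v)
  case (Suc b)
  then consider "v \<in> nbhd E Z (a + b)" | u where "u \<in> nbhd E Z (a + b)" "(u, v) \<in> E" by auto
  then show ?case
  proof cases
    case 1
    then show ?thesis using Suc.IH by auto
  next
    case (2 u)
    then show ?thesis using Suc.IH[of u] by auto
  qed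
qed auto

lemma nbhd_subset_rtrancl: "nbhd E {p} s \<subseteq> E\<^sup>* `` {p}"
  by (induction s) (auto intro: rtrancl_into_rtrancl)

lemma rtrancl_in_nbhd: "(p, v) \<in> E\<^sup>* \<Longrightarrow> \<exists>s. v \<in> nbhd E {p} s"
proof (induction rule: rtrancl_induct)
  case base
  then show ?case by (intro exI[of _ 0]) simp
next
  case (step y z)
  then obtain s where "y \<in> nbhd E {p} s" by blast
  then show ?case using step by (intro exI[of _ "Suc s"]) auto
qed

context sym_graph
begin

lemma component_subset: "p \<in> V \<Longrightarrow> E\<^sup>* `` {p} \<subseteq> V"
proof
  fix v assume "p \<in> V" "v \<in> E\<^sup>* `` {p}"
  then have "(p, v) \<in> E\<^sup>*" by simp
  then show "v \<in> V" using \<open>p \<in> V\<close> E_sub by (induction rule: rtrancl_induct) auto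
qed

lemma component_closed: "E `` (E\<^sup>* `` {p}) \<subseteq> E\<^sup>* `` {p}"
  by (auto intro: rtrancl_into_rtrancl)

lemma component_eq: "v \<in> E\<^sup>* `` {p} \<Longrightarrow> E\<^sup>* `` {v} = E\<^sup>* `` {p}"
  using sym_rtrancl[OF sym_E] by (auto dest: symD intro: rtrancl_trans)

lemma adj_cut:
  assumes "E `` C \<subseteq> C"
  shows "adj E (cut C x) v = (if v \<in> C then adj E x v else 0)"
proof (cases "v \<in> C")
  case True
  then show ?thesis using assms by (auto simp: adj_def cut_def intro!: sum.cong)
next
  case False
  have "w \<notin> C" if "(v, w) \<in> E" for w using False that assms sym_E by (auto dest: symD)
  then show ?thesis using False by (auto simp: adj_def cut_def intro!: sum.neutral)
qed

text \<open>
  Split \<open>C\<close> by the distance \<open>d\<close> from the root \<open>p\<close> modulo \<open>R\<close>. Some residue class contains at most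
  \<open>card C / R\<close> vertices. Walking from any vertex towards the root meets this class within \<open>R\<close>
  steps, unless the root comes first.
\<close>
lemma net_exists:
  assumes "p \<in> V" "0 < R" and C_def: "C = E\<^sup>* `` {p}"
  shows "\<exists>Z. finite Z \<and> C \<subseteq> nbhd E Z R \<and> real (card Z) \<le> real (card C) / real R + 1"
proof -
  have finC: "finite C" using component_subset[OF \<open>p \<in> V\<close>] finite_V finite_subset C_def by blast
  define d where "d v = (LEAST j. v \<in> nbhd E {p} j)" for v
  have d_in: "v \<in> nbhd E {p} (d v)" if "v \<in> C" for v
    unfolding d_def using rtrancl_in_nbhd[of p v E] that C_def by (auto intro: LeastI)
  have d_le: "d v \<le> j" if "v \<in> nbhd E {p} j" for v j
    unfolding d_def using that by (rule Least_le)
  define L where "L i = {v \<in> C. d v mod R = i}" for i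
  have "(\<lambda>v. d v mod R) ` C \<subseteq> {..<R}" using \<open>0 < R\<close> by auto
  then have sum: "(\<Sum>i<R. card (L i)) = card C"
    using sum.group[of C "{..<R}" "\<lambda>v. d v mod R" "\<lambda>_. 1::nat"] finC
    by (simp add: L_def)
  have "\<exists>i<R. R * card (L i) \<le> card C"
  proof (rule ccontr)
    assume "\<not> ?thesis"
    then have "(\<Sum>i<R. card C) < (\<Sum>i<R. R * card (L i))"
      using \<open>0 < R\<close> by (intro sum_strict_mono) auto
    also have "\<dots> = R * card C" using sum by (simp add: sum_distrib_left[symmetric])
    finally show False by simp
  qed
  then obtain i where i: "i < R" "R * card (L i) \<le> card C" by blast
  define Z where "Z = insert p (L i)"
  have "v \<in> nbhd E Z R" if v: "v \<in> C" for v
  proof -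
    define t where "t = min (d v) ((d v + R - i) mod R)"
    have t: "t \<le> d v" "t \<le> R" using \<open>0 < R\<close> by (auto simp: t_def intro: less_imp_le min.coboundedI2)
    obtain w where w: "w \<in> nbhd E {p} (d v - t)" "v \<in> nbhd E {w} t"
      using nbhd_split[of v E "{p}" "d v - t" t] d_in[OF v] t by auto
    have wC: "w \<in> C" using w(1) subsetD[OF nbhd_subset_rtrancl[of E p "d v - t"]] C_def by blast
    have "d v \<le> d w + t" using nbhd_trans[OF d_in[OF wC] w(2)] by (rule d_le)
    with d_le[OF w(1)] have dw: "d w = d v - t" by simp
    have "w \<in> Z"
    proof (cases "d v \<le> (d v + R - i) mod R")
      case True
      then show ?thesis using dw d_in[OF wC] by (simp add: t_def Z_def)
    next
      case False
      then have t': "t = (d v + R - i) mod R" by (simp add: t_def)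
      define k where "k = (d v + R - i) div R"
      have k: "d v + R - i = R * k + t" unfolding k_def t' by simp
      have "k \<noteq> 0"
      proof
        assume "k = 0"
        then show False using k t i by simp
      qed
      then obtain k' where "k = Suc k'" by (cases k) auto
      then have "d v - t = R * k' + i" using k i t by simp
      then show ?thesis using dw wC i by (simp add: Z_def L_def)
    qed
    then have "v \<in> nbhd E Z (0 + t)" using w by (intro nbhd_trans[of w E Z 0]) auto
    then show ?thesis using subsetD[OF nbhd_mono[OF t(2)]] by simp
  qed
  moreover have "finite Z" using finC by (simp add: Z_def L_def)
  moreover have "real (card Z) \<le> real (card C) / real R + 1"
  proof -
    have "card Z \<le> card (L i) + 1"
      using card_insert_le_m1[of "card (L i) + 1" "L i" p] by (simp add: Z_def)
    moreover have "real (card (L i)) \<le> real (card C) / real R"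
      using i \<open>0 < R\<close> by (simp add: field_simps flip: of_nat_mult)
    ultimately show ?thesis by linarith
  qed
  ultimately show ?thesis by blast
qed

text \<open>
  The form \<open>\<mu> * ip V z z - ip V z (adj E z)\<close> is nonnegative, so a zero of it is a minimum, where its
  derivative \<open>- 2 * h\<close> vanishes.
\<close>
lemma eigenvector_if_form_maximal:
  assumes bdd: "bounded_on \<mu> V" and z: "\<And>v. v \<notin> V \<Longrightarrow> z v = 0"
    and ge: "\<mu> * ip V z z \<le> ip V z (adj E z)"
  shows "adj E z v = \<mu> * z v"
proof -
  have up: "ip V y (adj E y) \<le> \<mu> * ip V y y" if "\<And>v. v \<notin> V \<Longrightarrow> y v = 0" for y
    using bdd that unfolding bounded_on_def by blast
  define h where "h v = adj E z v - \<mu> * z v" for v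
  have h0: "h v = 0" if "v \<notin> V" for v using that z by (simp add: h_def)
  have hh: "ip V h h = ip V h (adj E z) - \<mu> * ip V h z"
    by (subst (2) h_def[abs_def]) (simp add: ip_diff ip_scale)
  define c where "c = \<mu> * ip V h h - ip V h (adj E h)"
  have ineq: "2 * t * ip V h h \<le> t\<^sup>2 * c" for t
  proof -
    have "ip V (\<lambda>v. z v + t * h v) (adj E (\<lambda>v. z v + t * h v))
      \<le> \<mu> * ip V (\<lambda>v. z v + t * h v) (\<lambda>v. z v + t * h v)"
      by (rule up) (simp add: z h0)
    then have "ip V z (adj E z) + 2 * t * ip V h (adj E z) + t\<^sup>2 * ip V h (adj E h)
      \<le> \<mu> * ip V z z + \<mu> * (2 * t * ip V h z) + \<mu> * (t\<^sup>2 * ip V h h)"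
      by (simp add: adj_add adj_scale ip_add ip_scale adj_sym[of z h, symmetric] ip_commute[of V "adj E z" h]
        ip_commute[of V z h] power2_eq_square algebra_simps)
    then show ?thesis using ge by (simp add: c_def hh algebra_simps)
  qed
  have c: "0 \<le> c" using up[of h] h0 by (simp add: c_def)
  have "ip V h h = 0"
  proof (cases "c = 0")
    case True
    then show ?thesis using ineq[of 1] ip_self_nonneg[of V h] by simp
  next
    case False
    then have "c > 0" using c by simp
    then have "2 * ip V h h * ip V h h \<le> ip V h h * ip V h h"
      using ineq[of "ip V h h / c"] by (simp add: field_simps power2_eq_square)
    then show ?thesis using mult_nonneg_nonneg[OF ip_self_nonneg[of V h] ip_self_nonneg[of V h]] by auto
  qed
  then show ?thesis using ip_self_eq_0[OF finite_V] h0 by (cases "v \<in> V") (auto simp: h_def z)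
qed

lemma abs_eigenvector:
  assumes bdd: "bounded_on \<mu> V" and y: "\<And>v. v \<notin> V \<Longrightarrow> y v = 0" "\<And>v. adj E y v = \<mu> * y v"
  shows "adj E (\<lambda>v. \<bar>y v\<bar>) v = \<mu> * \<bar>y v\<bar>"
proof (rule eigenvector_if_form_maximal[OF bdd])
  have "\<mu> * ip V y y = ip V y (adj E y)" by (simp add: y(2)[abs_def] ip_scale)
  then show "\<mu> * ip V (\<lambda>v. \<bar>y v\<bar>) (\<lambda>v. \<bar>y v\<bar>) \<le> ip V (\<lambda>v. \<bar>y v\<bar>) (adj E (\<lambda>v. \<bar>y v\<bar>))"
    using abs_adj_form[of y] by (simp add: ip_abs)
qed (simp add: y)

text \<open>
  At a zero of a nonnegative eigenvector, the entries at the neighbours sum to zero; so the zero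
  spreads over the whole component.
\<close>
lemma nonneg_eigenvector_zero:
  assumes "\<And>v. 0 \<le> y v" "\<And>v. adj E y v = \<mu> * y v" "y u = 0" "v \<in> E\<^sup>* `` {u}"
  shows "y v = 0"
proof -
  have "(u, v) \<in> E\<^sup>*" using assms(4) by simp
  then show ?thesis
  proof (induction rule: rtrancl_induct)
    case (step w x)
    then have "(\<Sum>x\<in>E `` {w}. y x) = 0" using assms(2)[of w] by (simp add: adj_def)
    then show ?case using step assms(1) by (subst (asm) sum_nonneg_eq_0_iff) auto
  qed (rule assms)
qed

lemma eigenvector_zero_on_component:
  assumes bdd: "bounded_on \<mu> V" and y: "\<And>v. v \<notin> V \<Longrightarrow> y v = 0" "\<And>v. adj E y v = \<mu> * y v"
    and "y u = 0" "v \<in> E\<^sup>* `` {u}"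
  shows "y v = 0"
  using nonneg_eigenvector_zero[of "\<lambda>v. \<bar>y v\<bar>" \<mu> u v] abs_eigenvector[OF bdd y] assms by simp

text \<open>
  The form splits as a sum over the components, one of which must contribute a positive amount.
\<close>
lemma unbounded_component:
  assumes "\<not> bounded_on \<mu> V" "0 < \<mu>"
  shows "\<exists>p\<in>V. \<exists>x. (\<forall>v. 0 \<le> x v) \<and> (\<forall>v. v \<notin> E\<^sup>* `` {p} \<longrightarrow> x v = 0) \<and> \<mu> * ip V x x < ip V x (adj E x)"
proof -
  obtain x0 where x0: "\<forall>v. v \<notin> V \<longrightarrow> x0 v = 0" "\<mu> * ip V x0 x0 < ip V x0 (adj E x0)"
    using assms(1) unfolding bounded_on_def by (auto simp: not_le)
  define x where "x v = \<bar>x0 v\<bar>" for v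
  have x: "\<mu> * ip V x x < ip V x (adj E x)"
    using abs_adj_form[of x0] x0(2) by (simp add: x_def[abs_def] ip_abs)
  define g where "g v = x v * (adj E x v - \<mu> * x v)" for v
  define comp where "comp v = E\<^sup>* `` {v}" for v
  have "0 < (\<Sum>v\<in>V. g v)"
    using x by (simp add: g_def ip_def algebra_simps sum_subtractf sum_distrib_left)
  also have "\<dots> = (\<Sum>C\<in>comp ` V. \<Sum>v\<in>{v\<in>V. comp v = C}. g v)"
    by (rule sum.image_gen[OF finite_V])
  finally obtain C where C: "C \<in> comp ` V" "0 < (\<Sum>v\<in>{v\<in>V. comp v = C}. g v)"
    by (meson not_le sum_nonpos)
  then obtain p where p: "p \<in> V" "C = comp p" by blast
  have inC: "comp v = C \<longleftrightarrow> v \<in> C" if "v \<in> V" for v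
    unfolding p(2) comp_def using component_eq[of v p] by blast
  then have set: "{v\<in>V. comp v = C} = {v\<in>V. v \<in> C}" by blast
  have closed: "E `` C \<subseteq> C" unfolding p(2) comp_def by (rule component_closed)
  have "ip V (cut C x) (adj E (cut C x)) - \<mu> * ip V (cut C x) (cut C x)
      = (\<Sum>v\<in>V. if v \<in> C then g v else 0)"
    unfolding ip_def sum_distrib_left sum_subtractf[symmetric] adj_cut[OF closed]
    by (intro sum.cong) (auto simp: cut_def g_def algebra_simps)
  also have "\<dots> = (\<Sum>v\<in>{v\<in>V. comp v = C}. g v)"
    unfolding set using finite_V by (simp add: sum.inter_filter)
  finally have "\<mu> * ip V (cut C x) (cut C x) < ip V (cut C x) (adj E (cut C x))" using C(2) by linarith
  then show ?thesis using p unfolding comp_def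
    by (intro bexI[of _ p] exI[of _ "cut C x"]) (auto simp: cut_def x_def)
qed

end

section \<open>Eigenvalue multiplicity when the form is positive semidefinite up to a rank-one term\<close>

text \<open>
  The situation of a Gram matrix of equiangular lines: \<open>\<mu> - A + J / 2\<close> is positive semidefinite.
\<close>
locale psd_graph = sym_graph V E for V :: "'a set" and E +
  fixes \<mu> :: real
  assumes \<mu>_pos: "0 < \<mu>"
    and psd: "ip V x (adj E x) \<le> \<mu> * ip V x x + (\<Sum>v\<in>V. x v)\<^sup>2 / 2"

text \<open>
  The linear functionals \<open>f 0, \<dots>, f (r - 1)\<close> witness that the rank is at most \<open>r\<close>: their common
  zeros belong to the kernel of \<open>\<mu> - A + J / 2\<close>.
\<close>
locale low_rank_graph = psd_graph V E \<mu> for V :: "'a set" and E \<mu> +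
  fixes r :: nat and f :: "nat \<Rightarrow> 'a \<Rightarrow> real"
  assumes kernel: "(\<And>c. c < r \<Longrightarrow> ip V (f c) x = 0) \<Longrightarrow> v \<in> V \<Longrightarrow>
      adj E x v = \<mu> * x v + (\<Sum>w\<in>V. x w) / 2"

context psd_graph
begin

text \<open>
  Some combination \<open>y\<close> of \<open>x\<close> and \<open>z\<close> has entries that sum to zero, so \<open>J\<close> does not help it; as the
  cross terms vanish, the form at \<open>y\<close> would be negative if \<open>x\<close> occurred in it. Hence the entries of
  \<open>z\<close> sum to zero, and \<open>z\<close> vanishes. So at most one of several regions that are pairwise disjoint
  and not joined by arcs can have an eigenvalue above \<open>\<mu>\<close>.
\<close>
lemma orthogonal_bad_vectors:
  assumes orth: "ip V x z = 0" "ip V x (adj E z) = 0"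
    and x: "\<mu> * ip V x x < ip V x (adj E x)" and z: "\<mu> * ip V z z \<le> ip V z (adj E z)"
    and "\<And>v. 0 \<le> z v" "v \<in> V"
  shows "z v = 0"
proof -
  define X where "X = (\<Sum>v\<in>V. x v)"
  define Z where "Z = (\<Sum>v\<in>V. z v)"
  define y where "y v = Z * x v - X * z v" for v
  have "(\<Sum>v\<in>V. y v) = 0"
    by (simp add: y_def X_def Z_def sum_subtractf flip: sum_distrib_left)
  then have "ip V y (adj E y) \<le> \<mu> * ip V y y" using psd[of y] by simp
  moreover have "ip V y (adj E y) = Z\<^sup>2 * ip V x (adj E x) + X\<^sup>2 * ip V z (adj E z)"
    using orth adj_sym[of z x]
    by (simp add: y_def[abs_def] adj_diff adj_scale ip_diff ip_scale power2_eq_square ip_commute[of V "adj E z" x])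
  moreover have "ip V y y = Z\<^sup>2 * ip V x x + X\<^sup>2 * ip V z z"
    using orth(1) by (simp add: y_def[abs_def] ip_diff ip_scale power2_eq_square ip_commute[of V z x])
  moreover have "X\<^sup>2 * (\<mu> * ip V z z) \<le> X\<^sup>2 * ip V z (adj E z)" using z by (intro mult_left_mono) auto
  ultimately have "Z\<^sup>2 * (ip V x (adj E x) - \<mu> * ip V x x) \<le> 0" by (simp add: algebra_simps)
  then have "Z = 0" using x by (simp add: mult_le_0_iff)
  then show ?thesis using assms(5,6) finite_V by (simp add: Z_def sum_nonneg_eq_0_iff)
qed

end

context low_rank_graph
begin

text \<open>
  Pairing \<open>\<mu> * x - A x + J x / 2 = 0\<close> with \<open>x\<close> adds two nonnegative terms.
\<close>
lemma kernel_sum: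
  assumes bdd: "bounded_on \<mu> V" and x: "\<And>v. v \<notin> V \<Longrightarrow> x v = 0"
    and ker: "\<And>c. c < r \<Longrightarrow> ip V (f c) x = 0"
  shows "(\<Sum>v\<in>V. x v) = 0"
proof -
  define S where "S = (\<Sum>w\<in>V. x w)"
  have "ip V x (adj E x) = (\<Sum>v\<in>V. \<mu> * (x v * x v) + S / 2 * x v)"
    unfolding ip_def S_def using kernel[OF ker] by (intro sum.cong) (auto simp: algebra_simps)
  also have "\<dots> = \<mu> * ip V x x + S / 2 * S"
    unfolding sum.distrib sum_distrib_left[symmetric] by (simp add: ip_def S_def)
  finally have "ip V x (adj E x) = \<mu> * ip V x x + S / 2 * S" .
  moreover have "ip V x (adj E x) \<le> \<mu> * ip V x x"
    using bdd x unfolding bounded_on_def by blast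
  ultimately have "S\<^sup>2 \<le> 0" by (simp add: power2_eq_square)
  then show ?thesis by (simp add: S_def)
qed

text \<open>
  Fixing one vertex in every component that carries an eigenvector for \<open>\<mu>\<close> (a \<^emph>\<open>critical\<close>
  component) and letting a solution vanish there forces it to be zero. One component \<open>C0\<close> can be
  spared, because on it the solution has constant sign while its entries sum to zero.
\<close>
lemma card_bound_if_bounded:
  assumes bdd: "bounded_on \<mu> V"
    and crit: "\<And>p y. p \<in> V \<Longrightarrow> (\<And>v. v \<notin> E\<^sup>* `` {p} \<Longrightarrow> y v = 0) \<Longrightarrow> (\<And>v. adj E y v = \<mu> * y v)
      \<Longrightarrow> y p \<noteq> 0 \<Longrightarrow> k \<le> card (E\<^sup>* `` {p})"
    and "r < card V"
  shows "k * (card V - r + 1) \<le> card V"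
proof -
  define comp where "comp v = E\<^sup>* `` {v}" for v
  define crits where "crits = {C \<in> comp ` V. \<exists>y v. (\<forall>v. v \<notin> C \<longrightarrow> y v = 0) \<and> (\<forall>v. adj E y v = \<mu> * y v) \<and> v \<in> C \<and> y v \<noteq> 0}"
  have fin: "finite crits" using finite_V by (simp add: crits_def)
  have crits_sub: "crits \<subseteq> comp ` V" by (auto simp: crits_def)
  have in_comp: "v \<in> comp v" for v by (simp add: comp_def)
  have comp_V: "comp v \<subseteq> V" if "v \<in> V" for v unfolding comp_def using component_subset[OF that] .
  have comp_eq: "comp u = comp v" if "u \<in> comp v" for u v
    using component_eq that unfolding comp_def by blast
  have closed: "E `` comp v \<subseteq> comp v" for v unfolding comp_def by (rule component_closed)
  have cut_eig: "adj E (cut (comp v) y) u = \<mu> * cut (comp v) y u" if "\<And>u. adj E y u = \<mu> * y u" for v y u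
    by (simp add: adj_cut[OF closed] that) (simp add: cut_def)
  have comp_crit: "comp v \<in> crits" if "v \<in> V" "y v \<noteq> 0" "\<And>u. adj E y u = \<mu> * y u" for v y
    unfolding crits_def using that cut_eig[of y v] in_comp[of v]
    by (auto intro!: exI[of _ "cut (comp v) y"] exI[of _ v] simp: cut_def)
  have ker: "adj E y u = \<mu> * y u" if "\<And>c. c < r \<Longrightarrow> ip V (f c) y = 0" "\<And>u. u \<notin> V \<Longrightarrow> y u = 0" for y u
    using kernel[of y u] kernel_sum[OF bdd, of y] that by (cases "u \<in> V") auto
  obtain y0 where y0: "\<exists>v\<in>V. y0 v \<noteq> 0" "\<forall>v. v \<notin> V \<longrightarrow> y0 v = 0" "\<forall>c\<in>{..<r}. ip V (f c) y0 = 0"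
    using homogeneous_system_nontrivial_solution[of "{..<r}" V f] finite_V assms(3) by auto
  then obtain v0 where v0: "v0 \<in> V" "y0 v0 \<noteq> 0" by blast
  then have C0: "comp v0 \<in> crits" using comp_crit[of v0 y0] ker[of y0] y0 by auto
  define C0 where "C0 = comp v0"
  have card_le: "card V \<le> r + (card crits - 1)"
  proof (rule ccontr)
    assume less: "\<not> ?thesis"
    define rep where "rep C = (SOME v. v \<in> C)" for C :: "'a set"
    have rep: "rep (comp v) \<in> comp v" for v unfolding rep_def using in_comp[of v] by (rule someI)
    define I where "I = Inl ` {..<r} \<union> Inr ` (crits - {C0})"
    have "card I = r + (card crits - 1)"
      unfolding I_def using fin C0 by (subst card_Un_disjoint) (auto simp: card_image C0_def)
    then have "card I < card V" using less by simp
    then obtain y where y: "\<exists>v\<in>V. y v \<noteq> 0" "\<forall>v. v \<notin> V \<longrightarrow> y v = 0"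
      "\<forall>i\<in>I. ip V (case_sum f (\<lambda>C. point (rep C)) i) y = 0"
      using homogeneous_system_nontrivial_solution[of I V "case_sum f (\<lambda>C. point (rep C))"] fin finite_V
      by (auto simp: I_def)
    have yf: "ip V (f c) y = 0" if "c < r" for c using bspec[OF y(3), of "Inl c"] that by (simp add: I_def)
    have eig: "adj E y u = \<mu> * y u" for u using ker[OF yf] y(2) by blast
    have sum0: "(\<Sum>v\<in>V. y v) = 0" using kernel_sum[OF bdd, of y] yf y(2) by blast
    have rep0: "y (rep (comp v)) = 0" if "v \<in> V" "comp v \<in> crits" "comp v \<noteq> C0" for v
    proof -
      have "rep (comp v) \<in> V" using rep[of v] comp_V that by blast
      then show ?thesis using bspec[OF y(3), of "Inr (comp v)"] that finite_V
        by (simp add: I_def ip_point)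
    qed
    have zero_or: "y w = 0 \<or> comp w = C0" if w: "w \<in> V" for w
    proof (rule ccontr)
      assume contra: "\<not> (y w = 0 \<or> comp w = C0)"
      then have "y (rep (comp w)) = 0" using rep0[OF w] comp_crit[OF w, of y] eig by auto
      moreover have "w \<in> E\<^sup>* `` {rep (comp w)}"
        using comp_eq[OF rep[of w]] in_comp[of w] by (simp add: comp_def)
      ultimately have "y w = 0"
        using eigenvector_zero_on_component[OF bdd] y(2) eig by blast
      then show False using contra by simp
    qed
    \<comment> \<open>The solution lives on one component, on which an eigenvector has constant sign.\<close>
    obtain w where w: "w \<in> V" "y w \<noteq> 0" using y(1) by blast
    define s where "s = sgn (y w)"
    have s: "s * y w = \<bar>y w\<bar>" "s \<noteq> 0" using w by (simp_all add: s_def mult.commute abs_sgn sgn_if)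
    define h where "h v = \<bar>y v\<bar> - s * y v" for v
    have "adj E h v = \<mu> * h v" for v
      unfolding h_def[abs_def] adj_diff adj_scale
      using abs_eigenvector[OF bdd, of y v] y(2) eig by (simp add: algebra_simps)
    moreover have "h v = 0" if "v \<notin> V" for v using y(2) that by (simp add: h_def)
    ultimately have hz: "h v = 0" if "v \<in> comp w" for v
      using eigenvector_zero_on_component[OF bdd, of h w v] s that by (simp add: comp_def h_def)
    have "\<bar>y v\<bar> = s * y v" if v: "v \<in> V" for v
    proof (cases "y v = 0")
      case False
      then have "comp v = comp w" using zero_or[OF v] zero_or[OF w(1)] w by auto
      then show ?thesis using hz[of v] in_comp[of v] by (simp add: h_def)
    qed simp
    then have "(\<Sum>v\<in>V. \<bar>y v\<bar>) = 0" using sum0 by (simp flip: sum_distrib_left)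
    then show False using finite_V w by (simp add: sum_nonneg_eq_0_iff)
  qed
  have "k * card crits \<le> (\<Sum>C\<in>crits. card C)"
  proof -
    have "k \<le> card C" if C_crit: "C \<in> crits" for C
    proof -
      have "\<exists>y v. (\<forall>v. v \<notin> C \<longrightarrow> y v = 0) \<and> (\<forall>v. adj E y v = \<mu> * y v) \<and> v \<in> C \<and> y v \<noteq> 0"
        and "C \<in> comp ` V"
        using C_crit unfolding crits_def by simp_all
      then obtain y v p where y: "\<forall>v. v \<notin> C \<longrightarrow> y v = 0"
        "\<forall>v. adj E y v = \<mu> * y v" "v \<in> C" "y v \<noteq> 0" and "p \<in> V" "C = comp p"
        by (elim exE conjE imageE)
      then have "v \<in> V" "comp v = C" using y(3) comp_V comp_eq by blast+
      then have C: "E\<^sup>* `` {v} = C" by (simp add: comp_def)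
      have "k \<le> card (E\<^sup>* `` {v})"
        by (rule crit[of v y]) (use y C \<open>v \<in> V\<close> in simp_all)
      then show ?thesis using C by simp
    qed
    then show ?thesis using sum_mono[of crits "\<lambda>_. k" card] by (simp add: mult.commute)
  qed
  also have "\<dots> = card (\<Union>crits)"
  proof (rule card_Union_disjoint[symmetric])
    show "pairwise disjnt crits"
    proof (rule pairwiseI)
      fix A B assume AB: "A \<in> crits" "B \<in> crits" "A \<noteq> B"
      then obtain a b where ab: "A = comp a" "B = comp b" using crits_sub by blast
      have False if "v \<in> A" "v \<in> B" for v
        using comp_eq[of v a] comp_eq[of v b] that ab AB(3) by simp
      then show "disjnt A B" unfolding disjnt_def by blast
    qed
    show "finite C" if C_crit: "C \<in> crits" for C
    proof -
      obtain a where "a \<in> V" "C = comp a" using crits_sub C_crit by blast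
      then show ?thesis using comp_V finite_V finite_subset by blast
    qed
  qed
  also have "\<dots> \<le> card V"
    using comp_V crits_sub by (intro card_mono finite_V) blast
  finally have "k * card crits \<le> card V" .
  moreover have "card V - r + 1 \<le> card crits"
    using card_le assms(3) by auto
  ultimately show ?thesis using mult_le_mono2 order_trans by blast
qed

text \<open>
  The solutions considered vanish on the net \<open>Z\<close> and on the exceptional ball \<open>U\<close>, and their entries
  sum to zero. They also vanish outside the bad component \<open>C\<close>: their absolute values there
  would otherwise contradict \<open>orthogonal_bad_vectors\<close>. Radius \<open>2 * s + 1\<close> makes balls of radius \<open>s\<close>
  outside \<open>U\<close> neither meet nor touch the bad one.
\<close>
lemma card_bound_if_unbounded:
  assumes unb: "\<not> bounded_on \<mu> V" and b: "\<mu> \<le> b" "1 \<le> b"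
    and deg: "\<And>v. card (E `` {v}) \<le> \<Delta>" and Rq: "0 < R" "0 < q"
  shows "real (card V) \<le> real (r + 1) + (real (card V) / real R + 1) + real (\<Delta> + 1) ^ (2 * (R * q) + 1)
    + real (card V) * (1 - 1 / b ^ (2 * R)) ^ q"
proof -
  obtain p x where p: "p \<in> V" and x: "\<And>v. 0 \<le> x v" "\<And>v. v \<notin> E\<^sup>* `` {p} \<Longrightarrow> x v = 0"
    and bad: "\<mu> * ip V x x < ip V x (adj E x)"
    using unbounded_component[OF unb \<mu>_pos] by blast
  define C where "C = E\<^sup>* `` {p}"
  have CV: "C \<subseteq> V" unfolding C_def by (rule component_subset[OF p])
  have closed: "E `` C \<subseteq> C" unfolding C_def by (rule component_closed)
  have closed': "E `` (- C) \<subseteq> - C" using closed sym_E by (auto dest: symD)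
  have nbr: "E `` {v} \<noteq> {}" if v: "v \<in> C" for v
  proof
    assume iso: "E `` {v} = {}"
    have C_v: "C = {v}"
    proof -
      have "E\<^sup>* `` {v} = {v}" using iso by (auto elim: converse_rtranclE)
      then show ?thesis using component_eq[of v p] v by (simp add: C_def)
    qed
    have "adj E x u = 0" for u
      unfolding adj_def
    proof (rule sum.neutral, rule ballI)
      fix w assume "w \<in> E `` {u}"
      then have "w \<noteq> v" using iso sym_E by (auto dest: symD)
      then have "w \<notin> E\<^sup>* `` {p}" using C_v by (simp add: C_def)
      then show "x w = 0" by (rule x(2))
    qed
    then have "ip V x (adj E x) = 0" by (simp add: ip_def)
    then show False using bad mult_nonneg_nonneg[OF less_imp_le[OF \<mu>_pos] ip_self_nonneg[of V x]] by linarith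
  qed
  have card_C: "card C \<le> card V" using CV finite_V by (simp add: card_mono)
  obtain Z where Z: "finite Z" "C \<subseteq> nbhd E Z R" "real (card Z) \<le> real (card C) / real R + 1"
    using net_exists[OF p Rq(1) C_def] by blast
  define s where "s = R * q"
  obtain U where U: "finite U" "real (card U) \<le> real (\<Delta> + 1) ^ (2 * s + 1)"
    and good: "\<And>v. v \<notin> U \<Longrightarrow> bounded_on \<mu> (nbhd E {v} s)"
  proof (cases "\<exists>v0. \<not> bounded_on \<mu> (nbhd E {v0} s)")
    case False
    then show ?thesis by (intro that[of "{}"]) auto
  next
    case True
    then obtain v0 where v0: "\<not> bounded_on \<mu> (nbhd E {v0} s)" by blast
    have abs_bad: "\<exists>x. (\<forall>v. 0 \<le> x v) \<and> (\<forall>v. v \<notin> Q \<longrightarrow> x v = 0) \<and> \<mu> * ip V x x < ip V x (adj E x)"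
      if bad_Q: "\<not> bounded_on \<mu> Q" for Q
    proof -
      obtain x where "\<forall>v. v \<notin> Q \<longrightarrow> x v = 0" "\<mu> * ip V x x < ip V x (adj E x)"
        using bad_Q unfolding bounded_on_def by (auto simp: not_le)
      then show ?thesis using abs_adj_form[of x]
        by (intro exI[of _ "\<lambda>v. \<bar>x v\<bar>"]) (auto simp: ip_abs)
    qed
    obtain x1 where x1: "\<forall>v. 0 \<le> x1 v" "\<forall>v. v \<notin> nbhd E {v0} s \<longrightarrow> x1 v = 0" "\<mu> * ip V x1 x1 < ip V x1 (adj E x1)"
      using abs_bad[OF v0] by blast
    have "bounded_on \<mu> (nbhd E {v} s)" if v: "v \<notin> nbhd E {v0} (2 * s + 1)" for v
    proof (rule ccontr)
      assume "\<not> ?thesis"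
      then obtain z where z: "\<forall>v. 0 \<le> z v" "\<forall>u. u \<notin> nbhd E {v} s \<longrightarrow> z u = 0" "\<mu> * ip V z z < ip V z (adj E z)"
        using abs_bad by blast
      have far: "u \<noteq> w \<and> (u, w) \<notin> E" if u: "u \<in> nbhd E {v0} s" and w: "w \<in> nbhd E {v} s" for u w
      proof -
        have "w \<notin> nbhd E {v0} (s + 1)"
          using nbhd_trans[OF _ nbhd_sym[OF sym_E w], of "{v0}" "s + 1"] v by (auto simp: mult_2)
        then show ?thesis using u by auto
      qed
      have "ip V x1 z = 0" unfolding ip_def
        using far x1(2) z(2) by (intro sum.neutral) (metis mult_eq_0_iff)
      moreover have "ip V x1 (adj E z) = 0" unfolding ip_def
      proof (intro sum.neutral ballI)
        fix u assume "u \<in> V"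
        have "adj E z u = 0" if "u \<in> nbhd E {v0} s"
          unfolding adj_def using far[OF that] z(2) by (intro sum.neutral) auto
        then show "x1 u * adj E z u = 0" using x1(2) by auto
      qed
      ultimately have "\<forall>v\<in>V. z v = 0"
        using orthogonal_bad_vectors[of x1 z] x1(3) z(1,3) by auto
      then have "ip V z (adj E z) = 0" "ip V z z = 0" by (simp_all add: ip_def)
      then show False using z(3) by simp
    qed
    moreover have "card (nbhd E {v0} (2 * s + 1)) \<le> 1 * (\<Delta> + 1) ^ (2 * s + 1)"
      using card_nbhd_le(1)[OF deg, of "{v0}" "2 * s + 1"] by simp
    then have "real (card (nbhd E {v0} (2 * s + 1))) \<le> real (\<Delta> + 1) ^ (2 * s + 1)"
      by (metis mult_1 of_nat_le_iff of_nat_power)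
    ultimately show ?thesis
      using that[of "nbhd E {v0} (2 * s + 1)"] card_nbhd_le(2)[OF deg, of "{v0}"] by blast
  qed
  define H where "H = C - Z - U"
  \<comment> \<open>One more equation makes the entries sum to zero.\<close>
  define f' where "f' = f(r := \<lambda>_. 1)"
  define m where "m = card V - (r + 1 + card (Z \<union> U))"
  define I where "I = Inl ` {..<r + 1} \<union> Inr ` (Z \<union> U)"
  have card_I: "card I = r + 1 + card (Z \<union> U)"
    unfolding I_def using Z(1) U(1) by (subst card_Un_disjoint) (auto simp: card_image)
  have "real m \<le> real (card V) * (1 - 1 / b ^ (2 * R)) ^ q"
  proof (cases "card I \<le> card V")
    case False
    then show ?thesis using b by (simp add: m_def card_I)
  next
    case True
    then have "card I + m \<le> card V" by (simp add: m_def card_I)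
    then obtain X where X: "orthonormal V m X" "\<And>i v. i < m \<Longrightarrow> v \<notin> V \<Longrightarrow> X i v = 0"
      "\<And>i c. i < m \<Longrightarrow> c \<in> I \<Longrightarrow> ip V (case_sum f' point c) (X i) = 0"
      using homogeneous_system_orthonormal_solutions[of I V m "case_sum f' point"] finite_V Z(1) U(1)
      by (auto simp: I_def)
    have eig: "adj E (X i) v = \<mu> * X i v" if i: "i < m" for i v
    proof (cases "v \<in> V")
      case True
      have "ip V (f' r) (X i) = 0" using X(3)[OF i, of "Inl r"] by (simp add: I_def)
      then have sum0: "(\<Sum>w\<in>V. X i w) = 0" by (simp add: ip_def f'_def)
      have "ip V (f c) (X i) = 0" if "c < r" for c
        using X(3)[OF i, of "Inl c"] that by (simp add: I_def f'_def)
      from kernel[OF this True] show ?thesis using sum0 by simp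
    qed (simp add: X(2)[OF i])
    have X_ZU: "X i v = 0" if "i < m" "v \<in> Z \<union> U" for i v
      using X(3)[OF that(1), of "Inr v"] X(2)[OF that(1), of v] that(2) finite_V
      by (cases "v \<in> V") (simp_all add: I_def ip_point)
    have X_C: "X i v = 0" if i: "i < m" and v: "v \<notin> C" for i v
    proof (cases "v \<in> V")
      case True
      define y where "y = cut (- C) (X i)"
      have "adj E y u = \<mu> * y u" for u
        unfolding y_def using eig[OF i] by (simp add: adj_cut[OF closed']) (simp add: cut_def)
      then have "\<mu> * ip V y y = ip V y (adj E y)" by (simp add: ip_def sum_distrib_left mult_ac)
      define z where "z u = \<bar>y u\<bar>" for u
      have "\<mu> * ip V z z \<le> ip V z (adj E z)"
        using abs_adj_form[of y] \<open>\<mu> * ip V y y = _\<close> by (simp add: z_def[abs_def] ip_abs)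
      moreover have zC: "z u = 0" if "u \<in> C" for u using that by (simp add: z_def y_def cut_def)
      have "ip V x z = 0" unfolding ip_def
        using x(2) zC by (intro sum.neutral) (auto simp: C_def)
      moreover have "ip V x (adj E z) = 0" unfolding ip_def
      proof (intro sum.neutral ballI)
        fix u
        have "adj E z u = 0" if "u \<in> C" unfolding adj_def using closed that zC by (intro sum.neutral) auto
        then show "x u * adj E z u = 0" using x(2) by (auto simp: C_def)
      qed
      ultimately have "z v = 0" using bad True
        by (intro orthogonal_bad_vectors[of x z v]) (simp_all add: z_def)
      then show ?thesis using v by (simp add: z_def y_def cut_def)
    qed (simp add: X(2)[OF i])
    show ?thesis
    proof (rule restricted_eigenspace_dim_le[where C = C and Z = Z and H = H and X = X and \<mu> = \<mu>])
      show "X i v = 0" if "i < m" "v \<notin> H" for i v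
        using that X_ZU X_C by (auto simp: H_def)
    qed (use nbr closed CV Z Rq good \<mu>_pos b X(1) eig in \<open>auto simp: H_def s_def\<close>)
  qed
  moreover have "real (card V) \<le> real (r + 1) + real (card Z) + real (card U) + real m"
    using card_Un_le[of Z U] unfolding m_def by linarith
  moreover have "real (card C) / real R \<le> real (card V) / real R"
    using card_C by (simp add: divide_right_mono)
  ultimately show ?thesis using Z(3) U(2) unfolding s_def by linarith
qed

end

section \<open>Independent sets, switching and bounded degree\<close>

text \<open>
  By induction on \<open>a\<close>: if some vertex has \<open>t ^ a\<close> neighbours, it extends a clique among them. Otherwise
  all degrees are below \<open>t ^ a\<close>, and a maximal independent set has \<open>t\<close> elements, since together with its neighbours it covers
  everything. The bound is exponential in the clique size only, and this keeps the threshold for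
  \<open>r\<close> in the theorem singly exponential.
\<close>
lemma clique_or_independent_set:
  assumes "finite W" "t ^ a \<le> card W" "0 < t" and sym: "\<And>v w. P v w \<Longrightarrow> P w v"
  shows "(\<exists>K\<subseteq>W. card K = a \<and> (\<forall>v\<in>K. \<forall>w\<in>K. v \<noteq> w \<longrightarrow> P v w)) \<or>
    (\<exists>S\<subseteq>W. t \<le> card S \<and> (\<forall>v\<in>S. \<forall>w\<in>S. v \<noteq> w \<longrightarrow> \<not> P v w))"
  using assms(1,2)
proof (induction a arbitrary: W)
  case 0
  then show ?case by (intro disjI1 exI[of _ "{}"]) auto
next
  case (Suc a)
  define N where "N v = {w \<in> W. w \<noteq> v \<and> P v w}" for v
  show ?case
  proof (cases "\<exists>v\<in>W. t ^ a \<le> card (N v)")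
    case True
    then obtain v where v: "v \<in> W" "t ^ a \<le> card (N v)" by blast
    have "finite (N v)" using Suc.prems by (simp add: N_def)
    from Suc.IH[OF this v(2)] show ?thesis
    proof (elim disjE exE conjE)
      fix K assume K: "K \<subseteq> N v" "card K = a" "\<forall>v\<in>K. \<forall>w\<in>K. v \<noteq> w \<longrightarrow> P v w"
      have "finite K" "v \<notin> K" using K(1) \<open>finite (N v)\<close> finite_subset by (auto simp: N_def)
      then have "insert v K \<subseteq> W \<and> card (insert v K) = Suc a \<and>
          (\<forall>x\<in>insert v K. \<forall>w\<in>insert v K. x \<noteq> w \<longrightarrow> P x w)"
        using K v sym by (auto simp: N_def)
      then show ?thesis by blast
    next
      fix S assume "S \<subseteq> N v" "t \<le> card S" "\<forall>v\<in>S. \<forall>w\<in>S. v \<noteq> w \<longrightarrow> \<not> P v w"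
      then show ?thesis by (intro disjI2 exI[of _ S]) (auto simp: N_def)
    qed
  next
    case False
    define indep where "indep S \<longleftrightarrow> S \<subseteq> W \<and> (\<forall>v\<in>S. \<forall>w\<in>S. v \<noteq> w \<longrightarrow> \<not> P v w)" for S
    have "finite (Collect indep)"
      using Suc.prems(1) by (rule_tac finite_subset[of _ "Pow W"]) (auto simp: indep_def)
    moreover have "indep {}" by (simp add: indep_def)
    ultimately obtain S where S: "indep S" and max: "\<And>T. indep T \<Longrightarrow> S \<subseteq> T \<Longrightarrow> T = S"
      using finite_has_maximal[of "Collect indep"] by auto
    have "W \<subseteq> (\<Union>v\<in>S. insert v (N v))"
    proof
      fix w assume w: "w \<in> W"
      show "w \<in> (\<Union>v\<in>S. insert v (N v))"
      proof (rule ccontr)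
        assume contra: "w \<notin> (\<Union>v\<in>S. insert v (N v))"
        then have "indep (insert w S)" using S w sym unfolding indep_def N_def by blast
        then have "insert w S = S" by (rule max) blast
        then show False using contra by blast
      qed
    qed
    moreover have "finite S" using S Suc.prems(1) finite_subset unfolding indep_def by blast
    ultimately have "card W \<le> card (\<Union>v\<in>S. insert v (N v))"
      using Suc.prems(1) by (intro card_mono) (auto simp: N_def)
    also have "\<dots> \<le> (\<Sum>v\<in>S. card (insert v (N v)))" by (rule card_UN_le[OF \<open>finite S\<close>])
    also have "\<dots> \<le> (\<Sum>v\<in>S. t ^ a)"
    proof (rule sum_mono)
      fix v assume "v \<in> S"
      then have "card (N v) < t ^ a" using False S unfolding indep_def by force
      moreover have "card (insert v (N v)) \<le> Suc (card (N v))" by (rule card_insert_le_m1) auto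
      ultimately show "card (insert v (N v)) \<le> t ^ a" by simp
    qed
    finally have "card W \<le> card S * t ^ a" by simp
    then have "t * t ^ a \<le> card S * t ^ a" using Suc.prems(2) by (metis power_Suc order_trans)
    then have "t \<le> card S" using \<open>0 < t\<close> by simp
    then show ?thesis using S unfolding indep_def by blast
  qed
qed

definition equiangular_family :: "'a set \<Rightarrow> nat \<Rightarrow> real \<Rightarrow> ('a \<Rightarrow> nat \<Rightarrow> real) \<Rightarrow> bool" where
  "equiangular_family V r \<alpha> u \<longleftrightarrow>
    (\<forall>v\<in>V. \<forall>w\<in>V. \<bar>ip {..<r} (u v) (u w)\<bar> = (if v = w then 1 else \<alpha>))"

definition obtuse_arcs :: "'a set \<Rightarrow> nat \<Rightarrow> ('a \<Rightarrow> nat \<Rightarrow> real) \<Rightarrow> ('a \<times> 'a) set" where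
  "obtuse_arcs V r u = {(v, w) \<in> V \<times> V. ip {..<r} (u v) (u w) < 0}"

text \<open>
  Negating the vectors in \<open>F\<close>, known as switching for the graph of obtuse angles, preserves the lines.
\<close>
definition flip :: "'a set \<Rightarrow> ('a \<Rightarrow> nat \<Rightarrow> real) \<Rightarrow> 'a \<Rightarrow> nat \<Rightarrow> real" where
  "flip F u v c = (if v \<in> F then - u v c else u v c)"

lemma ip_flip: "ip X (flip F u v) (flip F u w) =
    (if v \<in> F \<longleftrightarrow> w \<in> F then ip X (u v) (u w) else - ip X (u v) (u w))"
  by (auto simp: ip_def flip_def sum_negf)

lemma equiangular_family_flip: "equiangular_family V r \<alpha> u \<Longrightarrow> equiangular_family V r \<alpha> (flip F u)"
  unfolding equiangular_family_def ip_flip by auto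

lemma gram_entry:
  assumes "equiangular_family V r \<alpha> u" "0 < \<alpha>" "v \<in> V" "w \<in> V"
  shows "ip {..<r} (u v) (u w) =
    (if v = w then 1 - \<alpha> else 0) + \<alpha> - (if (v, w) \<in> obtuse_arcs V r u then 2 * \<alpha> else 0)"
proof (cases "v = w")
  case True
  then show ?thesis using assms ip_self_nonneg[of "{..<r}" "u v"]
    by (fastforce simp: equiangular_family_def obtuse_arcs_def)
next
  case False
  then have "\<bar>ip {..<r} (u v) (u w)\<bar> = \<alpha>" using assms by (simp add: equiangular_family_def)
  then show ?thesis using False assms by (auto simp: obtuse_arcs_def)
qed

lemma sym_graph_obtuse_arcs: "finite V \<Longrightarrow> sym_graph V (obtuse_arcs V r u)"
  by unfold_locales (auto simp: obtuse_arcs_def sym_def ip_commute)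

text \<open>
  The Gram matrix is \<open>(1 - \<alpha>) I + \<alpha> J - 2 \<alpha> A\<close>.
\<close>
lemma ip_combination:
  assumes V: "finite V" and u: "equiangular_family V r \<alpha> u" "0 < \<alpha>" and v: "v \<in> V"
  shows "(\<Sum>c<r. u v c * ip V (\<lambda>w. u w c) x)
    = (1 - \<alpha>) * x v + \<alpha> * (\<Sum>w\<in>V. x w) - 2 * \<alpha> * adj (obtuse_arcs V r u) x v"
proof -
  have "(\<Sum>c<r. u v c * ip V (\<lambda>w. u w c) x) = (\<Sum>w\<in>V. ip {..<r} (u v) (u w) * x w)"
    unfolding ip_def sum_distrib_left sum_distrib_right by (subst sum.swap) (simp add: mult_ac)
  also have "\<dots> = (\<Sum>w\<in>V. (if v = w then (1 - \<alpha>) * x w else 0) + \<alpha> * x w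
      - 2 * \<alpha> * (if (v, w) \<in> obtuse_arcs V r u then x w else 0))"
    by (intro sum.cong refl, subst gram_entry[OF u v], assumption) (auto simp: algebra_simps)
  also have "\<dots> = (1 - \<alpha>) * x v + \<alpha> * (\<Sum>w\<in>V. x w) - 2 * \<alpha> * adj (obtuse_arcs V r u) x v"
    using V v unfolding sum_subtractf sum.distrib
    by (simp add: sum_distrib_left sym_graph.adj_alt[OF sym_graph_obtuse_arcs[OF V]])
  finally show ?thesis .
qed

lemma low_rank_graph_obtuse_arcs:
  assumes V: "finite V" and u: "equiangular_family V r \<alpha> u" and \<alpha>: "0 < \<alpha>" "\<alpha> < 1"
  shows "low_rank_graph V (obtuse_arcs V r u) ((1 - \<alpha>) / (2 * \<alpha>)) r (\<lambda>c w. u w c)"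
proof -
  interpret sym_graph V "obtuse_arcs V r u" by (rule sym_graph_obtuse_arcs[OF V])
  show ?thesis
  proof unfold_locales
    fix x :: "'a \<Rightarrow> real"
    let ?A = "adj (obtuse_arcs V r u)"
    have "0 \<le> (\<Sum>c<r. (ip V (\<lambda>w. u w c) x)\<^sup>2)" by (intro sum_nonneg) auto
    also have "\<dots> = (\<Sum>v\<in>V. x v * (\<Sum>c<r. u v c * ip V (\<lambda>w. u w c) x))"
      unfolding sum_distrib_left power2_eq_square
      by (subst sum.swap) (simp add: ip_def sum_distrib_left sum_distrib_right mult_ac)
    also have "\<dots> = (\<Sum>v\<in>V. x v * ((1 - \<alpha>) * x v + \<alpha> * (\<Sum>w\<in>V. x w) - 2 * \<alpha> * ?A x v))"
      using ip_combination[OF V u \<alpha>(1)] by simp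
    also have "\<dots> = (1 - \<alpha>) * ip V x x + \<alpha> * (\<Sum>w\<in>V. x w)\<^sup>2 - 2 * \<alpha> * ip V x (?A x)"
      by (simp add: ip_def algebra_simps sum.distrib sum_subtractf power2_eq_square sum_distrib_left)
    finally show "ip V x (?A x) \<le> (1 - \<alpha>) / (2 * \<alpha>) * ip V x x + (\<Sum>v\<in>V. x v)\<^sup>2 / 2"
      using \<alpha> by (simp add: field_simps)
  next
    fix x :: "'a \<Rightarrow> real" and v assume ker: "\<And>c. c < r \<Longrightarrow> ip V (\<lambda>w. u w c) x = 0" and v: "v \<in> V"
    have "(\<Sum>c<r. u v c * ip V (\<lambda>w. u w c) x) = 0" using ker by simp
    then show "adj (obtuse_arcs V r u) x v = (1 - \<alpha>) / (2 * \<alpha>) * x v + (\<Sum>w\<in>V. x w) / 2"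
      using ip_combination[OF V u \<alpha>(1) v] \<alpha> by (simp add: field_simps)
  qed (use \<alpha> in simp)
qed

text \<open>
  The sum \<open>s\<close> of \<open>m\<close> such vectors has squared norm \<open>m * (1 + \<alpha> - \<alpha> * m)\<close>.
\<close>
lemma obtuse_clique_card_le:
  assumes u: "equiangular_family V r \<alpha> u" and \<alpha>: "0 < \<alpha>" "1 / \<alpha> \<le> real N"
    and K: "K \<subseteq> V" "finite K" "\<And>v w. v \<in> K \<Longrightarrow> w \<in> K \<Longrightarrow> v \<noteq> w \<Longrightarrow> ip {..<r} (u v) (u w) < 0"
  shows "card K \<le> N + 1"
proof (cases "K = {}")
  case False
  define s where "s c = (\<Sum>v\<in>K. u v c)" for c
  have ent: "ip {..<r} (u v) (u w) = (if v = w then 1 + \<alpha> else 0) - \<alpha>" if "v \<in> K" "w \<in> K" for v w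
    using gram_entry[OF u \<alpha>(1), of v w] that subsetD[OF K(1)] K(3)[of v w] ip_self_nonneg[of "{..<r}" "u v"]
    by (auto simp: obtuse_arcs_def)
  have "0 \<le> ip {..<r} s s" by (rule ip_self_nonneg)
  also have "\<dots> = (\<Sum>v\<in>K. \<Sum>w\<in>K. ip {..<r} (u v) (u w))"
    unfolding s_def[abs_def] ip_sum ..
  also have "\<dots> = (\<Sum>v\<in>K. \<Sum>w\<in>K. (if v = w then 1 + \<alpha> else 0) - \<alpha>)"
    using ent by simp
  also have "\<dots> = real (card K) * (1 + \<alpha> - \<alpha> * real (card K))"
    using K(2) by (simp add: sum_subtractf algebra_simps)
  finally have "0 \<le> 1 + \<alpha> - \<alpha> * real (card K)"
    using False K(2) by (simp add: zero_le_mult_iff card_gt_0_iff)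
  then have "real (card K) \<le> 1 / \<alpha> + 1" using \<alpha>(1) by (simp add: field_simps)
  then show ?thesis using \<alpha>(2) by linarith
qed simp

definition ind :: "'a set \<Rightarrow> 'a \<Rightarrow> real" where
  "ind T v = (if v \<in> T then 1 else 0)"

lemma ip_ind: "finite V \<Longrightarrow> T \<subseteq> V \<Longrightarrow> ip V (ind T) x = (\<Sum>v\<in>T. x v)"
  unfolding ip_def ind_def by (intro sum.mono_neutral_cong_right) auto

context psd_graph
begin

lemma adj_ind: "adj E (ind T) v = real (card (E `` {v} \<inter> T))"
  by (simp add: adj_def ind_def sum.If_cases Collect_mem_eq)

text \<open>
  Test the form with the vector that is \<open>1\<close> on \<open>N\<^sup>2\<close> neighbours of \<open>v\<close>, \<open>N\<close> at \<open>v\<close>, and constant on \<open>S\<close> so that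
  the entries sum to zero. Since \<open>S\<close> is much larger than \<open>N\<close> and sees few arcs, it contributes next
  to nothing, while the star around \<open>v\<close> has largest eigenvalue \<open>N > 2 * \<mu>\<close>.
\<close>
lemma few_common_neighbours:
  assumes S: "S \<subseteq> V" "\<And>v w. v \<in> S \<Longrightarrow> w \<in> S \<Longrightarrow> (v, w) \<notin> E" and N: "2 \<le> N" "2 * \<mu> + 1 \<le> real N"
    and big: "8 * N ^ 4 \<le> card S" and v: "v \<in> V" "v \<notin> S"
    and T: "T \<subseteq> E `` {v}" "card T = N\<^sup>2" "T \<inter> S = {}" "v \<notin> T"
    and few: "\<And>w. w \<in> insert v T \<Longrightarrow> card (E `` {w} \<inter> S) \<le> N\<^sup>2"
  shows False
proof -
  have TV: "T \<subseteq> V" using T(1) E_sub by blast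
  have fin: "finite S" "finite T" using S(1) TV finite_V finite_subset by blast+
  define n where "n = real N"
  define q where "q = real (card S)"
  have n: "2 \<le> n" "\<mu> \<le> (n - 1) / 2" using N by (simp_all add: n_def)
  have q: "8 * n ^ 4 \<le> q" unfolding n_def q_def using big by (metis of_nat_le_iff of_nat_mult of_nat_numeral of_nat_power)
  have qpos: "0 < q" using q n by (smt (verit) zero_less_power)
  define s where "s = (n\<^sup>2 + n) / q"
  have s0: "0 \<le> s" using n qpos by (simp add: s_def)
  have cT: "real (card T) = n\<^sup>2" by (simp add: T(2) n_def)
  define x where "x w = (ind T w + n * ind {v} w) - s * ind S w" for w
  have sumx: "(\<Sum>w\<in>V. x w) = 0"
  proof -
    have one: "(\<Sum>w\<in>V. ind Q w) = real (card Q)" if "Q \<subseteq> V" for Q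
      using ip_ind[OF finite_V that, of "\<lambda>_. 1"] by (simp add: ip_def)
    have "(\<Sum>w\<in>V. x w) = real (card T) + n * real (card {v}) - s * real (card S)"
      unfolding x_def sum_subtractf sum.distrib sum_distrib_left[symmetric]
      using one[OF TV] one[OF S(1)] one[of "{v}"] v by simp
    then show ?thesis using qpos by (simp add: s_def q_def[symmetric] cT)
  qed
  have xx: "ip V x x = n\<^sup>2 + n\<^sup>2 + s\<^sup>2 * q"
  proof -
    have "ip V x x = (\<Sum>w\<in>V. ind T w + n\<^sup>2 * ind {v} w + s\<^sup>2 * ind S w)"
      unfolding ip_def x_def using T(3,4) v(2)
      by (intro sum.cong) (auto simp: ind_def power2_eq_square)
    also have "\<dots> = ip V (ind T) (\<lambda>_. 1) + n\<^sup>2 * ip V (ind {v}) (\<lambda>_. 1) + s\<^sup>2 * ip V (ind S) (\<lambda>_. 1)"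
      by (simp add: ip_def sum.distrib sum_distrib_left)
    finally show ?thesis using v by (simp add: ip_ind[OF finite_V] TV S(1) cT q_def)
  qed
  have pos: "0 \<le> ip V (ind P) (adj E (ind Q))" for P Q
    unfolding ip_def adj_ind by (intro sum_nonneg) (simp add: ind_def)
  have vT: "ip V (ind {v}) (adj E (ind T)) = n\<^sup>2"
    using v T(1) cT by (simp add: ip_ind[OF finite_V] adj_ind Int_absorb1)
  have SS: "ip V (ind S) (adj E (ind S)) = 0"
  proof -
    have "E `` {w} \<inter> S = {}" if "w \<in> S" for w using S(2) that by blast
    then show ?thesis using S(1) by (simp add: ip_ind[OF finite_V] adj_ind)
  qed
  have TS: "ip V (ind T) (adj E (ind S)) \<le> n\<^sup>2 * n\<^sup>2"
  proof -
    have "ip V (ind T) (adj E (ind S)) = (\<Sum>w\<in>T. real (card (E `` {w} \<inter> S)))"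
      using TV by (simp add: ip_ind[OF finite_V] adj_ind)
    also have "\<dots> \<le> (\<Sum>w\<in>T. n\<^sup>2)"
      unfolding n_def using few by (intro sum_mono) (metis insertCI of_nat_le_iff of_nat_power)
    finally show ?thesis by (simp add: cT)
  qed
  have vS: "ip V (ind {v}) (adj E (ind S)) \<le> n\<^sup>2"
  proof -
    have "ip V (ind {v}) (adj E (ind S)) = real (card (E `` {v} \<inter> S))"
      using v by (simp add: ip_ind[OF finite_V] adj_ind)
    then show ?thesis unfolding n_def using few[of v] by (metis insertI1 of_nat_le_iff of_nat_power)
  qed
  have "ip V x (adj E x) = ip V (ind T) (adj E (ind T)) + n\<^sup>2 * ip V (ind {v}) (adj E (ind {v}))
      + 2 * n * ip V (ind {v}) (adj E (ind T)) - 2 * s * ip V (ind T) (adj E (ind S))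
      - 2 * s * n * ip V (ind {v}) (adj E (ind S)) + s\<^sup>2 * ip V (ind S) (adj E (ind S))"
    unfolding x_def[abs_def]
    by (simp add: adj_add adj_diff adj_scale ip_add ip_diff ip_scale power2_eq_square
      adj_sym[of "ind T" "ind {v}", symmetric] adj_sym[of "ind S" "ind {v}", symmetric]
      adj_sym[of "ind S" "ind T", symmetric] ip_commute[of V "adj E _"] algebra_simps)
  moreover have "s * ip V (ind T) (adj E (ind S)) \<le> s * (n\<^sup>2 * n\<^sup>2)"
    using TS s0 by (rule mult_left_mono)
  moreover have "(s * n) * ip V (ind {v}) (adj E (ind S)) \<le> (s * n) * n\<^sup>2"
    using vS s0 n by (intro mult_left_mono) auto
  moreover have "0 \<le> n\<^sup>2 * ip V (ind {v}) (adj E (ind {v}))" using pos by simp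
  ultimately have low: "2 * n * n\<^sup>2 - 2 * (s * (n\<^sup>2 * n\<^sup>2)) - 2 * (s * n * n\<^sup>2) \<le> ip V x (adj E x)"
    using pos[of T T] by (simp add: vT SS)
  define e where "e = (n\<^sup>2 + n)\<^sup>2 / q"
  have e: "e \<le> 1 / 2"
  proof -
    have "n \<le> n\<^sup>2 / 2" using n by (simp add: power2_eq_square)
    then have "(n\<^sup>2 + n)\<^sup>2 \<le> (3 / 2 * n\<^sup>2)\<^sup>2" using n by (intro power_mono) auto
    also have "\<dots> = 9 / 4 * n ^ 4" by (simp add: power_mult_distrib power2_eq_square power4_eq_xxxx)
    also have "\<dots> \<le> q / 2" using q zero_le_power[of n 4] n by linarith
    finally show ?thesis using qpos by (simp add: e_def field_simps)
  qed
  have e0: "0 \<le> e" using qpos by (simp add: e_def)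
  have "2 * (s * (n\<^sup>2 * n\<^sup>2)) + 2 * (s * n * n\<^sup>2) = 2 * e * n\<^sup>2"
  proof -
    have "2 * (s * (n\<^sup>2 * n\<^sup>2)) + 2 * (s * n * n\<^sup>2) = 2 * (s * (n\<^sup>2 + n)) * n\<^sup>2"
      by (simp add: algebra_simps)
    then show ?thesis by (simp add: s_def e_def power2_eq_square)
  qed
  moreover have "s\<^sup>2 * q = e" using qpos by (simp add: s_def e_def power2_eq_square)
  moreover have "ip V x (adj E x) \<le> \<mu> * ip V x x" using psd[of x] sumx by simp
  ultimately have "2 * n * n\<^sup>2 - 2 * e * n\<^sup>2 \<le> \<mu> * (n\<^sup>2 + n\<^sup>2 + e)" using low xx by simp
  also have "\<dots> \<le> (n - 1) / 2 * (n\<^sup>2 + n\<^sup>2 + e)" using n e0 by (intro mult_right_mono) auto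
  also have "\<dots> \<le> (n - 1) / 2 * (n\<^sup>2 + n\<^sup>2 + 1 / 2)" using n e by (intro mult_left_mono) auto
  finally have 1: "2 * n * n\<^sup>2 - 2 * e * n\<^sup>2 \<le> (n - 1) / 2 * (n\<^sup>2 + n\<^sup>2 + 1 / 2)" .
  have "2 * e * n\<^sup>2 \<le> n\<^sup>2" using e n mult_right_mono[of "2 * e" 1 "n\<^sup>2"] by simp
  with 1 have "2 * n * n\<^sup>2 - n\<^sup>2 \<le> (n - 1) / 2 * (n\<^sup>2 + n\<^sup>2 + 1 / 2)" by linarith
  then have "n * n\<^sup>2 \<le> n / 4" by (simp add: field_simps)
  moreover have "n * 4 \<le> n * n\<^sup>2" using n power_mono[of 2 n 2] by (intro mult_left_mono) auto
  ultimately show False using n by linarith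
qed

lemma neighbours_in_independent_set:
  assumes S: "S \<subseteq> V" "\<And>v w. v \<in> S \<Longrightarrow> w \<in> S \<Longrightarrow> (v, w) \<notin> E" and N: "2 \<le> N" "2 * \<mu> + 1 \<le> real N"
    and v: "v \<in> V" "v \<notin> S" and big: "8 * N ^ 4 \<le> card (S - E `` {v})"
  shows "card (E `` {v} \<inter> S) < N\<^sup>2"
proof (rule ccontr)
  assume "\<not> ?thesis"
  then obtain T where T: "T \<subseteq> E `` {v} \<inter> S" "card T = N\<^sup>2"
    by (meson not_less obtain_subset_with_card_n)
  have empty: "E `` {w} \<inter> (S - E `` {v}) = {}" if "w \<in> insert v T" for w
    using that T(1) S(2) by blast
  show False
    by (rule few_common_neighbours[of "S - E `` {v}" N v T])
       (use S N v big T empty in auto)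
qed

lemma degree_le:
  assumes S: "S \<subseteq> V" "\<And>v w. v \<in> S \<Longrightarrow> w \<in> S \<Longrightarrow> (v, w) \<notin> E" and N: "2 \<le> N" "2 * \<mu> + 1 \<le> real N"
    and big: "17 * N ^ 4 \<le> card S" and irrefl: "\<And>v. (v, v) \<notin> E"
    and few: "\<And>w. card (E `` {w} \<inter> S) \<le> N\<^sup>2"
  shows "card (E `` {v}) \<le> 2 * N\<^sup>2"
proof (rule ccontr)
  assume large: "\<not> ?thesis"
  then have "E `` {v} \<noteq> {}" by auto
  then have vV: "v \<in> V" using E_sub by blast
  have "card (E `` {v}) = card (E `` {v} \<inter> S) + card (E `` {v} - S)"
    using card_Int_Diff[OF finite_nbrs] .
  then have "N\<^sup>2 \<le> card (E `` {v} - S)" using large few[of v] by linarith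
  then obtain T where T: "T \<subseteq> E `` {v} - S" "card T = N\<^sup>2"
    by (meson obtain_subset_with_card_n)
  have finS: "finite S" using S(1) finite_V finite_subset by blast
  have few': "card (E `` {w} \<inter> (S - {v})) \<le> N\<^sup>2" for w
  proof -
    have "card (E `` {w} \<inter> (S - {v})) \<le> card (E `` {w} \<inter> S)"
      using finS by (intro card_mono) auto
    then show ?thesis using few[of w] by linarith
  qed
  have "card S - 1 \<le> card (S - {v})" by (simp add: card_Diff_singleton_if)
  moreover have "1 \<le> N ^ 4" using N by simp
  ultimately have "8 * N ^ 4 \<le> card (S - {v})" using big by linarith
  moreover have "v \<notin> T" using T(1) irrefl by blast
  ultimately show False
    using S N vV T(1) by (intro few_common_neighbours[of "S - {v}" N v T] few' T(2)) auto
qed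

end

text \<open>
  A vector outside the independent set \<open>S\<close> is adjacent either to few or to almost all elements of \<open>S\<close>;
  negating those of the second kind makes every vertex have few neighbours in \<open>S\<close>. Then no vertex can
  have many neighbours at all.
\<close>
lemma bounded_degree_switching:
  assumes V: "finite V" and u: "equiangular_family V r \<alpha> u" and \<alpha>: "0 < \<alpha>" "\<alpha> < 1"
    and N: "2 \<le> N" "1 / \<alpha> \<le> real N" and large: "(17 * N ^ 4) ^ (N + 2) \<le> card V"
  shows "\<exists>F. \<forall>v. card (obtuse_arcs V r (flip F u) `` {v}) \<le> 2 * N\<^sup>2"
proof -
  define \<mu> where "\<mu> = (1 - \<alpha>) / (2 * \<alpha>)"
  have \<mu>N: "2 * \<mu> + 1 \<le> real N" using N(2) \<alpha> by (simp add: \<mu>_def field_simps)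
  let ?g = "\<lambda>v w. ip {..<r} (u v) (u w)"
  let ?G = "\<lambda>F. obtuse_arcs V r (flip F u)"
  have psd: "psd_graph V (?G F) \<mu>" for F
    using low_rank_graph_obtuse_arcs[OF V equiangular_family_flip[OF u] \<alpha>, of F]
    unfolding \<mu>_def low_rank_graph_def by blast
  have no_clique: "\<not> (\<exists>K\<subseteq>V. card K = N + 2 \<and> (\<forall>v\<in>K. \<forall>w\<in>K. v \<noteq> w \<longrightarrow> ?g v w < 0))"
  proof (intro notI, elim exE conjE)
    fix K assume K: "K \<subseteq> V" "card K = N + 2" "\<forall>v\<in>K. \<forall>w\<in>K. v \<noteq> w \<longrightarrow> ?g v w < 0"
    have "card K \<le> N + 1"
      using K(1,3) finite_subset[OF K(1) V] by (intro obtuse_clique_card_le[OF u \<alpha>(1) N(2)]) auto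
    then show False using K(2) by simp
  qed
  have sym: "?g w v < 0" if "?g v w < 0" for v w using that by (simp add: ip_commute)
  have "0 < 17 * N ^ 4" using N(1) by simp
  then have "\<exists>S\<subseteq>V. 17 * N ^ 4 \<le> card S \<and> (\<forall>v\<in>S. \<forall>w\<in>S. v \<noteq> w \<longrightarrow> \<not> ?g v w < 0)"
    using clique_or_independent_set[OF V large, of "\<lambda>v w. ?g v w < 0"] sym no_clique by blast
  then obtain S where S: "S \<subseteq> V" "17 * N ^ 4 \<le> card S" "\<And>v w. v \<in> S \<Longrightarrow> w \<in> S \<Longrightarrow> v \<noteq> w \<Longrightarrow> 0 \<le> ?g v w"
    by (auto simp: not_less)
  have S0: "0 \<le> ?g v w" if "v \<in> S" "w \<in> S" for v w
    using S(3)[OF that] ip_self_nonneg[of "{..<r}" "u v"] by (cases "v = w") auto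
  have nz: "?g v w \<noteq> 0" if "v \<in> V" "w \<in> V" for v w
    using u that \<alpha> unfolding equiangular_family_def by (metis abs_zero less_irrefl zero_neq_one)
  have finS: "finite S" using S(1) V finite_subset by blast
  define P where "P v = {w \<in> S. ?g v w < 0}" for v
  define F where "F = {v \<in> V - S. N\<^sup>2 \<le> card (P v)}"
  have indep: "(v, w) \<notin> ?G F'" if "v \<in> S" "w \<in> S" "F' \<inter> S = {}" for v w F'
    using S0[OF that(1,2)] that by (auto simp: obtuse_arcs_def ip_flip)
  have F_S: "w \<notin> F" if "w \<in> S" for w using that by (simp add: F_def)
  have few: "card (?G F `` {v} \<inter> S) \<le> N\<^sup>2" for v
  proof -
    consider "v \<notin> V" | "v \<in> S" | "v \<in> V - S - F" | "v \<in> F" by (auto simp: F_def)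
    then show ?thesis
    proof cases
      case 1
      then have "?G F `` {v} = {}" by (auto simp: obtuse_arcs_def)
      then show ?thesis by simp
    next
      case 2
      then have "?G F `` {v} \<inter> S = {}" using indep[of v _ F] by (auto simp: F_def)
      then show ?thesis by simp
    next
      case 3
      then have "v \<in> V" "v \<notin> F" by auto
      then have "?G F `` {v} \<inter> S = P v" using S(1) F_S by (auto simp: obtuse_arcs_def ip_flip P_def)
      moreover have "card (P v) < N\<^sup>2" using 3 unfolding F_def not_le[symmetric] by blast
      ultimately show ?thesis by simp
    next
      case 4
      then have v: "v \<in> V" "v \<notin> S" "N\<^sup>2 \<le> card (P v)" by (simp_all add: F_def)
      have pos: "0 < ?g v w \<longleftrightarrow> \<not> ?g v w < 0" if "w \<in> S" for w
        using nz[OF v(1), of w] S(1) that by auto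
      have nbrs0: "?G {} `` {v} \<inter> S = P v" "S - ?G {} `` {v} = S - P v"
        using v(1,2) S(1) by (auto simp: obtuse_arcs_def ip_flip P_def)
      have nbrs1: "?G {v} `` {v} \<inter> S = S - P v" "S - ?G {v} `` {v} = P v"
        using v(1,2) S(1) pos by (auto simp: obtuse_arcs_def ip_flip P_def)
      have nbrsF: "?G F `` {v} \<inter> S = S - P v"
        using v(1,2) 4 S(1) F_S pos by (auto simp: obtuse_arcs_def ip_flip P_def)
      have "card (S - P v) = card S - card (P v)" "card (P v) \<le> card S"
        using finS by (auto simp: P_def card_Diff_subset card_mono)
      then have "8 * N ^ 4 \<le> card (S - P v) \<or> 8 * N ^ 4 \<le> card (P v)" using S(2) by linarith
      then show ?thesis
      proof
        assume "8 * N ^ 4 \<le> card (S - P v)"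
        then have "card (P v) < N\<^sup>2"
          using psd_graph.neighbours_in_independent_set[OF psd S(1), of "{}" N v] indep[of _ _ "{}"] N(1) \<mu>N v nbrs0
          by simp
        then show ?thesis using v by simp
      next
        assume "8 * N ^ 4 \<le> card (P v)"
        then have "card (S - P v) < N\<^sup>2"
          using psd_graph.neighbours_in_independent_set[OF psd S(1), of "{v}" N v] indep[of _ _ "{v}"] N(1) \<mu>N v nbrs1
          by simp
        then show ?thesis using nbrsF by simp
      qed
    qed
  qed
  have "card (?G F `` {v}) \<le> 2 * N\<^sup>2" for v
  proof (rule psd_graph.degree_le[OF psd S(1) _ N(1) \<mu>N S(2) _ few])
    show "(v, w) \<notin> ?G F" if "v \<in> S" "w \<in> S" for v w
      using indep[OF that, of F] F_S by blast
    show "(v, v) \<notin> ?G F" for v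
      using ip_self_nonneg[of "{..<r}" "u v"] by (auto simp: obtuse_arcs_def ip_flip)
  qed
  then show ?thesis by blast
qed

section \<open>Largest eigenvalues and the spectral radius order\<close>

context sym_graph
begin

lemma bounded_on_mono: "bounded_on \<mu> Q \<Longrightarrow> \<mu> \<le> \<nu> \<Longrightarrow> bounded_on \<nu> Q"
  unfolding bounded_on_def using mult_right_mono[OF _ ip_self_nonneg] by (meson order_trans)

text \<open>
  The form attains its maximum on the unit sphere, which is compact in the product topology, and a
  maximizer is an eigenvector.
\<close>
lemma maximal_eigenvector_exists:
  assumes "V \<noteq> {}"
  shows "\<exists>z \<mu>. (\<forall>v. v \<notin> V \<longrightarrow> z v = 0) \<and> (\<exists>v\<in>V. z v \<noteq> 0) \<and> (\<forall>v. adj E z v = \<mu> * z v) \<and> bounded_on \<mu> V"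
proof -
  define S where "S v = (if v \<in> V then {-1..1::real} else {0})" for v
  have "compactin (product_topology (\<lambda>_. euclidean) UNIV) (PiE UNIV S)"
    by (subst compactin_PiE) (auto simp: S_def)
  then have comp: "compact (PiE UNIV S)"
    unfolding euclidean_product_topology compactin_euclidean_iff .
  have "continuous_on UNIV (\<lambda>x. ip V x x)"
    unfolding ip_def by (intro continuous_intros continuous_on_product_coordinates)
  then have "closed {x. ip V x x = 1}"
    using closed_Collect_eq[of "\<lambda>x. ip V x x" "\<lambda>_. 1"] by simp
  with comp have comp': "compact (PiE UNIV S \<inter> {x. ip V x x = 1})" by (rule compact_Int_closed)
  obtain p where p: "p \<in> V" using assms by blast
  have "point p \<in> PiE UNIV S \<inter> {x. ip V x x = 1}"
    using p finite_V by (auto simp: ip_point S_def) (auto simp: point_def)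
  then have ne: "PiE UNIV S \<inter> {x. ip V x x = 1} \<noteq> {}" by blast
  have cont: "continuous_on (PiE UNIV S \<inter> {x. ip V x x = 1}) (\<lambda>x. ip V x (adj E x))"
    unfolding ip_def adj_def
    by (intro continuous_intros continuous_on_subset[OF continuous_on_product_coordinates]) auto
  obtain z where z: "z \<in> PiE UNIV S" "ip V z z = 1"
    and max: "\<And>x. x \<in> PiE UNIV S \<Longrightarrow> ip V x x = 1 \<Longrightarrow> ip V x (adj E x) \<le> ip V z (adj E z)"
    using continuous_attains_sup[OF comp' ne cont] by auto
  define \<mu> where "\<mu> = ip V z (adj E z)"
  have z0: "z v = 0" if "v \<notin> V" for v using z(1) that by (auto simp: S_def PiE_iff split: if_splits)
  have bdd: "bounded_on \<mu> V"
    unfolding bounded_on_def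
  proof (intro allI impI)
    fix x :: "'a \<Rightarrow> real" assume x: "\<forall>v. v \<notin> V \<longrightarrow> x v = 0"
    show "ip V x (adj E x) \<le> \<mu> * ip V x x"
    proof (cases "ip V x x = 0")
      case True
      then have "ip V x (adj E x) = 0" using ip_self_eq_0[OF finite_V] by (simp add: ip_def)
      then show ?thesis using True by simp
    next
      case False
      then have pos: "0 < ip V x x" using ip_self_nonneg[of V x] by simp
      define c where "c = 1 / sqrt (ip V x x)"
      have c2: "c * c = 1 / ip V x x" using pos by (simp add: c_def)
      define y where "y v = c * x v" for v
      have yy: "ip V y y = 1" using pos by (simp add: y_def[abs_def] ip_scale mult.assoc[symmetric] c2)
      have "y v \<in> S v" for v
      proof (cases "v \<in> V")
        case True
        have "y v * y v \<le> ip V y y" unfolding ip_def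
          using True finite_V by (intro member_le_sum) auto
        then have "\<bar>y v\<bar> \<le> 1" using yy by (simp add: abs_square_le_1[symmetric] power2_eq_square)
        then show ?thesis using True by (auto simp: S_def)
      qed (use x in \<open>simp add: S_def y_def\<close>)
      then have "ip V y (adj E y) \<le> \<mu>" unfolding \<mu>_def by (intro max yy) auto
      moreover have "ip V y (adj E y) = ip V x (adj E x) / ip V x x"
        by (simp add: y_def[abs_def] adj_scale ip_scale mult.assoc[symmetric] c2)
      ultimately show ?thesis using pos by (simp add: field_simps)
    qed
  qed
  have "adj E z v = \<mu> * z v" for v
    by (rule eigenvector_if_form_maximal[OF bdd z0]) (simp_all add: z(2) \<mu>_def)
  moreover have "\<exists>v\<in>V. z v \<noteq> 0"
  proof (rule ccontr)
    assume "\<not> ?thesis"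
    then have "ip V z z = 0" by (simp add: ip_def)
    then show False using z(2) by simp
  qed
  ultimately show ?thesis using z0 bdd by blast
qed

end

lemma sym_graph_parcs:
  fixes G :: "nat pair_pre_digraph"
  assumes "pair_graph G" "pverts G = {..<n}"
  shows "sym_graph {..<n} (parcs G)" "\<And>v. (v, v) \<notin> parcs G"
proof -
  interpret pair_graph G by fact
  show "sym_graph {..<n} (parcs G)"
  proof unfold_locales
    show "parcs G \<subseteq> {..<n} \<times> {..<n}" using in_arcsD1 in_arcsD2 assms(2) by fastforce
    show "sym (parcs G)" using arcs_symmetric by (auto simp: sym_def)
  qed simp
  show "(v, v) \<notin> parcs G" for v using no_loops[of "(v, v)"] by auto
qed

lemma eigenvalue_adjacency_matrix:
  fixes G :: "nat pair_pre_digraph"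
  assumes G: "pair_graph G" "pverts G = {..<n}"
  shows "eigenvalue (adjacency_matrix G) \<nu> \<longleftrightarrow>
    (\<exists>x. (\<forall>v. v \<notin> {..<n} \<longrightarrow> x v = 0) \<and> (\<exists>v\<in>{..<n}. x v \<noteq> 0) \<and> (\<forall>v. adj (parcs G) x v = \<nu> * x v))"
    (is "_ \<longleftrightarrow> ?R")
proof -
  interpret sym_graph "{..<n}" "parcs G" by (rule sym_graph_parcs[OF G])
  let ?M = "adjacency_matrix G"
  have M: "?M = mat n n (\<lambda>(i, j). if (i, j) \<in> parcs G then 1 else 0)"
    by (simp add: adjacency_matrix_def G(2))
  have mult: "(?M *\<^sub>v v) $ i = adj (parcs G) (\<lambda>j. if j < n then v $ j else 0) i"
    if "v \<in> carrier_vec n" "i < n" for v i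
    using that unfolding M
    by (auto simp: scalar_prod_def adj_alt atLeast0LessThan intro!: sum.cong)
  show ?thesis
  proof
    assume "eigenvalue ?M \<nu>"
    then obtain v where v: "v \<in> carrier_vec n" "v \<noteq> 0\<^sub>v n" "?M *\<^sub>v v = \<nu> \<cdot>\<^sub>v v"
      unfolding eigenvalue_def eigenvector_def by (auto simp: M)
    define x where "x j = (if j < n then v $ j else 0)" for j
    have "adj (parcs G) x i = \<nu> * x i" for i
      using mult[OF v(1), of i] v(1,3) by (cases "i < n") (simp_all add: x_def[abs_def])
    moreover have "\<exists>i<n. x i \<noteq> 0"
      using v(1,2) unfolding x_def by (metis carrier_vecD eq_vecI index_zero_vec(1) index_zero_vec(2))
    ultimately show ?R by (intro exI[of _ x]) (auto simp: x_def)
  next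
    assume ?R
    then obtain x where x: "\<forall>v. v \<notin> {..<n} \<longrightarrow> x v = 0" "\<exists>v\<in>{..<n}. x v \<noteq> 0"
      "\<forall>v. adj (parcs G) x v = \<nu> * x v" by blast
    have ext: "(\<lambda>j. if j < n then vec n x $ j else 0) = x" using x(1) by auto
    have "?M *\<^sub>v vec n x = \<nu> \<cdot>\<^sub>v vec n x"
      by (rule eq_vecI) (use mult[of "vec n x"] ext x(3) in \<open>simp_all add: M\<close>)
    moreover obtain i where "i < n" "x i \<noteq> 0" using x(2) by blast
    then have "vec n x \<noteq> 0\<^sub>v n" by (metis index_vec index_zero_vec(1))
    ultimately show "eigenvalue ?M \<nu>" unfolding eigenvalue_def eigenvector_def
      by (intro exI[of _ "vec n x"]) (simp add: M)
  qed
qed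

text \<open>
  This translates the statement about all eigenvalues of a matrix into the one-sided bound on the
  quadratic form that is used everywhere else.
\<close>
lemma is_largest_eigenvalue_iff:
  fixes G :: "nat pair_pre_digraph"
  assumes G: "pair_graph G" "pverts G = {..<n}"
  shows "is_largest_eigenvalue (adjacency_matrix G) \<mu> \<longleftrightarrow>
    (\<exists>x. (\<forall>v. v \<notin> {..<n} \<longrightarrow> x v = 0) \<and> (\<exists>v\<in>{..<n}. x v \<noteq> 0) \<and> (\<forall>v. adj (parcs G) x v = \<mu> * x v)) \<and>
    sym_graph.bounded_on {..<n} (parcs G) \<mu> {..<n}"
proof -
  interpret sym_graph "{..<n}" "parcs G" by (rule sym_graph_parcs[OF G])
  note ev = eigenvalue_adjacency_matrix[OF G]
  have "bounded_on \<mu> {..<n}" if "is_largest_eigenvalue (adjacency_matrix G) \<mu>"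
  proof -
    have "{..<n} \<noteq> {}" using that unfolding is_largest_eigenvalue_def ev by blast
    then obtain z \<nu> where "eigenvalue (adjacency_matrix G) \<nu>" "bounded_on \<nu> {..<n}"
      using maximal_eigenvector_exists unfolding ev by blast
    then show ?thesis using that bounded_on_mono unfolding is_largest_eigenvalue_def by blast
  qed
  moreover have "\<nu> \<le> \<mu>" if bdd: "bounded_on \<mu> {..<n}" and \<nu>: "eigenvalue (adjacency_matrix G) \<nu>" for \<nu>
  proof -
    obtain x where x: "\<forall>v. v \<notin> {..<n} \<longrightarrow> x v = 0" "\<exists>v\<in>{..<n}. x v \<noteq> 0"
      "\<forall>v. adj (parcs G) x v = \<nu> * x v" using \<nu> unfolding ev by blast
    have "\<nu> * ip {..<n} x x = ip {..<n} x (adj (parcs G) x)"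
      using x(3) by (simp add: ip_def sum_distrib_left mult_ac)
    also have "\<dots> \<le> \<mu> * ip {..<n} x x" using bdd x(1) unfolding bounded_on_def by blast
    finally have "\<nu> * ip {..<n} x x \<le> \<mu> * ip {..<n} x x" .
    moreover have "ip {..<n} x x \<noteq> 0" using x(2) unfolding ip_self_eq_0[OF finite_V] by blast
    then have "0 < ip {..<n} x x" using ip_self_nonneg[of "{..<n}" x] by simp
    ultimately show ?thesis by (simp add: mult_le_cancel_right)
  qed
  ultimately show ?thesis unfolding is_largest_eigenvalue_def ev by blast
qed

lemma spectral_radius_order_witness:
  assumes "spectral_radius_order \<mu> = enat k"
  shows "\<exists>G :: nat pair_pre_digraph. pair_graph G \<and> pverts G = {..<k} \<and> is_largest_eigenvalue (adjacency_matrix G) \<mu>"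
proof -
  define A where "A = {enat (card (pverts G)) | G :: nat pair_pre_digraph.
            pair_graph G \<and> pverts G = {..<card (pverts G)} \<and> is_largest_eigenvalue (adjacency_matrix G) \<mu>}"
  have Inf: "Inf A = enat k" using assms by (simp only: spectral_radius_order_def A_def)
  then have "A \<noteq> {}" by (auto simp: Inf_enat_def)
  then obtain a where "a \<in> A" by blast
  then have "(LEAST x. x \<in> A) \<in> A" by (rule LeastI)
  then have "enat k \<in> A" using Inf \<open>A \<noteq> {}\<close> by (simp add: Inf_enat_def)
  then obtain G :: "nat pair_pre_digraph" where "k = card (pverts G)" "pair_graph G"
    "pverts G = {..<card (pverts G)}" "is_largest_eigenvalue (adjacency_matrix G) \<mu>"
    unfolding A_def by blast
  then show ?thesis by metis
qed

text \<open>
  The set \<open>C\<close> is a union of components that carries an eigenvector for \<open>\<mu>\<close>. Numbering its vertices by \<open>h\<close>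
  produces a competitor in the definition of the order.
\<close>
lemma spectral_radius_order_le:
  assumes G: "sym_graph V E" and irrefl: "\<And>v. (v, v) \<notin> E" and bdd: "sym_graph.bounded_on V E \<mu> V"
    and C: "C \<subseteq> V" "E `` C \<subseteq> C"
    and y: "\<And>v. v \<notin> C \<Longrightarrow> y v = 0" "\<And>v. adj E y v = \<mu> * y v" "p \<in> C" "y p \<noteq> 0"
  shows "spectral_radius_order \<mu> \<le> enat (card C)"
proof -
  interpret sym_graph V E by fact
  define n where "n = card C"
  have finC: "finite C" using C(1) finite_V finite_subset by blast
  obtain h where h: "bij_betw h {..<n} C"
    using ex_bij_betw_nat_finite[OF finC] by (auto simp: n_def atLeast0LessThan)
  define E' where "E' = {(i, j). i < n \<and> j < n \<and> (h i, h j) \<in> E}"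
  define H :: "nat pair_pre_digraph" where "H = \<lparr>pverts = {..<n}, parcs = E'\<rparr>"
  have H: "pair_graph H"
  proof
    show "symmetric (with_proj H)"
      using sym_E by (auto simp: symmetric_def sym_def H_def E'_def arcs_ends_def arc_to_ends_def)
    have "E' \<subseteq> {..<n} \<times> {..<n}" by (auto simp: E'_def)
    then show "finite (parcs H)" unfolding H_def by (simp add: finite_subset)
  qed (use irrefl in \<open>auto simp: H_def E'_def\<close>)
  have vH: "pverts H = {..<n}" "parcs H = E'" by (simp_all add: H_def)
  interpret H: sym_graph "{..<n}" E' using sym_graph_parcs(1)[OF H vH(1)] by (simp add: vH)
  have hC: "h i \<in> C" if "i < n" for i using h that by (auto simp: bij_betw_def)
  have adj_h: "adj E x (h i) = adj E' (\<lambda>j. if j < n then x (h j) else 0) i"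
    if "\<And>v. v \<notin> C \<Longrightarrow> x v = 0" "i < n" for x i
  proof -
    have "adj E x (h i) = (\<Sum>w\<in>C. if (h i, w) \<in> E then x w else 0)"
      unfolding adj_alt using C(1) finite_V that(1) by (intro sum.mono_neutral_right) auto
    also have "\<dots> = (\<Sum>j<n. if (h i, h j) \<in> E then x (h j) else 0)"
      by (rule sum.reindex_bij_betw[OF h, symmetric])
    also have "\<dots> = adj E' (\<lambda>j. if j < n then x (h j) else 0) i"
      unfolding H.adj_alt using that(2) by (intro sum.cong) (auto simp: E'_def)
    finally show ?thesis .
  qed
  have ip_h: "ip V x z = ip {..<n} (\<lambda>j. if j < n then x (h j) else 0) (\<lambda>j. if j < n then z (h j) else 0)"
    if "\<And>v. v \<notin> C \<Longrightarrow> x v = 0" for x z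
  proof -
    have "ip V x z = (\<Sum>w\<in>C. x w * z w)"
      unfolding ip_def using C(1) finite_V that by (intro sum.mono_neutral_right) auto
    also have "\<dots> = (\<Sum>j<n. x (h j) * z (h j))" by (rule sum.reindex_bij_betw[OF h, symmetric])
    finally show ?thesis by (simp add: ip_def)
  qed
  have "is_largest_eigenvalue (adjacency_matrix H) \<mu>"
    unfolding is_largest_eigenvalue_iff[OF H vH(1)] vH(2)
  proof
    define z where "z j = (if j < n then y (h j) else 0)" for j
    have "adj E' z i = \<mu> * z i" for i
      using adj_h[of y i] y(1,2) H.adj_outside[of i z] by (cases "i < n") (auto simp: z_def[abs_def])
    moreover obtain j where "j < n" "h j = p" using h y(3) unfolding bij_betw_def by blast
    ultimately show "\<exists>x. (\<forall>v. v \<notin> {..<n} \<longrightarrow> x v = 0) \<and> (\<exists>v\<in>{..<n}. x v \<noteq> 0) \<and> (\<forall>v. adj E' x v = \<mu> * x v)"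
      using y(4) by (intro exI[of _ z]) (auto simp: z_def)
    show "H.bounded_on \<mu> {..<n}"
      unfolding H.bounded_on_def
    proof (intro allI impI)
      fix x :: "nat \<Rightarrow> real" assume x: "\<forall>v. v \<notin> {..<n} \<longrightarrow> x v = 0"
      define g where "g = inv_into {..<n} h"
      define X where "X w = (if w \<in> C then x (g w) else 0)" for w
      have gh: "g (h j) = j" if "j < n" for j
        unfolding g_def using h that by (auto simp: bij_betw_def inv_into_f_f)
      have Xx: "(\<lambda>j. if j < n then X (h j) else 0) = x" using x hC gh by (auto simp: X_def)
      have X0: "X v = 0" if "v \<notin> C" for v using that by (simp add: X_def)
      have ip_X: "ip V X z = ip {..<n} x (\<lambda>j. if j < n then z (h j) else 0)" for z
        using ip_h[of X z] X0 by (simp add: Xx)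
      have adj_X: "adj E X (h i) = adj E' x i" if "i < n" for i
        using adj_h[of X i] X0 that by (simp add: Xx)
      have "ip V X (adj E X) = ip {..<n} x (\<lambda>j. if j < n then adj E X (h j) else 0)"
        unfolding ip_X Xx by simp
      also have "\<dots> = ip {..<n} x (adj E' x)"
        using adj_X by (simp add: ip_def)
      finally have "ip {..<n} x (adj E' x) = ip V X (adj E X)" ..
      also have "\<dots> \<le> \<mu> * ip V X X"
        using bdd X0 C(1) unfolding bounded_on_def by blast
      also have "ip V X X = ip {..<n} x x" unfolding ip_X Xx by simp
      finally show "ip {..<n} x (adj E' x) \<le> \<mu> * ip {..<n} x x" .
    qed
  qed
  then have "enat n = enat (card (pverts H)) \<and> pair_graph H \<and> pverts H = {..<card (pverts H)} \<and>
      is_largest_eigenvalue (adjacency_matrix H) \<mu>" using H vH(1) by simp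
  then have "enat n \<in> {enat (card (pverts G)) | G :: nat pair_pre_digraph.
            pair_graph G \<and> pverts G = {..<card (pverts G)} \<and> is_largest_eigenvalue (adjacency_matrix G) \<mu>}"
    by blast
  then show ?thesis unfolding spectral_radius_order_def n_def by (rule Inf_lower)
qed

section \<open>Lines and families of unit vectors\<close>

lemma scalar_prod_vec_ip: "vec r f \<bullet> vec r g = ip {..<r} f g"
  by (simp add: scalar_prod_def ip_def atLeast0LessThan)

lemma equiangular_family_of_lines:
  assumes L: "equiangular_lines r \<alpha> L"
  shows "\<exists>u. equiangular_family L r \<alpha> u"
proof -
  have "\<forall>l\<in>L. \<exists>u. u \<in> l \<and> u \<in> carrier_vec r \<and> unit_vector u"
  proof
    fix l assume "l \<in> L"
    then have "line_through_origin r l" using L by (simp add: equiangular_lines_def)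
    from unit_vector_on_line[OF this] show "\<exists>u. u \<in> l \<and> u \<in> carrier_vec r \<and> unit_vector u" by blast
  qed
  then obtain u where u: "\<And>l. l \<in> L \<Longrightarrow> u l \<in> l \<and> u l \<in> carrier_vec r \<and> unit_vector (u l)" by metis
  have ip: "ip {..<r} (\<lambda>c. u l $ c) (\<lambda>c. u m $ c) = u l \<bullet> u m" if "l \<in> L" "m \<in> L" for l m
  proof -
    have "dim_vec (u m) = r" using u[OF that(2)] by auto
    then show ?thesis by (simp add: ip_def scalar_prod_def atLeast0LessThan)
  qed
  have "equiangular_family L r \<alpha> (\<lambda>l c. u l $ c)"
    unfolding equiangular_family_def
  proof (intro ballI)
    fix l m assume lm: "l \<in> L" "m \<in> L"
    show "\<bar>ip {..<r} (\<lambda>c. u l $ c) (\<lambda>c. u m $ c)\<bar> = (if l = m then 1 else \<alpha>)"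
      unfolding ip[OF lm] using L u lm unfolding equiangular_lines_def unit_vector_def
      by (cases "l = m") auto
  qed
  then show ?thesis by blast
qed

lemma lines_of_equiangular_family:
  assumes V: "finite V" and u: "equiangular_family V r \<alpha> u" and \<alpha>: "\<alpha> < 1"
  shows "\<exists>L. finite L \<and> equiangular_lines r \<alpha> L \<and> card L = card V"
proof -
  define line where "line v = {c \<cdot>\<^sub>v vec r (u v) | c. True}" for v
  have ent: "\<bar>vec r (u v) \<bullet> vec r (u w)\<bar> = (if v = w then 1 else \<alpha>)" if "v \<in> V" "w \<in> V" for v w
    using u that unfolding scalar_prod_vec_ip equiangular_family_def by blast
  have unit: "vec r (u v) \<bullet> vec r (u v) = 1" if "v \<in> V" for v
    using ent[OF that that] ip_self_nonneg[of "{..<r}" "u v"] by (simp add: scalar_prod_vec_ip)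
  have angle: "\<bar>x \<bullet> y\<bar> = (if v = w then 1 else \<alpha>)"
    if "v \<in> V" "w \<in> V" "x \<in> line v" "y \<in> line w" "unit_vector x" "unit_vector y" for v w x y
  proof -
    obtain c d where cd: "x = c \<cdot>\<^sub>v vec r (u v)" "y = d \<cdot>\<^sub>v vec r (u w)"
      using \<open>x \<in> line v\<close> \<open>y \<in> line w\<close> unfolding line_def by blast
    have "c * c = 1" "d * d = 1"
      using \<open>unit_vector x\<close> \<open>unit_vector y\<close> unit[OF \<open>v \<in> V\<close>] unit[OF \<open>w \<in> V\<close>]
      by (simp_all add: cd unit_vector_def)
    then have "\<bar>c\<bar> = 1" "\<bar>d\<bar> = 1" by (auto simp: square_eq_1_iff)
    then show ?thesis using ent[OF \<open>v \<in> V\<close> \<open>w \<in> V\<close>] by (simp add: cd abs_mult)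
  qed
  have self: "vec r (u v) \<in> line v" for v
    unfolding line_def by (auto intro!: exI[of _ 1])
  have "inj_on line V"
  proof (rule inj_onI)
    fix v w assume vw: "v \<in> V" "w \<in> V" "line v = line w"
    then have "vec r (u v) \<in> line w" using self[of v] by simp
    then have "\<bar>vec r (u v) \<bullet> vec r (u v)\<bar> = (if v = w then 1 else \<alpha>)"
      using angle[OF vw(1,2) self, of "vec r (u v)"] unit[OF vw(1)] by (simp add: unit_vector_def)
    then show "v = w" using unit[OF vw(1)] \<alpha> by (auto split: if_splits)
  qed
  moreover have "equiangular_lines r \<alpha> (line ` V)"
    unfolding equiangular_lines_def
  proof (intro conjI ballI impI)
    fix l assume "l \<in> line ` V"
    then obtain v where v: "v \<in> V" "l = line v" by blast
    have "vec r (u v) \<noteq> 0\<^sub>v r"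
    proof
      assume "vec r (u v) = 0\<^sub>v r"
      then have "vec r (u v) \<bullet> vec r (u v) = 0" by simp
      then show False using unit[OF v(1)] by simp
    qed
    then show "line_through_origin r l"
      unfolding line_through_origin_def v(2) line_def by (intro bexI[of _ "vec r (u v)"]) auto
  next
    fix l m x y assume lm: "l \<in> line ` V" "m \<in> line ` V" "l \<noteq> m"
      and xy: "x \<in> l" "y \<in> m" "unit_vector x" "unit_vector y"
    from lm obtain v w where vw: "v \<in> V" "w \<in> V" "l = line v" "m = line w" by blast
    then have "v \<noteq> w" using lm(3) by blast
    then show "\<bar>x \<bullet> y\<bar> = \<alpha>" using angle[OF vw(1,2), of x y] xy vw(3,4) by simp
  qed
  ultimately show ?thesis using V by (intro exI[of _ "line ` V"]) (simp add: card_image)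
qed

lemma equiangular_family_reindex_coordinates:
  assumes X: "finite X" "card X = r"
    and U: "\<And>v w. v \<in> V \<Longrightarrow> w \<in> V \<Longrightarrow> \<bar>ip X (U v) (U w)\<bar> = (if v = w then 1 else \<alpha>)"
  shows "\<exists>u. equiangular_family V r \<alpha> u"
proof -
  obtain h where h: "bij_betw h {..<r} X"
    using ex_bij_betw_nat_finite[OF X(1)] X(2) by (auto simp: atLeast0LessThan)
  have "ip {..<r} (\<lambda>c. U v (h c)) (\<lambda>c. U w (h c)) = ip X (U v) (U w)" for v w
    unfolding ip_def by (rule sum.reindex_bij_betw[OF h])
  then show ?thesis using U unfolding equiangular_family_def
    by (intro exI[of _ "\<lambda>v c. U v (h c)"]) simp
qed

section \<open>Gram representations\<close>

lemma positive_semidefinite_zero_diagonal: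
  fixes Q :: "'a \<Rightarrow> 'a \<Rightarrow> real"
  assumes "finite V" and psd: "\<And>x. 0 \<le> (\<Sum>i\<in>V. \<Sum>j\<in>V. x i * Q i j * x j)"
    and "p \<in> V" "i \<in> V" "Q p p = 0" "Q p i = Q i p"
  shows "Q i p = 0"
proof (cases "i = p")
  case False
  have "0 \<le> Q i i + 2 * t * Q i p" for t
  proof -
    define x where "x j = (if j = i then 1 else if j = p then t else 0)" for j
    have collapse: "(\<Sum>j\<in>V. x j * g j) = g i + t * g p" for g
    proof -
      have "(\<Sum>j\<in>V. x j * g j) = (\<Sum>j\<in>{i, p}. x j * g j)"
        using assms by (intro sum.mono_neutral_right) (auto simp: x_def)
      then show ?thesis using False by (simp add: x_def)
    qed
    have "(\<Sum>i\<in>V. \<Sum>j\<in>V. x i * Q i j * x j) = (\<Sum>i\<in>V. x i * (\<Sum>j\<in>V. x j * Q i j))"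
      by (simp add: sum_distrib_left mult_ac)
    also have "\<dots> = Q i i + 2 * t * Q i p"
      unfolding collapse using assms by (simp add: algebra_simps)
    finally show ?thesis using psd[of x] by simp
  qed
  note ineq = this
  show ?thesis
  proof (rule ccontr)
    assume nz: "Q i p \<noteq> 0"
    then show False using ineq[of "- (Q i i + 1) / (2 * Q i p)"] by (simp add: field_simps)
  qed
qed (use assms in simp)

text \<open>
  Cholesky decomposition: split off the vertex \<open>p\<close> and represent the Schur complement \<open>Q'\<close>. If the
  diagonal entry at \<open>p\<close> is zero, so is its column, and the convention \<open>x / 0 = 0\<close> makes the same formulas
  work.
\<close>
lemma gram_representation:
  fixes Q :: "'a \<Rightarrow> 'a \<Rightarrow> real"
  assumes "finite V" and "\<And>i j. Q i j = Q j i" and "\<And>x. 0 \<le> (\<Sum>i\<in>V. \<Sum>j\<in>V. x i * Q i j * x j)"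
  shows "\<exists>w. \<forall>i\<in>V. \<forall>j\<in>V. ip V (w i) (w j) = Q i j"
  using assms
proof (induction V arbitrary: Q rule: finite_induct)
  case (insert p V)
  have expand: "(\<Sum>i\<in>insert p V. \<Sum>j\<in>insert p V. x i * Q i j * x j)
      = x p * Q p p * x p + 2 * x p * (\<Sum>i\<in>V. Q i p * x i) + (\<Sum>i\<in>V. \<Sum>j\<in>V. x i * Q i j * x j)" for x
  proof -
    have "(\<Sum>j\<in>V. x p * Q p j * x j) = x p * (\<Sum>i\<in>V. Q i p * x i)"
      unfolding sum_distrib_left by (intro sum.cong refl, subst insert.prems(1)) simp
    moreover have "(\<Sum>i\<in>V. x i * Q i p * x p) = x p * (\<Sum>i\<in>V. Q i p * x i)"
      unfolding sum_distrib_left by (intro sum.cong) simp_all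
    ultimately show ?thesis using insert.hyps by (simp add: sum.distrib)
  qed
  have Qpp: "0 \<le> Q p p" using insert.prems(2)[of "point p"] expand[of "point p"] insert.hyps
    by (simp add: point_def sum.neutral)
  have zero: "Q i p = 0" if "i \<in> V" "Q p p = 0" for i
    by (rule positive_semidefinite_zero_diagonal[of "insert p V" Q p i, OF _ insert.prems(2) _ _ that(2) insert.prems(1)])
       (use insert.hyps that(1) in simp_all)
  define Q' where "Q' i j = Q i j - Q i p * Q j p / Q p p" for i j
  have "\<exists>w. \<forall>i\<in>V. \<forall>j\<in>V. ip V (w i) (w j) = Q' i j"
  proof (rule insert.IH)
    fix x :: "'a \<Rightarrow> real"
    define s where "s = (\<Sum>i\<in>V. Q i p * x i)"
    define y where "y = x(p := - s / Q p p)"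
    have yV: "y i = x i" if "i \<in> V" for i using that insert.hyps by (auto simp: y_def)
    have "0 \<le> y p * Q p p * y p + 2 * y p * (\<Sum>i\<in>V. Q i p * y i) + (\<Sum>i\<in>V. \<Sum>j\<in>V. y i * Q i j * y j)"
      using insert.prems(2)[of y] unfolding expand .
    also have "\<dots> = - s * s / Q p p + (\<Sum>i\<in>V. \<Sum>j\<in>V. x i * Q i j * x j)"
      using yV by (simp add: s_def[symmetric] cong: sum.cong) (simp add: y_def)
    also have "\<dots> = (\<Sum>i\<in>V. \<Sum>j\<in>V. x i * Q' i j * x j)"
    proof -
      have "(\<Sum>i\<in>V. \<Sum>j\<in>V. x i * Q' i j * x j)
          = (\<Sum>i\<in>V. \<Sum>j\<in>V. x i * Q i j * x j - (Q i p * x i) * (Q j p * x j) / Q p p)"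
        by (simp add: Q'_def algebra_simps)
      also have "\<dots> = (\<Sum>i\<in>V. \<Sum>j\<in>V. x i * Q i j * x j) - s * s / Q p p"
        unfolding sum_subtractf s_def sum_product sum_divide_distrib ..
      finally show ?thesis by simp
    qed
    finally show "0 \<le> (\<Sum>i\<in>V. \<Sum>j\<in>V. x i * Q' i j * x j)" .
  qed (simp add: Q'_def insert.prems(1) mult.commute)
  then obtain w' where w': "\<And>i j. i \<in> V \<Longrightarrow> j \<in> V \<Longrightarrow> ip V (w' i) (w' j) = Q' i j" by blast
  define w where "w i c = (if c = p then Q i p / sqrt (Q p p) else if i = p then 0 else w' i c)" for i c
  have ip_w: "ip (insert p V) (w i) (w j) = Q i p * Q j p / Q p p + (if i = p \<or> j = p then 0 else ip V (w' i) (w' j))" for i j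
  proof -
    have "ip V (w i) (w j) = (if i = p \<or> j = p then 0 else ip V (w' i) (w' j))"
      unfolding ip_def w_def using insert.hyps by (auto intro!: sum.cong sum.neutral)
    then show ?thesis using insert.hyps Qpp by (simp add: ip_def) (simp add: w_def)
  qed
  have "ip (insert p V) (w i) (w j) = Q i j" if "i \<in> insert p V" "j \<in> insert p V" for i j
  proof -
    consider "i = p" | "j = p" "i \<noteq> p" | "i \<in> V" "j \<in> V" "i \<noteq> p" "j \<noteq> p" using \<open>i \<in> insert p V\<close> \<open>j \<in> insert p V\<close> insert.hyps by auto
    then show ?thesis
    proof cases
      case 1
      then show ?thesis unfolding ip_w using zero[of j] \<open>j \<in> insert p V\<close> insert.prems(1)[of p j] by auto
    next
      case 2
      then show ?thesis unfolding ip_w using zero[of i] \<open>i \<in> insert p V\<close> by auto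
    next
      case 3
      then show ?thesis unfolding ip_w using w'[of i j] by (simp add: Q'_def)
    qed
  qed
  then show ?case by blast
qed simp

text \<open>
  Singularity saves one dimension: represent all indices but \<open>p\<close>, and let the relation \<open>y\<close> among the
  rows express the vector for \<open>p\<close> in terms of the others.
\<close>
lemma singular_gram_representation:
  fixes Q :: "'a \<Rightarrow> 'a \<Rightarrow> real"
  assumes V: "finite V" and sym: "\<And>i j. Q i j = Q j i"
    and psd: "\<And>x. (\<And>v. v \<notin> V \<Longrightarrow> x v = 0) \<Longrightarrow> 0 \<le> (\<Sum>i\<in>V. \<Sum>j\<in>V. x i * Q i j * x j)"
    and y: "p \<in> V" "y p \<noteq> 0" "\<And>i. i \<in> V \<Longrightarrow> (\<Sum>j\<in>V. Q i j * y j) = 0"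
  shows "\<exists>w. \<forall>i\<in>V. \<forall>j\<in>V. ip (V - {p}) (w i) (w j) = Q i j"
proof -
  let ?W = "V - {p}"
  have "0 \<le> (\<Sum>i\<in>?W. \<Sum>j\<in>?W. x i * Q i j * x j)" for x
  proof -
    let ?x = "cut ?W x"
    have "(\<Sum>i\<in>V. \<Sum>j\<in>V. ?x i * Q i j * ?x j) = (\<Sum>i\<in>?W. \<Sum>j\<in>?W. x i * Q i j * x j)"
      using V by (intro sum.mono_neutral_cong_right ballI) (auto simp: cut_def intro!: sum.mono_neutral_cong_right)
    then show ?thesis using psd[of ?x] by (simp add: cut_def)
  qed
  then obtain w' where w': "\<And>i j. i \<in> ?W \<Longrightarrow> j \<in> ?W \<Longrightarrow> ip ?W (w' i) (w' j) = Q i j"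
    using gram_representation[of ?W Q] V sym by blast
  define wp where "wp c = (\<Sum>i\<in>?W. (- y i / y p) * w' i c)" for c
  define w where "w i = (if i = p then wp else w' i)" for i
  have row: "(\<Sum>i\<in>?W. (- y i / y p) * Q i j) = Q p j" if "j \<in> V" for j
  proof -
    have "0 = (\<Sum>i\<in>V. Q j i * y i)" using y(3)[OF that] by simp
    also have "\<dots> = Q j p * y p + (\<Sum>i\<in>?W. Q j i * y i)" using V y(1) by (rule sum.remove)
    finally have "Q p j = - (\<Sum>i\<in>?W. Q j i * y i) / y p" using y(2) sym[of j p] by (simp add: field_simps)
    also have "\<dots> = (\<Sum>i\<in>?W. (- y i / y p) * Q i j)"
      unfolding sum_negf[symmetric] sum_divide_distrib using sym by (intro sum.cong) auto
    finally show ?thesis by simp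
  qed
  have wp1: "ip ?W wp (w' j) = Q p j" if "j \<in> ?W" for j
  proof -
    have "ip ?W wp (w' j) = (\<Sum>i\<in>?W. (- y i / y p) * ip ?W (w' i) (w' j))"
      unfolding wp_def[abs_def] ip_sum ip_scale ..
    then show ?thesis using w' that row by simp
  qed
  have "ip ?W wp wp = (\<Sum>i\<in>?W. (- y i / y p) * ip ?W (w' i) wp)"
    by (subst (1) wp_def[abs_def]) (simp only: ip_sum ip_scale)
  also have "\<dots> = (\<Sum>i\<in>?W. (- y i / y p) * Q i p)"
  proof (intro sum.cong refl arg_cong2[where f = "(*)"])
    fix i assume "i \<in> ?W"
    then show "ip ?W (w' i) wp = Q i p"
      using wp1[of i] ip_commute[of ?W wp "w' i"] sym[of p i] by simp
  qed
  finally have wp2: "ip ?W wp wp = Q p p" using row[OF y(1)] by simp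
  have wp3: "ip ?W (w' i) wp = Q i p" if "i \<in> ?W" for i
    using wp1[OF that] ip_commute[of ?W wp "w' i"] sym[of p i] by simp
  have "ip ?W (w i) (w j) = Q i j" if "i \<in> V" "j \<in> V" for i j
    using that w' wp1 wp2 wp3 by (cases "i = p"; cases "j = p") (simp_all add: w_def)
  then show ?thesis by blast
qed

section \<open>The three estimates for equiangular families\<close>

text \<open>
  Disjoint copies of \<open>G\<close>, each spanning \<open>k - 1\<close> dimensions, followed by isolated vertices that use up the
  remaining dimensions; one dimension is reserved for the common coordinate that contributes \<open>J / 2\<close>.
\<close>
lemma equiangular_family_construction:
  fixes G :: "nat pair_pre_digraph"
  assumes \<alpha>: "0 < \<alpha>" "\<alpha> < 1" and \<mu>: "\<mu> = (1 - \<alpha>) / (2 * \<alpha>)" and k: "2 \<le> k" and r: "1 \<le> r"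
    and G: "pair_graph G" "pverts G = {..<k}" "is_largest_eigenvalue (adjacency_matrix G) \<mu>"
  shows "\<exists>(W :: (nat \<times> nat) set) u. finite W \<and> card W = (r - 1) div (k - 1) + (r - 1) \<and> equiangular_family W r \<alpha> u"
proof -
  define E where "E = parcs G"
  define V where "V = {..<k}"
  interpret sym_graph V E unfolding V_def E_def by (rule sym_graph_parcs(1)[OF G(1,2)])
  have irrefl: "(v, v) \<notin> E" for v unfolding E_def by (rule sym_graph_parcs(2)[OF G(1,2)])
  have \<mu>0: "0 < \<mu>" using \<alpha> by (simp add: \<mu>)
  obtain y where y: "\<exists>v\<in>V. y v \<noteq> 0" "\<And>v. adj E y v = \<mu> * y v" and bdd: "bounded_on \<mu> V"
    using G(3) unfolding is_largest_eigenvalue_iff[OF G(1,2)] V_def E_def by blast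
  then obtain p where p: "p \<in> V" "y p \<noteq> 0" by blast
  define Q where "Q i j = (if i = j then \<mu> else 0) - (if (i, j) \<in> E then 1 else 0)" for i j
  have row: "(\<Sum>j\<in>V. Q i j * x j) = \<mu> * x i - adj E x i" if "i \<in> V" for i x
  proof -
    have "(\<Sum>j\<in>V. Q i j * x j) = (\<Sum>j\<in>V. (if i = j then \<mu> * x j else 0) - (if (i, j) \<in> E then x j else 0))"
      by (intro sum.cong) (auto simp: Q_def algebra_simps)
    then show ?thesis using finite_V that by (simp add: sum_subtractf adj_alt)
  qed
  have "\<exists>w. \<forall>i\<in>V. \<forall>j\<in>V. ip (V - {p}) (w i) (w j) = Q i j"
  proof (rule singular_gram_representation[where y = y and p = p, OF finite_V _ _ p])
    show "Q i j = Q j i" for i j using sym_E by (auto simp: Q_def dest: symD)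
    show "0 \<le> (\<Sum>i\<in>V. \<Sum>j\<in>V. x i * Q i j * x j)" if "\<And>v. v \<notin> V \<Longrightarrow> x v = 0" for x
    proof -
      have "(\<Sum>i\<in>V. \<Sum>j\<in>V. x i * Q i j * x j) = (\<Sum>i\<in>V. x i * (\<mu> * x i - adj E x i))"
        using row by (simp add: sum_distrib_left mult.assoc flip: sum_distrib_left)
      also have "\<dots> = \<mu> * ip V x x - ip V x (adj E x)"
        by (simp add: ip_def algebra_simps sum_subtractf sum_distrib_left)
      finally show ?thesis using bdd that unfolding bounded_on_def by auto
    qed
    show "(\<Sum>j\<in>V. Q i j * y j) = 0" if "i \<in> V" for i using row[OF that] y(2) by simp
  qed
  then obtain w where w: "\<And>i j. i \<in> V \<Longrightarrow> j \<in> V \<Longrightarrow> ip (V - {p}) (w i) (w j) = Q i j" by blast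
  define m where "m = (r - 1) div (k - 1)"
  define l where "l = (r - 1) mod (k - 1)"
  have ml: "m * (k - 1) + l = r - 1" unfolding m_def l_def by (rule div_mult_mod_eq)
  \<comment> \<open>Block \<open>a < m\<close> is a copy of the graph, block \<open>m\<close> collects isolated vertices, and the
    coordinate \<open>(Suc m, 0)\<close> is shared by all vectors.\<close>
  define W where "W = {..<m} \<times> V \<union> {m} \<times> {..<l}"
  define Y where "Y = {..<m} \<times> (V - {p})"
  define Z where "Z = {m} \<times> {..<l}"
  define X where "X = insert (Suc m, 0) (Y \<union> Z)"
  have finX: "finite Y" "finite Z" "finite W" using finite_V by (simp_all add: Y_def Z_def W_def)
  have disj: "Y \<inter> Z = {}" "(Suc m, 0) \<notin> Y \<union> Z" by (auto simp: Y_def Z_def)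
  have cV: "card V = k" by (simp add: V_def)
  have "card Y = m * (k - 1)" using p finite_V by (simp add: Y_def card_cartesian_product cV)
  then have cX: "card X = r"
    using disj finX ml r by (simp add: X_def card_Un_disjoint) (simp add: Z_def card_cartesian_product)
  have cW: "card W = m + (r - 1)"
  proof -
    have "card W = m * k + l"
      unfolding W_def using finite_V
      by (subst card_Un_disjoint) (auto simp: card_cartesian_product cV)
    also have "\<dots> = m + (m * (k - 1) + l)" using k by (cases k) simp_all
    finally show ?thesis unfolding ml .
  qed
  define U where "U v c = (if fst c = Suc m then 1 / sqrt 2 else if fst c \<noteq> fst v then 0
      else if fst v < m then w (snd v) (snd c) else if snd v = snd c then sqrt \<mu> else 0)"
    for v c :: "nat \<times> nat"
  have gram: "ip X (U (a, i)) (U (a', i')) = 1 / 2 + (if a \<noteq> a' then 0 else if a < m then Q i i' else if i = i' then \<mu> else 0)"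
    if "(a, i) \<in> W" "(a', i') \<in> W" for a i a' i'
  proof -
    have Y_sum: "ip Y (U (a, i)) (U (a', i')) = (if a = a' \<and> a < m then Q i i' else 0)"
    proof -
      have "ip Y (U (a, i)) (U (a', i'))
          = (\<Sum>b<m. \<Sum>c\<in>V - {p}. if b = a then (if a = a' then w i c * w i' c else 0) else 0)"
        unfolding ip_def Y_def sum.cartesian_product by (intro sum.cong) (auto simp: U_def)
      also have "\<dots> = (\<Sum>b<m. if b = a then (if a = a' then ip (V - {p}) (w i) (w i') else 0) else 0)"
        by (intro sum.cong) (auto simp: ip_def)
      also have "\<dots> = (if a = a' \<and> a < m then Q i i' else 0)"
        using that w by (auto simp: W_def)
      finally show ?thesis .
    qed
    have Z_sum: "ip Z (U (a, i)) (U (a', i')) = (if a = a' \<and> a = m \<and> i = i' then \<mu> else 0)"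
    proof -
      have "ip Z (U (a, i)) (U (a', i')) = (\<Sum>b\<in>{m}. \<Sum>c<l. U (a, i) (b, c) * U (a', i') (b, c))"
        unfolding ip_def Z_def sum.cartesian_product by (intro sum.cong) auto
      also have "\<dots> = (\<Sum>c<l. if c = i then (if a = a' \<and> a = m \<and> i = i' then \<mu> else 0) else 0)"
      proof -
        have "U (a, i) (m, c) * U (a', i') (m, c)
            = (if c = i then (if a = a' \<and> a = m \<and> i = i' then \<mu> else 0) else 0)" for c
          using \<mu>0 by (auto simp: U_def)
        then show ?thesis by simp
      qed
      also have "\<dots> = (if a = a' \<and> a = m \<and> i = i' then \<mu> else 0)"
        using that by (auto simp: W_def)
      finally show ?thesis .
    qed
    have "ip X (U (a, i)) (U (a', i')) = 1 / 2 + (ip Y (U (a, i)) (U (a', i')) + ip Z (U (a, i)) (U (a', i')))"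
      unfolding ip_def X_def using disj finX by (simp add: sum.union_disjoint) (simp add: U_def)
    then show ?thesis using that unfolding Y_sum Z_sum by (auto simp: W_def)
  qed
  have "\<exists>u. equiangular_family W r \<alpha> u"
  proof (rule equiangular_family_reindex_coordinates[OF _ cX])
    show "finite X" using finX by (simp add: X_def)
    fix v v' assume v: "v \<in> W" "v' \<in> W"
    obtain a i a' i' where vs: "v = (a, i)" "v' = (a', i')" by (cases v, cases v')
    have s: "sqrt (2 * \<alpha>) * sqrt (2 * \<alpha>) = 2 * \<alpha>" using \<alpha> by simp
    have "ip X (\<lambda>c. sqrt (2 * \<alpha>) * U v c) (\<lambda>c. sqrt (2 * \<alpha>) * U v' c) = 2 * \<alpha> * ip X (U v) (U v')"
      unfolding ip_scale mult.assoc[symmetric] s ..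
    also have "\<dots> = \<alpha> + (if a \<noteq> a' then 0 else if a < m then 2 * \<alpha> * Q i i' else if i = i' then 1 - \<alpha> else 0)"
      using gram[of a i a' i'] v \<alpha> by (simp add: vs \<mu> field_simps)
    finally show "\<bar>ip X (\<lambda>c. sqrt (2 * \<alpha>) * U v c) (\<lambda>c. sqrt (2 * \<alpha>) * U v' c)\<bar> = (if v = v' then 1 else \<alpha>)"
      using \<alpha> irrefl by (auto simp: vs Q_def \<mu>)
  qed
  then show ?thesis using cW finX(3) unfolding m_def by blast
qed

text \<open>
  A positive eigenvalue requires an edge, and the sum of its two end points, as a test vector, gives the
  value \<open>1\<close>.
\<close>
lemma order_of_positive_largest_eigenvalue:
  fixes G :: "nat pair_pre_digraph"
  assumes G: "pair_graph G" "pverts G = {..<k}" "is_largest_eigenvalue (adjacency_matrix G) \<mu>" and \<mu>: "0 < \<mu>"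
  shows "2 \<le> k" "1 \<le> \<mu>"
proof -
  interpret sym_graph "{..<k}" "parcs G" by (rule sym_graph_parcs(1)[OF G(1,2)])
  have irrefl: "(v, v) \<notin> parcs G" for v by (rule sym_graph_parcs(2)[OF G(1,2)])
  obtain y where y: "\<exists>v\<in>{..<k}. y v \<noteq> 0" "\<And>v. adj (parcs G) y v = \<mu> * y v" and bdd: "bounded_on \<mu> {..<k}"
    using G(3) unfolding is_largest_eigenvalue_iff[OF G(1,2)] by blast
  obtain p where p: "p < k" "y p \<noteq> 0" using y(1) by blast
  have "parcs G `` {p} \<noteq> {}"
  proof
    assume "parcs G `` {p} = {}"
    then have "adj (parcs G) y p = 0" by (simp add: adj_def)
    then show False using y(2) p \<mu> by simp
  qed
  then obtain q where q: "(p, q) \<in> parcs G" by blast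
  then have q': "q < k" "q \<noteq> p" "(q, p) \<in> parcs G" using E_sub irrefl sym_E by (auto dest: symD)
  then show "2 \<le> k" using p(1) by linarith
  define x where "x v = point p v + point q v" for v
  have "ip {..<k} x (adj (parcs G) x) = 2"
    using q q' p(1) irrefl by (simp add: x_def[abs_def] ip_add adj_add ip_point adj_point)
  moreover have "ip {..<k} x x = 2"
    using q' p(1) by (simp add: x_def[abs_def] ip_add ip_point) (simp add: point_def)
  moreover have "ip {..<k} x (adj (parcs G) x) \<le> \<mu> * ip {..<k} x x"
    using bdd q' p(1) unfolding bounded_on_def by (simp add: x_def point_def)
  ultimately show "1 \<le> \<mu>" by simp
qed

lemma card_le_dimension_if_no_arcs:
  assumes V: "finite V" and u: "equiangular_family V r \<alpha> u" and \<alpha>: "0 < \<alpha>" "\<alpha> < 1"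
    and no_arcs: "obtuse_arcs V r u = {}"
  shows "card V \<le> r"
proof (rule ccontr)
  assume "\<not> card V \<le> r"
  interpret low_rank_graph V "obtuse_arcs V r u" "(1 - \<alpha>) / (2 * \<alpha>)" r "\<lambda>c w. u w c"
    by (rule low_rank_graph_obtuse_arcs[OF V u \<alpha>])
  obtain x where x: "\<exists>v\<in>V. x v \<noteq> 0" "\<forall>c\<in>{..<r}. ip V (\<lambda>w. u w c) x = 0"
    using homogeneous_system_nontrivial_solution[of "{..<r}" V "\<lambda>c w. u w c"] V \<open>\<not> card V \<le> r\<close> by auto
  define S where "S = (\<Sum>w\<in>V. x w)"
  have eq: "(1 - \<alpha>) / (2 * \<alpha>) * x v + S / 2 = 0" if "v \<in> V" for v
    using kernel[of x v] x(2) that by (simp add: S_def no_arcs adj_def)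
  have "0 = (\<Sum>v\<in>V. (1 - \<alpha>) / (2 * \<alpha>) * x v + S / 2)" using eq by simp
  also have "\<dots> = ((1 - \<alpha>) / (2 * \<alpha>) + real (card V) / 2) * S"
    unfolding sum.distrib sum_distrib_left[symmetric] S_def[symmetric] by (simp add: algebra_simps)
  finally have "S = 0"
    using add_pos_nonneg[OF \<mu>_pos, of "real (card V) / 2"] by auto
  then show False using x(1) eq \<alpha> by auto
qed

text \<open>
  Normalize all inner products with one vector \<open>o'\<close> to be positive. If two others had inner product
  \<open>- \<alpha>\<close>, the sum of them minus \<open>2 * \<alpha>\<close> times \<open>o'\<close>, which is their projection away from \<open>o'\<close>, would have negative
  squared norm. So the Gram matrix is \<open>(1 - \<alpha>) I + \<alpha> J\<close>, which is nonsingular.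
\<close>
lemma card_le_dimension_if_angle_large:
  assumes V: "finite V" and u: "equiangular_family V r \<alpha> u" and \<alpha>: "1 / 2 < \<alpha>" "\<alpha> < 1"
  shows "card V \<le> r"
proof (cases "V = {}")
  case False
  then obtain o' where o: "o' \<in> V" by blast
  define F where "F = {v \<in> V. ip {..<r} (u o') (u v) < 0}"
  define f where "f = flip F u"
  have fam: "equiangular_family V r \<alpha> f" unfolding f_def by (rule equiangular_family_flip[OF u])
  have \<alpha>0: "0 < \<alpha>" using \<alpha> by simp
  note gram = gram_entry[OF fam \<alpha>0]
  have oF: "o' \<notin> F" using ip_self_nonneg[of "{..<r}" "u o'"] by (simp add: F_def)
  have "0 \<le> ip {..<r} (f o') (f v)" if "v \<in> V" for v
    unfolding f_def ip_flip using that oF by (auto simp: F_def)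
  then have no: "(o', v) \<notin> obtuse_arcs V r f" "(v, o') \<notin> obtuse_arcs V r f" for v
    using ip_commute[of "{..<r}" "f v" "f o'"] by (auto simp: obtuse_arcs_def not_less)
  have irrefl: "(v, v) \<notin> obtuse_arcs V r f" for v
    using ip_self_nonneg[of "{..<r}" "f v"] by (simp add: obtuse_arcs_def)
  have "obtuse_arcs V r f = {}"
  proof (rule ccontr)
    assume "obtuse_arcs V r f \<noteq> {}"
    then obtain v w where vw: "(v, w) \<in> obtuse_arcs V r f" by auto
    then have vw': "v \<in> V" "w \<in> V" "v \<noteq> w" "v \<noteq> o'" "w \<noteq> o'"
      using irrefl no by (auto simp: obtuse_arcs_def)
    define s where "s c = (f v c + f w c) - 2 * \<alpha> * f o' c" for c
    have "0 \<le> ip {..<r} s s" by (rule ip_self_nonneg)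
    also have "\<dots> = 2 - 2 * \<alpha> - 4 * \<alpha>\<^sup>2"
      using vw vw' o no irrefl symD[OF sym_graph.sym_E[OF sym_graph_obtuse_arcs[OF V]] vw]
      by (simp add: s_def[abs_def] ip_add ip_diff ip_scale gram power2_eq_square algebra_simps)
    also have "\<dots> = 2 * (1 + \<alpha>) * (1 - 2 * \<alpha>)" by (simp add: power2_eq_square algebra_simps)
    also have "\<dots> < 0" using \<alpha> by (intro mult_pos_neg) auto
    finally show False by simp
  qed
  then show ?thesis using card_le_dimension_if_no_arcs[OF V fam \<alpha>0 \<alpha>(2)] by blast
qed simp

lemma equiangular_family_card_cases:
  assumes V: "finite V" and u: "equiangular_family V r \<alpha> u" and \<alpha>: "0 < \<alpha>" "\<alpha> < 1"
    and \<mu>: "\<mu> = (1 - \<alpha>) / (2 * \<alpha>)" and b: "\<mu> \<le> b" "1 \<le> b"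
    and N: "2 \<le> N" "1 / \<alpha> \<le> real N" and large: "(17 * N ^ 4) ^ (N + 2) \<le> card V" "r < card V"
  shows "(\<exists>k. spectral_radius_order \<mu> = enat k \<and> k * (card V - r + 1) \<le> card V) \<or>
    (\<forall>R>0. \<forall>q>0. real (card V) \<le> real (r + 1) + (real (card V) / real R + 1)
      + real (2 * N\<^sup>2 + 1) ^ (2 * (R * q) + 1) + real (card V) * (1 - 1 / b ^ (2 * R)) ^ q)"
proof -
  obtain F where F: "\<And>v. card (obtuse_arcs V r (flip F u) `` {v}) \<le> 2 * N\<^sup>2"
    using bounded_degree_switching[OF V u \<alpha> N large(1)] by blast
  define f where "f = flip F u"
  have fam: "equiangular_family V r \<alpha> f" unfolding f_def by (rule equiangular_family_flip[OF u])
  interpret low_rank_graph V "obtuse_arcs V r f" \<mu> r "\<lambda>c w. f w c"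
    unfolding \<mu> by (rule low_rank_graph_obtuse_arcs[OF V fam \<alpha>])
  have irrefl: "(v, v) \<notin> obtuse_arcs V r f" for v
    using ip_self_nonneg[of "{..<r}" "f v"] by (simp add: obtuse_arcs_def)
  show ?thesis
  proof (cases "bounded_on \<mu> V")
    case True
    have order_le: "spectral_radius_order \<mu> \<le> enat (card ((obtuse_arcs V r f)\<^sup>* `` {p}))"
      if "p \<in> V" "\<And>v. v \<notin> (obtuse_arcs V r f)\<^sup>* `` {p} \<Longrightarrow> y v = 0"
        "\<And>v. adj (obtuse_arcs V r f) y v = \<mu> * y v" "y p \<noteq> 0" for p y
      using component_subset[OF that(1)] component_closed that
      by (intro spectral_radius_order_le[OF sym_graph_axioms irrefl True, of _ y p]) auto
    show ?thesis
    proof (cases "spectral_radius_order \<mu>")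
      case (enat k)
      have "k * (card V - r + 1) \<le> card V"
      proof (rule card_bound_if_bounded[OF True _ large(2)])
        fix p y assume "p \<in> V" "\<And>v. v \<notin> (obtuse_arcs V r f)\<^sup>* `` {p} \<Longrightarrow> y v = 0"
          "\<And>v. adj (obtuse_arcs V r f) y v = \<mu> * y v" "y p \<noteq> (0::real)"
        from order_le[OF this] show "k \<le> card ((obtuse_arcs V r f)\<^sup>* `` {p})" by (simp add: enat)
      qed
      then show ?thesis using enat by blast
    next
      case infinity
      have "(card V + 1) * (card V - r + 1) \<le> card V"
      proof (rule card_bound_if_bounded[OF True _ large(2)])
        fix p y assume "p \<in> V" "\<And>v. v \<notin> (obtuse_arcs V r f)\<^sup>* `` {p} \<Longrightarrow> y v = 0"
          "\<And>v. adj (obtuse_arcs V r f) y v = \<mu> * y v" "y p \<noteq> (0::real)"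
        from order_le[OF this] show "card V + 1 \<le> card ((obtuse_arcs V r f)\<^sup>* `` {p})" by (simp add: infinity)
      qed
      then have False by simp
      then show ?thesis ..
    qed
  next
    case False
    then show ?thesis using card_bound_if_unbounded[OF False b F[folded f_def]] by blast
  qed
qed

section \<open>Choice of the parameters\<close>

lemma large_exponential_constant:
  obtains L0 :: real where "1 \<le> L0" "\<And>L. L0 \<le> L \<Longrightarrow> 8 * L ^ 2 \<le> exp (3 * L / 4)"
    "\<And>L. L0 \<le> L \<Longrightarrow> 8 * L \<le> exp L"
proof -
  have "eventually (\<lambda>L::real. 8 * L ^ 2 \<le> exp (3 * L / 4)) at_top"
    "eventually (\<lambda>L::real. 8 * L \<le> exp L) at_top" by real_asymp+
  then have "eventually (\<lambda>L::real. 8 * L ^ 2 \<le> exp (3 * L / 4) \<and> 8 * L \<le> exp L) at_top"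
    by (rule eventually_conj)
  then obtain L0 :: real where "\<And>L. L0 \<le> L \<Longrightarrow> 8 * L ^ 2 \<le> exp (3 * L / 4) \<and> 8 * L \<le> exp L"
    unfolding eventually_at_top_linorder by blast
  then show ?thesis using that[of "max 1 L0"] by simp
qed

lemma ln_2_ge_half: "1 / 2 \<le> ln (2::real)"
  using ln_le_minus_one[of "1 / 2 :: real"] by (simp add: ln_div)

lemma nat_floor_bounds:
  fixes y :: real
  assumes "2 \<le> y"
  shows "real (nat \<lfloor>y\<rfloor>) \<le> y" "y / 2 \<le> real (nat \<lfloor>y\<rfloor>)" "0 < nat \<lfloor>y\<rfloor>"
  using assms by linarith+

text \<open>
  What \<open>card_bound_if_unbounded\<close> gives: \<open>D\<close> stands for one more than the maximal degree.
\<close>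
definition net_walk_bound :: "nat \<Rightarrow> nat \<Rightarrow> real \<Rightarrow> real \<Rightarrow> bool" where
  "net_walk_bound n r b D \<longleftrightarrow> (\<forall>R>0. \<forall>q>0. real n \<le> real (r + 1) + (real n / real R + 1)
    + D ^ (2 * (R * q) + 1) + real n * (1 - 1 / b ^ (2 * R)) ^ q)"

text \<open>
  Write \<open>l = ln n\<close> and \<open>L = ln l\<close>. The choice of \<open>R\<close> makes \<open>b ^ (2 * R)\<close> at most the fourth root of \<open>l\<close>,
  and the choice of \<open>q\<close> makes the exceptional ball at most the square root of \<open>n\<close>. The last term is then
  smaller than \<open>n / L\<close>, so the net, of size about \<open>n / R\<close>, dominates.
\<close>
lemma optimized_card_bound:
  obtains K :: real where "16 \<le> K"
    "\<And>b n r D. 2 \<le> b \<Longrightarrow> 1 < ln (real n) \<Longrightarrow> K * ln b \<le> ln (ln (real n)) \<Longrightarrow> 1 \<le> D \<Longrightarrow> D \<le> b ^ 5 \<Longrightarrow>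
      net_walk_bound n r b D \<Longrightarrow>
      real n \<le> real r + 24 * ln b * real n / ln (ln (real n))"
proof -
  obtain L0 :: real where L0: "1 \<le> L0" "\<And>L. L0 \<le> L \<Longrightarrow> 8 * L ^ 2 \<le> exp (3 * L / 4)"
    "\<And>L. L0 \<le> L \<Longrightarrow> 8 * L \<le> exp L" using large_exponential_constant by blast
  define K where "K = 16 + 4 * L0"
  have main: "real n \<le> real r + 24 * ln b * real n / ln (ln (real n))"
    if b: "2 \<le> b" and n: "1 < ln (real n)" and LK: "K * ln b \<le> ln (ln (real n))" and D: "1 \<le> D" "D \<le> b ^ 5"
      and bound: "net_walk_bound n r b D" for b n r and D :: real
  proof -
    define \<beta> where "\<beta> = ln b"
    define l where "l = ln (real n)"
    define L where "L = ln l"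
    have "ln 2 \<le> ln b" using b by simp
    then have \<beta>: "1 / 2 \<le> \<beta>" using ln_2_ge_half by (simp add: \<beta>_def)
    have "n \<noteq> 0" using n by (cases n) simp_all
    then have nl: "real n = exp l" by (simp add: l_def)
    have lL: "l = exp L" using n by (simp add: l_def L_def)
    have b\<beta>: "b = exp \<beta>" using b by (simp add: \<beta>_def)
    have LK': "16 * \<beta> + L0 * (4 * \<beta>) \<le> L" using LK by (simp add: K_def L_def l_def \<beta>_def algebra_simps)
    have "L0 * 2 \<le> L0 * (4 * \<beta>)" using L0(1) \<beta> by (intro mult_left_mono) auto
    then have L: "16 * \<beta> \<le> L" "L0 \<le> L" "1 \<le> L"
      using LK' L0(1) \<beta> by linarith+
    have L8: "8 * L \<le> l" using L0(3)[OF L(2)] by (simp add: lL)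
    define R where "R = nat \<lfloor>L / (8 * \<beta>)\<rfloor>"
    define q where "q = nat \<lfloor>l / (4 * L)\<rfloor>"
    have R2: "2 \<le> L / (8 * \<beta>)" using L \<beta> by (simp add: field_simps)
    then have R: "real R \<le> L / (8 * \<beta>)" "L / (8 * \<beta>) / 2 \<le> real R" "0 < R"
      unfolding R_def by (rule nat_floor_bounds)+
    have q2: "2 \<le> l / (4 * L)" using L8 L by (simp add: field_simps)
    then have q: "real q \<le> l / (4 * L)" "l / (4 * L) / 2 \<le> real q" "0 < q"
      unfolding q_def by (rule nat_floor_bounds)+
    have R\<beta>: "real R * \<beta> \<le> L / 8" using R(1) \<beta> by (simp add: field_simps)
    have expL: "L \<le> exp L" using exp_ge_add_one_self[of L] by linarith
    have T1: "real n / real R \<le> 16 * \<beta> * (real n / L)"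
    proof -
      have "real n / real R \<le> real n / (L / (8 * \<beta>) / 2)"
        using R L \<beta> by (intro divide_left_mono) auto
      then show ?thesis using L \<beta> by (simp add: field_simps)
    qed
    have T2: "D ^ (2 * (R * q) + 1) \<le> real n / L"
    proof -
      have "D ^ (2 * (R * q) + 1) \<le> (b ^ 5) ^ (2 * (R * q) + 1)" using D by (intro power_mono) auto
      also have "\<dots> = exp (real (5 * (2 * (R * q) + 1)) * \<beta>)"
        by (simp only: power_mult[symmetric] b\<beta> exp_of_nat_mult)
      also have "\<dots> \<le> exp (l / 2)"
      proof -
        have "real R * \<beta> * real q \<le> L / 8 * (l / (4 * L))"
          using R\<beta> q(1) \<beta> L by (intro mult_mono) auto
        also have "\<dots> = l / 32" using L by (simp add: field_simps)
        finally have "real (5 * (2 * (R * q) + 1)) * \<beta> \<le> l / 2"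
          using L L8 by (simp add: algebra_simps)
        then show ?thesis by simp
      qed
      also have "\<dots> \<le> exp l / L"
      proof -
        have "L \<le> exp (l / 2)" using exp_ge_add_one_self[of "l / 2"] L8 L by linarith
        then have "exp (l / 2) * L \<le> exp (l / 2) * exp (l / 2)" by simp
        also have "\<dots> = exp l" by (simp flip: exp_add)
        finally show ?thesis using L by (simp add: field_simps)
      qed
      finally show ?thesis by (simp add: nl)
    qed
    have T3: "real n * (1 - 1 / b ^ (2 * R)) ^ q \<le> real n / L"
    proof -
      define x where "x = 1 / b ^ (2 * R)"
      have "1 \<le> b ^ (2 * R)" using b by simp
      then have x1: "x \<le> 1" using b by (simp add: x_def)
      have "b ^ (2 * R) = exp (real (2 * R) * \<beta>)" by (simp only: b\<beta> exp_of_nat_mult)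
      also have "\<dots> \<le> exp (L / 4)" using R\<beta> by simp
      finally have "1 / exp (L / 4) \<le> x"
        unfolding x_def using b by (intro divide_left_mono) auto
      then have x: "exp (- L / 4) \<le> x" by (simp add: exp_minus field_simps)
      have "L \<le> exp L * exp (- L / 4) / (8 * L)"
      proof -
        have "exp L * exp (- L / 4) = exp (3 * L / 4)" by (simp flip: exp_add)
        then show ?thesis using L0(2)[OF L(2)] L by (simp add: field_simps power2_eq_square)
      qed
      also have "\<dots> = l / (4 * L) / 2 * exp (- L / 4)" by (simp add: lL)
      also have "\<dots> \<le> real q * x" using q x by (intro mult_mono) auto
      finally have qx: "L \<le> real q * x" .
      have "(1 - x) ^ q \<le> exp (- x) ^ q"
        using x1 exp_ge_add_one_self[of "- x"] by (intro power_mono) auto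
      also have "\<dots> = exp (- (real q * x))" by (simp flip: exp_of_nat_mult)
      also have "\<dots> \<le> exp (- L)" using qx by simp
      also have "\<dots> \<le> 1 / L" using expL L by (simp add: exp_minus field_simps)
      finally have "real n * (1 - x) ^ q \<le> real n * (1 / L)" by (intro mult_left_mono) auto
      then show ?thesis by (simp add: x_def)
    qed
    have T4: "1 \<le> real n / L"
    proof -
      have "l \<le> exp l" using exp_ge_add_one_self[of l] by linarith
      then show ?thesis using L L8 by (simp add: nl field_simps)
    qed
    have "real n \<le> real (r + 1) + (real n / real R + 1) + D ^ (2 * (R * q) + 1)
        + real n * (1 - 1 / b ^ (2 * R)) ^ q" using bound R(3) q(3) unfolding net_walk_bound_def by blast
    then have "real n \<le> real r + 16 * \<beta> * (real n / L) + 4 * (real n / L)"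
      using T1 T2 T3 T4 by simp
    also have "\<dots> \<le> real r + 16 * \<beta> * (real n / L) + 8 * \<beta> * (real n / L)"
      using \<beta> T4 by (intro add_left_mono mult_right_mono) auto
    finally show ?thesis by (simp add: \<beta>_def L_def l_def algebra_simps)
  qed
  show ?thesis by (rule that[of K]) (use main L0(1) in \<open>auto simp: K_def\<close>)
qed

lemma max_equiangular_lines_le:
  assumes "0 \<le> \<alpha>" "\<alpha> < 1" "\<And>L. finite L \<Longrightarrow> equiangular_lines r \<alpha> L \<Longrightarrow> P (card L)"
  shows "P (max_equiangular_lines \<alpha> r)"
    and "finite L \<Longrightarrow> equiangular_lines r \<alpha> L \<Longrightarrow> card L \<le> max_equiangular_lines \<alpha> r"
proof -
  define S where "S = {card L | L. finite L \<and> equiangular_lines r \<alpha> L}"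
  have "S \<subseteq> {..r * r}" using card_equiangular_lines_le[OF assms(1,2)] by (auto simp: S_def)
  then have fin: "finite S" using finite_subset by blast
  have "equiangular_lines r \<alpha> {}" by (simp add: equiangular_lines_def)
  then have "S \<noteq> {}" unfolding S_def by blast
  then have "Max S \<in> S" using fin by (rule Max_in[rotated])
  then show "P (max_equiangular_lines \<alpha> r)"
    unfolding max_equiangular_lines_def S_def[symmetric] using assms(3) by (auto simp: S_def)
  show "card L \<le> max_equiangular_lines \<alpha> r" if "finite L" "equiangular_lines r \<alpha> L"
    unfolding max_equiangular_lines_def S_def[symmetric] using fin that by (intro Max_ge) (auto simp: S_def)
qed

lemma ln_ln_lower_bound:
  fixes b c x :: real
  assumes "2 \<le> b" "0 \<le> c" "2 powr (b powr c) \<le> x"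
  shows "1 \<le> c \<Longrightarrow> 1 \<le> ln x" "(c - 1) * ln b \<le> ln (ln x)"
proof -
  have x: "0 < x" using assms(3) powr_gt_zero[of 2 "b powr c"] by linarith
  have "ln (2 powr (b powr c)) \<le> ln x" using assms(3) x by (simp del: ln_powr)
  moreover have "ln (2 powr (b powr c)) = b powr c * ln 2" by (simp add: ln_powr)
  ultimately have lnx: "b powr c * ln 2 \<le> ln x" by linarith
  show "1 \<le> ln x" if "1 \<le> c"
  proof -
    have "b powr 1 \<le> b powr c" using assms(1) that by (intro powr_mono) auto
    then have "2 * (1 / 2) \<le> b powr c * ln 2" using assms(1) ln_2_ge_half by (intro mult_mono) auto
    then show ?thesis using lnx by simp
  qed
  have pos: "0 < b powr c * ln 2" using assms(1) by simp
  have "(c - 1) * ln b \<le> c * ln b + ln (1 / 2)"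
  proof -
    have "ln 2 \<le> ln b" using assms(1) by simp
    then show ?thesis by (simp add: ln_div algebra_simps)
  qed
  also have "\<dots> \<le> c * ln b + ln (ln 2)"
    using ln_2_ge_half by simp
  also have "\<dots> = ln (b powr c * ln 2)" using assms(1) by (simp add: ln_mult ln_powr)
  also have "\<dots> \<le> ln (ln x)" using lnx pos by simp
  finally show "(c - 1) * ln b \<le> ln (ln x)" .
qed

lemma ln_ln_mono: "1 \<le> ln x \<Longrightarrow> 0 < x \<Longrightarrow> x \<le> y \<Longrightarrow> ln (ln x) \<le> ln (ln (y::real))"
  by (smt (verit) ln_le_cancel_iff)

text \<open>
  The independent set needs \<open>17 * N ^ 4\<close> elements with \<open>N\<close> about \<open>1 / \<alpha>\<close>, and the clique to be excluded has
  \<open>N + 2\<close>.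
\<close>
lemma ramsey_threshold:
  assumes b: "2 \<le> b" and N: "real N \<le> b + 1" "0 < N" and n: "2 powr (b powr 9) \<le> real n"
  shows "(17 * N ^ 4) ^ (N + 2) \<le> n"
proof -
  have b1: "b + 1 \<le> 2 * b" using b by simp
  have "real N ^ 4 \<le> (2 * b) ^ 4" using N b1 by (intro power_mono) auto
  then have "real (17 * N ^ 4) \<le> 17 * (2 * b) ^ 4" by simp
  also have "\<dots> = 272 * b ^ 4" by (simp add: power_mult_distrib)
  also have "\<dots> \<le> b ^ 9 * b ^ 4"
  proof -
    have "(2::real) ^ 9 \<le> b ^ 9" using b by (intro power_mono) auto
    then show ?thesis using b by (intro mult_right_mono) auto
  qed
  also have "\<dots> = b powr 13" using b by (simp add: powr_numeral flip: power_add)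
  finally have base: "real (17 * N ^ 4) \<le> b powr 13" .
  have "real ((17 * N ^ 4) ^ (N + 2)) \<le> (b powr 13) ^ (N + 2)"
    unfolding of_nat_power using base by (intro power_mono) auto
  also have "\<dots> = exp (13 * real (N + 2) * ln b)"
  proof -
    have "b powr 13 = exp (13 * ln b)" using b by (simp add: powr_def)
    then have "(b powr 13) ^ (N + 2) = exp (real (N + 2) * (13 * ln b))" by (simp only: exp_of_nat_mult)
    then show ?thesis by (simp only: mult_ac)
  qed
  also have "\<dots> \<le> exp (b powr 9 * ln 2)"
  proof -
    have "13 * real (N + 2) * ln b \<le> 13 * (3 * b) * b"
      using N b by (intro mult_mono) (auto intro: ln_bound)
    also have "\<dots> = 39 * b ^ 2" by (simp add: power2_eq_square)
    also have "\<dots> \<le> b ^ 7 / 2 * b ^ 2"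
    proof -
      have "(2::real) ^ 7 \<le> b ^ 7" using b by (intro power_mono) auto
      then show ?thesis using b by (intro mult_right_mono) auto
    qed
    also have "\<dots> = b ^ 9 * (1 / 2)" by (simp flip: power_add)
    also have "\<dots> \<le> b ^ 9 * ln 2" using b ln_2_ge_half by (intro mult_left_mono) auto
    also have "\<dots> = b powr 9 * ln 2" using b by (simp add: powr_numeral)
    finally show ?thesis by simp
  qed
  also have "\<dots> = 2 powr (b powr 9)" by (simp add: powr_def[of 2])
  also have "\<dots> \<le> real n" by (rule n)
  finally show ?thesis by (simp only: of_nat_le_iff)
qed

text \<open>
  The three ways in which the number \<open>n\<close> of lines can be limited: by the dimension, by the number of
  components with largest eigenvalue \<open>\<mu>\<close>, or by the multiplicity of \<open>\<mu>\<close> as a second eigenvalue.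
\<close>
definition card_alternatives :: "real \<Rightarrow> nat \<Rightarrow> nat \<Rightarrow> bool" where
  "card_alternatives \<alpha> r n \<longleftrightarrow> n \<le> r \<or>
    (\<exists>k. spectral_radius_order ((1 - \<alpha>) / (2 * \<alpha>)) = enat k \<and> k * (n - r + 1) \<le> n) \<or>
    real n \<le> real r + 48 * real r * ln (1 / \<alpha>) / ln (ln (real r))"

text \<open>
  The bound \<open>optimized_card_bound\<close> is in terms of the number \<open>n\<close> of lines. For large \<open>C0\<close> its error
  term is at most \<open>n / 2\<close>, so \<open>n \<le> 2 * r\<close>, and \<open>n\<close> may be replaced by \<open>2 * r\<close> in it.
\<close>
lemma equiangular_lines_card_cases:
  obtains C0 :: real where "50 \<le> C0"
    "\<And>\<alpha> r L. 0 < \<alpha> \<Longrightarrow> \<alpha> \<le> 1 / 2 \<Longrightarrow> 2 powr ((1 / \<alpha>) powr C0) \<le> real r \<Longrightarrow> finite L \<Longrightarrow>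
      equiangular_lines r \<alpha> L \<Longrightarrow>
      card_alternatives \<alpha> r (card L)"
proof -
  obtain K :: real where K: "16 \<le> K"
    "\<And>b n r D. 2 \<le> b \<Longrightarrow> 1 < ln (real n) \<Longrightarrow> K * ln b \<le> ln (ln (real n)) \<Longrightarrow> 1 \<le> D \<Longrightarrow> D \<le> b ^ 5 \<Longrightarrow>
      net_walk_bound n r b D \<Longrightarrow>
      real n \<le> real r + 24 * ln b * real n / ln (ln (real n))"
    using optimized_card_bound by blast
  define C0 where "C0 = K + 50"
  have "card_alternatives \<alpha> r (card L)"
    if \<alpha>: "0 < \<alpha>" "\<alpha> \<le> 1 / 2" and r: "2 powr ((1 / \<alpha>) powr C0) \<le> real r"
      and L: "finite L" "equiangular_lines r \<alpha> L" for \<alpha> r L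
  proof (rule ccontr)
    assume "\<not> ?thesis"
    note contra = this[unfolded card_alternatives_def]
    define b where "b = 1 / \<alpha>"
    define n where "n = card L"
    define N where "N = nat \<lceil>b\<rceil>"
    define \<Lambda> where "\<Lambda> = ln (ln (real r))"
    have b: "2 \<le> b" using \<alpha> by (simp add: b_def field_simps)
    have nr: "r < n" using contra by (simp add: n_def)
    have N: "b \<le> real N" "real N \<le> b + 1" "2 \<le> N" using b unfolding N_def by linarith+
    have \<Lambda>: "(C0 - 1) * ln b \<le> \<Lambda>" "1 \<le> ln (real r)"
      using ln_ln_lower_bound[OF b _ r[folded b_def]] K(1) by (simp_all add: \<Lambda>_def C0_def)
    have lnb: "1 / 2 \<le> ln b" using ln_2_ge_half b ln_le_cancel_iff[of 2 b] by linarith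
    have r0: "0 < real r" using \<Lambda>(2) by (cases "r = 0") auto
    have n1: "1 < ln (real n)" using \<Lambda>(2) nr r0 ln_less_cancel_iff[of "real r" "real n"] by linarith
    have \<Lambda>n: "\<Lambda> \<le> ln (ln (real n))" unfolding \<Lambda>_def using \<Lambda>(2) r0 nr by (intro ln_ln_mono) auto
    have "49 * ln b \<le> (C0 - 1) * ln b" "K * ln b \<le> (C0 - 1) * ln b"
      using K(1) lnb by (auto simp: C0_def intro!: mult_right_mono)
    then have \<Lambda>49: "48 * ln b \<le> \<Lambda>" and \<Lambda>K: "K * ln b \<le> ln (ln (real n))"
      using \<Lambda>(1) \<Lambda>n lnb by linarith+
    have "2 powr (b powr 9) \<le> 2 powr (b powr C0)"
      using b K(1) by (intro powr_mono) (auto simp: C0_def)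
    then have "2 powr (b powr 9) \<le> real n" using r[folded b_def] nr by linarith
    then have big: "(17 * N ^ 4) ^ (N + 2) \<le> n" using N by (intro ramsey_threshold[OF b]) auto
    have D: "1 \<le> real (2 * N\<^sup>2 + 1)" "real (2 * N\<^sup>2 + 1) \<le> b ^ 5"
    proof -
      have "real (2 * N\<^sup>2 + 1) \<le> 2 * (b + b / 2)\<^sup>2 + 1"
        using N b by (simp add: power_mono)
      also have "\<dots> \<le> 8 * b\<^sup>2"
        using b power_mono[of 2 b 2] by (simp add: power2_eq_square algebra_simps)
      also have "\<dots> \<le> b ^ 3 * b\<^sup>2"
        using b power_mono[of 2 b 3] by (intro mult_right_mono) auto
      also have "\<dots> = b ^ 5" by (simp flip: power_add)
      finally show "real (2 * N\<^sup>2 + 1) \<le> b ^ 5" .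
    qed simp
    obtain u where u: "equiangular_family L r \<alpha> u" using equiangular_family_of_lines[OF L(2)] by blast
    have mu: "(1 - \<alpha>) / (2 * \<alpha>) \<le> b" using \<alpha> by (simp add: b_def field_simps)
    have "(\<exists>k. spectral_radius_order ((1 - \<alpha>) / (2 * \<alpha>)) = enat k \<and> k * (card L - r + 1) \<le> card L) \<or>
      (\<forall>R>0. \<forall>q>0. real (card L) \<le> real (r + 1) + (real (card L) / real R + 1)
        + real (2 * N\<^sup>2 + 1) ^ (2 * (R * q) + 1) + real (card L) * (1 - 1 / b ^ (2 * R)) ^ q)"
      using \<alpha> N b big nr
      by (intro equiangular_family_card_cases[OF L(1) u _ _ refl mu]) (auto simp: b_def n_def)
    then have "net_walk_bound n r b (real (2 * N\<^sup>2 + 1))"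
      unfolding n_def net_walk_bound_def using contra by blast
    then have le: "real n \<le> real r + 24 * ln b * real n / ln (ln (real n))"
      using K(2)[OF b n1 \<Lambda>K D] by blast
    have \<Lambda>0: "0 < \<Lambda>" using \<Lambda>49 lnb by linarith
    have "24 * ln b * real n / ln (ln (real n)) \<le> 24 * ln b * real n / \<Lambda>"
      using \<Lambda>n \<Lambda>0 lnb by (intro divide_left_mono) auto
    with le have le2: "real n \<le> real r + 24 * ln b * real n / \<Lambda>" by linarith
    have "24 * ln b / \<Lambda> \<le> 1 / 2" using \<Lambda>49 \<Lambda>0 by (simp add: field_simps)
    then have "24 * ln b / \<Lambda> * real n \<le> 1 / 2 * real n" by (intro mult_right_mono) auto
    with le2 have "real n \<le> 2 * real r" by simp
    then have "24 * ln b / \<Lambda> * real n \<le> 24 * ln b / \<Lambda> * (2 * real r)"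
      using \<Lambda>0 lnb by (intro mult_left_mono) auto
    with le2 have "real n \<le> real r + 48 * real r * ln b / \<Lambda>" by (simp add: mult_ac)
    then show False using contra by (simp add: n_def b_def \<Lambda>_def)
  qed
  then show ?thesis using that[of C0] K(1) by (simp add: C0_def)
qed

text \<open>
  The inequality \<open>k * (n - r + 1) \<le> n\<close> is \<open>(k - 1) * (n - r + 1) \<le> r - 1\<close> in disguise.
\<close>
lemma excess_le_if_components_large:
  fixes k n r :: nat
  assumes k: "2 \<le> k" and le: "k * (n - r + 1) \<le> n" and r: "r \<le> n" "1 \<le> r"
  shows "n - r + 1 \<le> (r - 1) div (k - 1)"
proof -
  define x where "x = n - r + 1"
  obtain k' where k': "k = Suc k'" "0 < k'" using k by (cases k) auto
  have "k * x = k' * x + x" by (simp add: k')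
  then have "k' * x \<le> r - 1" using le r by (simp add: x_def)
  then have "x \<le> (r - 1) div k'" using k'(2) by (simp add: less_eq_div_iff_mult_less_eq mult.commute)
  then show ?thesis by (simp add: x_def k')
qed

lemma floor_order_ratio:
  assumes "2 \<le> k" "1 \<le> r"
  shows "\<lfloor>real k / (real k - 1) * (real r - 1)\<rfloor> = int ((r - 1) div (k - 1) + (r - 1))"
proof -
  have k: "real k - 1 = real (k - 1)" "0 < real (k - 1)" and r: "real r - 1 = real (r - 1)"
    using assms by simp_all
  have "real k / (real k - 1) * (real r - 1) = real (r - 1) / real (k - 1) + of_int (int (r - 1))"
    using k(2) unfolding r by (simp add: k(1)[symmetric] field_simps)
  then have "\<lfloor>real k / (real k - 1) * (real r - 1)\<rfloor> = \<lfloor>real (r - 1) / real (k - 1)\<rfloor> + int (r - 1)"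
    by (simp only: floor_add_int)
  then show ?thesis by (simp add: floor_divide_of_nat_eq)
qed

lemma twice_order_le_dimension:
  assumes b: "2 \<le> b" and k: "2 \<le> k" and C: "1 \<le> C" and r: "2 powr (b powr (C * (real k - 1))) \<le> real r"
  shows "2 * k \<le> r"
proof -
  obtain k' where k': "k = Suc k'" "1 \<le> k'" using k by (cases k) auto
  have "Suc k' \<le> 2 ^ k'" by (rule Suc_leI[OF less_exp])
  then have "real (Suc k') \<le> real (2 ^ k')" by (simp only: of_nat_le_iff)
  then have k_le: "real k \<le> 2 ^ k'" by (simp add: k')
  also have "(2::real) ^ k' = 2 powr (real k')" by (simp add: powr_realpow)
  also have "\<dots> \<le> b powr (real k')" using b by (intro powr_mono2) auto
  also have "\<dots> \<le> b powr (C * (real k - 1))"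
    using b C k' mult_right_mono[of 1 C "real k'"] by (intro powr_mono) auto
  finally have "2 powr (real k) \<le> 2 powr (b powr (C * (real k - 1)))" by (intro powr_mono) auto
  moreover have "2 powr (real k) = (2::real) ^ k" by (simp add: powr_realpow)
  ultimately have "2 ^ k \<le> real r" using r by linarith
  moreover have "real (2 * k) \<le> 2 ^ k"
    using k_le k' by simp
  ultimately have "real (2 * k) \<le> real r" by linarith
  then show ?thesis by simp
qed

theorem theorem1p5:
  shows "\<exists>C::real. C > 0 \<and> (\<forall>(\<alpha>::real) (r::nat). 0 < \<alpha> \<and> \<alpha> < 1 \<and> r \<ge> 1 \<longrightarrow>
    (\<forall>k::nat. spectral_radius_order ((1 - \<alpha>) / (2 * \<alpha>)) = enat k \<longrightarrow>
       real r \<ge> 2 powr (1 / \<alpha> powr (C * (real k - 1))) \<longrightarrow>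
       int (max_equiangular_lines \<alpha> r) = \<lfloor>real k / (real k - 1) * (real r - 1)\<rfloor>) \<and>
    (\<forall>k::nat. spectral_radius_order ((1 - \<alpha>) / (2 * \<alpha>)) = enat k \<longrightarrow>
       2 powr (1 / \<alpha> powr C) \<le> real r \<and> real r < 2 powr (1 / \<alpha> powr (C * (real k - 1))) \<longrightarrow>
       real (max_equiangular_lines \<alpha> r) \<le> real r + C * real r * ln (1 / \<alpha>) / ln (ln (real r))) \<and>
    (spectral_radius_order ((1 - \<alpha>) / (2 * \<alpha>)) = \<infinity> \<longrightarrow>
       real r \<ge> 2 powr (1 / \<alpha> powr C) \<longrightarrow>
       real (max_equiangular_lines \<alpha> r) \<le> real r + C * real r * ln (1 / \<alpha>) / ln (ln (real r))))"
proof -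
  obtain C0 :: real where C0: "50 \<le> C0"
    "\<And>\<alpha> r L. 0 < \<alpha> \<Longrightarrow> \<alpha> \<le> 1 / 2 \<Longrightarrow> 2 powr ((1 / \<alpha>) powr C0) \<le> real r \<Longrightarrow> finite L \<Longrightarrow>
      equiangular_lines r \<alpha> L \<Longrightarrow>
      card_alternatives \<alpha> r (card L)"
    using equiangular_lines_card_cases by blast
  define C where "C = C0 + 100"
  have C: "150 \<le> C" using C0(1) by (simp add: C_def)
  have inv_powr: "1 / \<alpha> powr x = (1 / \<alpha>) powr x" if "0 < \<alpha>" for \<alpha> x :: real
    using that by (simp add: powr_divide)
  \<comment> \<open>A finite order forces \<open>\<mu> \<ge> 1\<close>, that is \<open>\<alpha> \<le> 1 / 3\<close>; so \<open>ln (1 / \<alpha>)\<close> is bounded below.\<close>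
  have order2: "2 \<le> k \<and> \<alpha> \<le> 1 / 2"
    if \<alpha>: "0 < \<alpha>" "\<alpha> < 1" and k: "spectral_radius_order ((1 - \<alpha>) / (2 * \<alpha>)) = enat k" for \<alpha> k
  proof -
    obtain G :: "nat pair_pre_digraph" where G: "pair_graph G" "pverts G = {..<k}"
      "is_largest_eigenvalue (adjacency_matrix G) ((1 - \<alpha>) / (2 * \<alpha>))"
      using spectral_radius_order_witness[OF k] by blast
    have pos: "0 < (1 - \<alpha>) / (2 * \<alpha>)" using \<alpha> by simp
    have "1 \<le> (1 - \<alpha>) / (2 * \<alpha>)" by (rule order_of_positive_largest_eigenvalue(2)[OF G pos])
    then show ?thesis using order_of_positive_largest_eigenvalue(1)[OF G pos] \<alpha> by (simp add: field_simps)
  qed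
  have cases: "card_alternatives \<alpha> r (card L)"
    if \<alpha>: "0 < \<alpha>" "\<alpha> < 1" and r: "2 powr ((1 / \<alpha>) powr C) \<le> real r"
      and L: "finite L" "equiangular_lines r \<alpha> L" for \<alpha> r L
  proof (cases "\<alpha> \<le> 1 / 2")
    case True
    have "2 powr ((1 / \<alpha>) powr C0) \<le> 2 powr ((1 / \<alpha>) powr C)"
      using \<alpha> by (intro powr_mono) (auto simp: C_def)
    then have "2 powr ((1 / \<alpha>) powr C0) \<le> real r" using r by linarith
    then show ?thesis by (rule C0(2)[OF \<alpha>(1) True _ L])
  next
    case False
    obtain u where "equiangular_family L r \<alpha> u" using equiangular_family_of_lines[OF L(2)] by blast
    then show ?thesis using card_le_dimension_if_angle_large[OF L(1)] False \<alpha>(2)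
      by (simp add: card_alternatives_def)
  qed
  have exact: "int (max_equiangular_lines \<alpha> r) = \<lfloor>real k / (real k - 1) * (real r - 1)\<rfloor>"
    if \<alpha>: "0 < \<alpha>" "\<alpha> < 1" and r1: "1 \<le> r" and k: "spectral_radius_order ((1 - \<alpha>) / (2 * \<alpha>)) = enat k"
      and r: "2 powr ((1 / \<alpha>) powr (C * (real k - 1))) \<le> real r" for \<alpha> k r
  proof -
    define b where "b = 1 / \<alpha>"
    have k2: "2 \<le> k" and "\<alpha> \<le> 1 / 2" using order2[OF \<alpha> k] by auto
    then have b: "2 \<le> b" using \<alpha> by (simp add: b_def field_simps)
    note r' = r[folded b_def]
    define M where "M = (r - 1) div (k - 1) + (r - 1)"
    have kr: "2 * k \<le> r" using twice_order_le_dimension[OF b k2 _ r'] C by simp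
    have div1: "1 \<le> (r - 1) div (k - 1)"
      using kr k2 by (simp add: Suc_le_eq div_greater_zero_iff)
    have Ck: "C \<le> C * (real k - 1)" using C k2 mult_left_mono[of 1 "real k - 1" C] by simp
    have "2 powr (b powr C) \<le> 2 powr (b powr (C * (real k - 1)))"
      using b Ck by (intro powr_mono) auto
    then have "2 powr (b powr C) \<le> real r" using r' by linarith
    then have rC: "2 powr ((1 / \<alpha>) powr C) \<le> real r" by (simp only: b_def)
    have upper: "card L \<le> M" if L: "finite L" "equiangular_lines r \<alpha> L" for L
    proof (rule ccontr)
      assume "\<not> card L \<le> M"
      then have big: "M < card L" by simp
      then have rL: "r \<le> card L" "r < card L" using div1 r1 by (simp_all add: M_def)
      define \<Lambda> where "\<Lambda> = ln (ln (real r))"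
      have "card L - r + 1 \<le> (r - 1) div (k - 1)"
      proof -
        consider "k * (card L - r + 1) \<le> card L" | "real (card L) \<le> real r + 48 * real r * ln b / \<Lambda>"
          using cases[OF \<alpha> rC L] rL k by (auto simp: card_alternatives_def b_def \<Lambda>_def)
        then show ?thesis
        proof cases
          case 1
          then show ?thesis using excess_le_if_components_large[OF k2 _ rL(1) r1] by blast
        next
          case 2
          \<comment> \<open>The threshold for \<open>r\<close> makes the error term at most \<open>r / (2 * (k - 1))\<close>.\<close>
          have lnb: "1 / 2 \<le> ln b" using ln_2_ge_half b ln_le_cancel_iff[of 2 b] by linarith
          have "(C * (real k - 1) - 1) * ln b \<le> \<Lambda>"
            unfolding \<Lambda>_def using Ck C by (intro ln_ln_lower_bound(2)[OF b _ r']) auto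
          moreover have "96 * (real k - 1) \<le> C * (real k - 1) - 1"
            using mult_right_mono[of 97 C "real k - 1"] C k2 by simp
          then have "96 * (real k - 1) * ln b \<le> (C * (real k - 1) - 1) * ln b"
            using lnb by (intro mult_right_mono) auto
          ultimately have \<Lambda>: "96 * (real k - 1) * ln b \<le> \<Lambda>" by linarith
          have "0 < 96 * (real k - 1) * ln b" using k2 lnb by simp
          then have \<Lambda>0: "0 < \<Lambda>" using \<Lambda> by linarith
          have "48 * ln b / \<Lambda> * (real k - 1) \<le> 1 / 2" using \<Lambda> \<Lambda>0 by (simp add: field_simps)
          then have "real r * (48 * ln b / \<Lambda> * (real k - 1)) \<le> real r * (1 / 2)" by (intro mult_left_mono) auto
          moreover have "(real (card L) - real r) * (real k - 1) \<le> 48 * real r * ln b / \<Lambda> * (real k - 1)"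
            using 2 k2 by (intro mult_right_mono) auto
          moreover have "48 * real r * ln b / \<Lambda> * (real k - 1) = real r * (48 * ln b / \<Lambda> * (real k - 1))"
            by simp
          ultimately have "(real (card L) - real r) * (real k - 1) \<le> real r / 2" by linarith
          moreover have "real (2 * k) \<le> real r" using kr of_nat_le_iff by blast
          ultimately have "(real (card L) - real r + 1) * (real k - 1) \<le> real r - 1"
            by (simp add: algebra_simps)
          moreover have "real (card L - r + 1) = real (card L) - real r + 1" "real (k - 1) = real k - 1"
            "real (r - 1) = real r - 1" using rL k2 r1 by simp_all
          ultimately have "real ((card L - r + 1) * (k - 1)) \<le> real (r - 1)"
            by (simp only: of_nat_mult)
          then have "(card L - r + 1) * (k - 1) \<le> r - 1" by (simp only: of_nat_le_iff)
          then show ?thesis using k2 by (simp add: less_eq_div_iff_mult_less_eq)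
        qed
      qed
      then show False using big rL r1 by (simp add: M_def)
    qed
    have "max_equiangular_lines \<alpha> r \<le> M"
      using max_equiangular_lines_le(1)[of \<alpha> r "\<lambda>n. n \<le> M"] upper \<alpha> by simp
    moreover have "M \<le> max_equiangular_lines \<alpha> r"
    proof -
      obtain G :: "nat pair_pre_digraph" where G: "pair_graph G" "pverts G = {..<k}"
        "is_largest_eigenvalue (adjacency_matrix G) ((1 - \<alpha>) / (2 * \<alpha>))"
        using spectral_radius_order_witness[OF k] by blast
      obtain W :: "(nat \<times> nat) set" and u where W: "finite W" "card W = M" "equiangular_family W r \<alpha> u"
        using equiangular_family_construction[OF \<alpha> refl k2 r1 G] unfolding M_def by blast
      obtain L where "finite L" "equiangular_lines r \<alpha> L" "card L = M"
        using lines_of_equiangular_family[OF W(1,3) \<alpha>(2)] W(2) by auto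
      then show ?thesis using max_equiangular_lines_le(2)[of \<alpha> r "\<lambda>_. True" L] \<alpha> by simp
    qed
    ultimately show ?thesis using floor_order_ratio[OF k2 r1] by (simp add: M_def)
  qed
  have approx: "real (max_equiangular_lines \<alpha> r) \<le> real r + C * real r * ln (1 / \<alpha>) / ln (ln (real r))"
    if \<alpha>: "0 < \<alpha>" "\<alpha> < 1" and r: "2 powr ((1 / \<alpha>) powr C) \<le> real r"
      and small: "\<And>k. spectral_radius_order ((1 - \<alpha>) / (2 * \<alpha>)) = enat k \<Longrightarrow>
        real r < 2 powr ((1 / \<alpha>) powr (C * (real k - 1)))" for \<alpha> r
  proof (rule max_equiangular_lines_le(1)[where P = "\<lambda>n. real n \<le> real r + C * real r * ln (1 / \<alpha>) / ln (ln (real r))"])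
    fix L assume L: "finite L" "equiangular_lines r \<alpha> L"
    define \<Lambda> where "\<Lambda> = ln (ln (real r))"
    define \<beta> where "\<beta> = ln (1 / \<alpha>)"
    \<comment> \<open>For \<open>\<alpha>\<close> near \<open>1\<close> the hypothesis only says \<open>r > 2\<close>; as \<open>e < 3\<close>, this suffices for \<open>\<Lambda> \<ge> 0\<close>.\<close>
    have "1 \<le> (1 / \<alpha>) powr C" using \<alpha> C by (intro ge_one_powr_ge_zero) auto
    moreover have "(1 / \<alpha>) powr C \<noteq> 1" using \<alpha> C by (simp add: powr_eq_one_iff_gen)
    ultimately have "2 powr 1 < 2 powr ((1 / \<alpha>) powr C)" by (intro powr_less_mono) auto
    then have "3 \<le> r" using r by simp
    then have "(3::real) \<le> real r" by simp
    then have "exp 1 \<le> real r" using exp_le by linarith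
    then have lnr: "1 \<le> ln (real r)" using \<open>3 \<le> r\<close> by (simp add: ln_ge_iff)
    then have \<Lambda>0: "0 \<le> \<Lambda>" by (simp add: \<Lambda>_def)
    have \<beta>0: "0 \<le> \<beta>" using \<alpha> by (simp add: \<beta>_def)
    have nonneg: "0 \<le> C * real r * \<beta> / \<Lambda>" using C \<Lambda>0 \<beta>0 by simp
    consider "card L \<le> r" | k where "r < card L" "spectral_radius_order ((1 - \<alpha>) / (2 * \<alpha>)) = enat k" "k * (card L - r + 1) \<le> card L"
      | "real (card L) \<le> real r + 48 * real r * \<beta> / \<Lambda>"
      using cases[OF \<alpha> r L] unfolding card_alternatives_def \<Lambda>_def \<beta>_def by fastforce
    then have "real (card L) \<le> real r + C * real r * \<beta> / \<Lambda>"
    proof cases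
      case 1
      then show ?thesis using nonneg by linarith
    next
      case 3
      have "48 * real r * \<beta> / \<Lambda> \<le> C * real r * \<beta> / \<Lambda>"
        using C \<Lambda>0 \<beta>0 by (intro divide_right_mono mult_right_mono) auto
      then show ?thesis using 3 by linarith
    next
      case (2 k)
      \<comment> \<open>Below the threshold, \<open>1 / (k - 1)\<close> is itself at most \<open>C * \<beta> / \<Lambda>\<close>.\<close>
      have k2: "2 \<le> k" and "\<alpha> \<le> 1 / 2" using order2[OF \<alpha> 2(2)] by auto
      then have b: "2 \<le> 1 / \<alpha>" using \<alpha> by (simp add: field_simps)
      have "(C - 1) * \<beta> \<le> \<Lambda>"
        unfolding \<Lambda>_def \<beta>_def using C by (intro ln_ln_lower_bound(2)[OF b _ r]) auto
      moreover have "1 / 2 \<le> \<beta>" unfolding \<beta>_def using ln_2_ge_half b ln_le_cancel_iff[of 2 "1 / \<alpha>"] by linarith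
      then have "0 < (C - 1) * \<beta>" using C by simp
      ultimately have \<Lambda>pos: "0 < \<Lambda>" by linarith
      define X where "X = (1 / \<alpha>) powr (C * (real k - 1))"
      have X0: "0 < X" using \<alpha> by (simp add: X_def)
      have "ln (real r) < ln (2 powr X)"
        using small[OF 2(2)] \<open>3 \<le> r\<close> by (simp add: X_def del: ln_powr)
      also have "\<dots> \<le> X" using X0 ln_2_less_1 by (simp add: ln_powr)
      finally have "\<Lambda> \<le> ln X" unfolding \<Lambda>_def using lnr by simp
      also have "\<dots> = C * (real k - 1) * \<beta>" using \<alpha> by (simp add: X_def ln_powr \<beta>_def)
      finally have le: "\<Lambda> \<le> C * (real k - 1) * \<beta>" .
      define x where "x = real (card L) - real r"
      have "real (k * (card L - r + 1)) \<le> real (card L)" using 2(3) by (simp only: of_nat_le_iff)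
      moreover have "real (card L - r + 1) = x + 1" using 2(1) by (simp add: x_def of_nat_diff)
      moreover have "real (card L) = x + real r" by (simp add: x_def)
      ultimately have "real k * (x + 1) \<le> x + real r" by (simp only: of_nat_mult)
      then have kx: "(real k - 1) * x \<le> real r" by (simp add: algebra_simps)
      have "x * \<Lambda> \<le> x * (C * (real k - 1) * \<beta>)" using le 2(1) by (intro mult_left_mono) (auto simp: x_def)
      also have "\<dots> = C * \<beta> * ((real k - 1) * x)" by (simp only: mult_ac)
      also have "\<dots> \<le> C * \<beta> * real r" using kx C \<beta>0 by (intro mult_left_mono) auto
      finally have "x \<le> C * real r * \<beta> / \<Lambda>" using \<Lambda>pos by (simp add: field_simps)
      then show ?thesis by (simp add: x_def)
    qed
    then show "real (card L) \<le> real r + C * real r * ln (1 / \<alpha>) / ln (ln (real r))"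
      by (simp only: \<beta>_def \<Lambda>_def)
  qed (use \<alpha> in simp_all)
  show ?thesis
  proof (intro exI[of _ C] conjI allI impI; (elim conjE)?)
    show "0 < C" using C by simp
  next
    fix \<alpha> :: real and r k :: nat
    assume "0 < \<alpha>" "\<alpha> < 1" "r \<ge> 1" "spectral_radius_order ((1 - \<alpha>) / (2 * \<alpha>)) = enat k"
      "real r \<ge> 2 powr (1 / \<alpha> powr (C * (real k - 1)))"
    then show "int (max_equiangular_lines \<alpha> r) = \<lfloor>real k / (real k - 1) * (real r - 1)\<rfloor>"
      using exact[of \<alpha> r k] inv_powr by simp
  next
    fix \<alpha> :: real and r k :: nat
    assume "0 < \<alpha>" "\<alpha> < 1" and k: "spectral_radius_order ((1 - \<alpha>) / (2 * \<alpha>)) = enat k"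
      and "2 powr (1 / \<alpha> powr C) \<le> real r" "real r < 2 powr (1 / \<alpha> powr (C * (real k - 1)))"
    then show "real (max_equiangular_lines \<alpha> r) \<le> real r + C * real r * ln (1 / \<alpha>) / ln (ln (real r))"
      using inv_powr by (intro approx) auto
  next
    fix \<alpha> :: real and r :: nat
    assume "0 < \<alpha>" "\<alpha> < 1" "spectral_radius_order ((1 - \<alpha>) / (2 * \<alpha>)) = \<infinity>"
      "real r \<ge> 2 powr (1 / \<alpha> powr C)"
    then show "real (max_equiangular_lines \<alpha> r) \<le> real r + C * real r * ln (1 / \<alpha>) / ln (ln (real r))"
      using inv_powr by (intro approx) auto
  qed
qed

end
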